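(* Let $n\ge 2$ and let $M_1$ and $M_2$ be the sequence-based invariant subspaces of $H^2(\mathbb D^n)$ corresponding to sequences $\{f_l(z_1,\dots,z_{n-1})\}_{l\ge 0}$ and $\{g_l(z_1,\dots,z_{n-1})\}_{l\ge 0}$, respectively. Then $M_1$ and $M_2$ are unitarily equivalent if and only if there exists a unimodular function $h(z_1,\dots,z_{n-1})$, depending only on the variables $z_1,\dots,z_{n-1}$, such that $M_2=hM_1$.
   Context: $\mathbb D$ is the open unit disc, $\mathbb T$ the unit circle. $H^2(\mathbb D^m)$ is the Hardy space of holomorphic functions $f(z)=\sum_{\alpha\in\mathbb Z_+^m}c(\alpha)z^\alpha$ on $\mathbb D^m$ with $\|f\|_2^2=\sum_\alpha|c(\alpha)|^2<\infty$; $f^*$ denotes the radial boundary function, defined a.e. on $\mathbb T^m$, and functions in $H^2(\mathbb D^m)$ are identified with their boundary functions in $L^2(\mathbb T^m)$. $H^\infty(\mathbb D^m)$ is the space of bounded holomorphic functions on $\mathbb D^m$. For $f\in H^\infty(\mathbb D^m)$, "$f^{-1}\in L^\infty(\mathbb T^m)$" means $1/f^*\in L^\infty(\mathbb T^m)$. An invariant subspace of $H^2(\mathbb D^n)$ is a closed linear subspace that is mapped into itself by multiplication by each of $z_1,\dots,z_n$. An invariant subspace $M$ is sequence-based, corresponding to the sequence $\{f_l\}_{l\ge0}$, if $M=\bigoplus_{l\ge 0}f_l(z_1,\dots,z_{n-1})H^2(\mathbb D^{n-1})z_n^l$, where $H^2(\mathbb D^{n-1})$ is the Hardy space in $z_1,\dots,z_{n-1}$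 and (I) $f_l\in H^\infty(\mathbb D^{n-1})$ with $f_l^{-1}\in L^\infty(\mathbb T^{n-1})$ for every $l$; (II) $f_l$ is divisible by $f_{l+1}$ for every $l$, i.e. each quotient $f_l/f_{l+1}$ belongs to $H^\infty(\mathbb D^{n-1})$ and has inverse in $L^\infty(\mathbb T^{n-1})$. Two invariant subspaces $M_1,M_2$ of $H^2(\mathbb D^n)$ are unitarily equivalent if there is a unitary operator $U:M_1\to M_2$ such that $U(\varphi f)=\varphi(Uf)$ for all $\varphi\in H^\infty(\mathbb D^n)$ and $f\in M_1$. A unimodular function is a measurable function $h$ on the torus $\mathbb T^n$ with $|h|=1$ a.e.; the equality $M_2=hM_1$ is understood for boundary functions on $\mathbb T^n$. *)

theory Defs
  imports "HOL-Analysis.Analysis"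
begin

text \<open>
  Points of \<open>\<complex>\<^sup>n\<close> are functions \<open>nat \<Rightarrow> complex\<close> that are extensional on \<open>{..<n}\<close>; the coordinate
  \<open>z\<^sub>j\<close> of the usual notation is \<open>z (j - 1)\<close>. Functions on the polydisc are extensional on
  \<open>polydisc n\<close>, so that equality of functions is equality on the polydisc.
\<close>

definition polydisc :: "nat \<Rightarrow> (nat \<Rightarrow> complex) set"
  where "polydisc n = ({..<n} \<rightarrow>\<^sub>E ball 0 1)"

definition multiindices :: "nat \<Rightarrow> (nat \<Rightarrow> nat) set"
  where "multiindices n = ({..<n} \<rightarrow>\<^sub>E UNIV)"

text \<open>Continuity refers to the product topology on \<open>nat \<Rightarrow> complex\<close>, which on \<open>polydisc n\<close> is the
  Euclidean one.\<close>

definition holomorphic_polydisc :: "nat \<Rightarrow> ((nat \<Rightarrow> complex) \<Rightarrow> complex) \<Rightarrow> bool"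
  where "holomorphic_polydisc n f \<longleftrightarrow>
    f \<in> extensional (polydisc n) \<and>
    continuous_on (polydisc n) f \<and>
    (\<forall>z\<in>polydisc n. \<forall>i<n. (\<lambda>w. f (z(i := w))) holomorphic_on ball 0 1)"

definition Hinf :: "nat \<Rightarrow> ((nat \<Rightarrow> complex) \<Rightarrow> complex) set"
  where "Hinf n = {f. holomorphic_polydisc n f \<and> bounded (f ` polydisc n)}"

definition has_power_series ::
    "nat \<Rightarrow> ((nat \<Rightarrow> complex) \<Rightarrow> complex) \<Rightarrow> ((nat \<Rightarrow> nat) \<Rightarrow> complex) \<Rightarrow> bool"
  where "has_power_series n f c \<longleftrightarrow>
    c \<in> extensional (multiindices n) \<and>
    (\<forall>z\<in>polydisc n. ((\<lambda>\<alpha>. c \<alpha> * (\<Prod>i<n. z i ^ \<alpha> i)) has_sum f z) (multiindices n))"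

definition H2 :: "nat \<Rightarrow> ((nat \<Rightarrow> complex) \<Rightarrow> complex) set"
  where "H2 n = {f. holomorphic_polydisc n f \<and>
    (\<exists>c. has_power_series n f c \<and> (\<lambda>\<alpha>. (cmod (c \<alpha>))\<^sup>2) summable_on multiindices n)}"

definition power_coeff :: "nat \<Rightarrow> ((nat \<Rightarrow> complex) \<Rightarrow> complex) \<Rightarrow> (nat \<Rightarrow> nat) \<Rightarrow> complex"
  where "power_coeff n f = (THE c. has_power_series n f c)"

definition H2_inner ::
    "nat \<Rightarrow> ((nat \<Rightarrow> complex) \<Rightarrow> complex) \<Rightarrow> ((nat \<Rightarrow> complex) \<Rightarrow> complex) \<Rightarrow> complex"
  where "H2_inner n f g =
    (\<Sum>\<^sub>\<infinity>\<alpha>\<in>multiindices n. power_coeff n f \<alpha> * cnj (power_coeff n g \<alpha>))"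

definition H2_norm :: "nat \<Rightarrow> ((nat \<Rightarrow> complex) \<Rightarrow> complex) \<Rightarrow> real"
  where "H2_norm n f = sqrt (\<Sum>\<^sub>\<infinity>\<alpha>\<in>multiindices n. (cmod (power_coeff n f \<alpha>))\<^sup>2)"

definition H2_tendsto ::
    "nat \<Rightarrow> (nat \<Rightarrow> (nat \<Rightarrow> complex) \<Rightarrow> complex) \<Rightarrow> ((nat \<Rightarrow> complex) \<Rightarrow> complex) \<Rightarrow> bool"
  where "H2_tendsto n X f \<longleftrightarrow>
    (\<lambda>k. H2_norm n (\<lambda>z\<in>polydisc n. X k z - f z)) \<longlonglongrightarrow> 0"

text \<open>Normalised Lebesgue measure on the circle and on the torus; the underlying space of
  \<open>torus n\<close> is \<open>{..<n} \<rightarrow>\<^sub>E sphere 0 1\<close>.\<close>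

definition circle :: "complex measure"
  where "circle =
    distr (uniform_measure lborel {0..2 * pi}) (restrict_space borel (sphere 0 1)) cis"

definition torus :: "nat \<Rightarrow> (nat \<Rightarrow> complex) measure"
  where "torus n = PiM {..<n} (\<lambda>_. circle)"

text \<open>The radial limit \<open>f\<^sup>*\<close>; its value is unspecified at points where the limit does not exist.\<close>

definition boundary_fun :: "nat \<Rightarrow> ((nat \<Rightarrow> complex) \<Rightarrow> complex) \<Rightarrow> (nat \<Rightarrow> complex) \<Rightarrow> complex"
  where "boundary_fun n f \<zeta> =
    Lim (at_left 1) (\<lambda>r::real. f (\<lambda>i\<in>{..<n}. complex_of_real r * \<zeta> i))"

definition Linf :: "nat \<Rightarrow> ((nat \<Rightarrow> complex) \<Rightarrow> complex) set"
  where "Linf n = {F \<in> borel_measurable (torus n). \<exists>C. AE \<zeta> in torus n. cmod (F \<zeta>) \<le> C}"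

text \<open>\<open>f\<^sup>-\<^sup>1 \<in> L\<^sup>\<infinity>\<close>. Since \<open>1 / 0 = 0\<close> in HOL, it must be said separately that \<open>f\<^sup>*\<close> vanishes almost
  nowhere.\<close>

definition inverse_in_Linf :: "nat \<Rightarrow> ((nat \<Rightarrow> complex) \<Rightarrow> complex) \<Rightarrow> bool"
  where "inverse_in_Linf n f \<longleftrightarrow>
    (AE \<zeta> in torus n. boundary_fun n f \<zeta> \<noteq> 0) \<and> (\<lambda>\<zeta>. 1 / boundary_fun n f \<zeta>) \<in> Linf n"

definition closed_subspace :: "nat \<Rightarrow> ((nat \<Rightarrow> complex) \<Rightarrow> complex) set \<Rightarrow> bool"
  where "closed_subspace n M \<longleftrightarrow>
    M \<subseteq> H2 n \<and>
    (\<lambda>z\<in>polydisc n. 0) \<in> M \<and>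
    (\<forall>f\<in>M. \<forall>g\<in>M. (\<lambda>z\<in>polydisc n. f z + g z) \<in> M) \<and>
    (\<forall>a. \<forall>f\<in>M. (\<lambda>z\<in>polydisc n. a * f z) \<in> M) \<and>
    (\<forall>X. \<forall>f\<in>H2 n. (\<forall>k. X k \<in> M) \<longrightarrow> H2_tendsto n X f \<longrightarrow> f \<in> M)"

definition invariant_subspace :: "nat \<Rightarrow> ((nat \<Rightarrow> complex) \<Rightarrow> complex) set \<Rightarrow> bool"
  where "invariant_subspace n M \<longleftrightarrow>
    closed_subspace n M \<and> (\<forall>i<n. \<forall>f\<in>M. (\<lambda>z\<in>polydisc n. z i * f z) \<in> M)"

text \<open>The subspace \<open>f(z\<^sub>1,\<dots>,z\<^sub>n\<^sub>-\<^sub>1) H\<^sup>2(\<D>\<^sup>n\<^sup>-\<^sup>1) z\<^sub>n\<^sup>l\<close> of \<open>H\<^sup>2(\<D>\<^sup>n)\<close>.\<close>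

definition layer ::
    "nat \<Rightarrow> ((nat \<Rightarrow> complex) \<Rightarrow> complex) \<Rightarrow> nat \<Rightarrow> ((nat \<Rightarrow> complex) \<Rightarrow> complex) set"
  where "layer n f l =
    {\<lambda>z\<in>polydisc n. f (restrict z {..<n - 1}) * u (restrict z {..<n - 1}) * z (n - 1) ^ l
     | u. u \<in> H2 (n - 1)}"

text \<open>Hilbert space direct sum of a sequence of subspaces of \<open>H\<^sup>2(\<D>\<^sup>n)\<close>: the summands are pairwise
  orthogonal, and the sum consists of all norm convergent series of elements of the summands.\<close>

definition direct_sum ::
    "nat \<Rightarrow> (nat \<Rightarrow> ((nat \<Rightarrow> complex) \<Rightarrow> complex) set) \<Rightarrow> ((nat \<Rightarrow> complex) \<Rightarrow> complex) set"
  where "direct_sum n E =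
    {F \<in> H2 n. \<exists>x. (\<forall>l. x l \<in> E l) \<and> H2_tendsto n (\<lambda>N. \<lambda>z\<in>polydisc n. \<Sum>l<N. x l z) F}"

definition is_direct_sum ::
    "nat \<Rightarrow> ((nat \<Rightarrow> complex) \<Rightarrow> complex) set \<Rightarrow>
      (nat \<Rightarrow> ((nat \<Rightarrow> complex) \<Rightarrow> complex) set) \<Rightarrow> bool"
  where "is_direct_sum n M E \<longleftrightarrow>
    (\<forall>k l. k \<noteq> l \<longrightarrow> (\<forall>x\<in>E k. \<forall>y\<in>E l. H2_inner n x y = 0)) \<and> M = direct_sum n E"

text \<open>Divisibility of \<open>f\<close> by \<open>g\<close>. As \<open>g\<close> may have zeros in the polydisc, the quotient is
  the holomorphic function \<open>q\<close> with \<open>f = g q\<close> rather than the pointwise HOL quotient.\<close>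

definition divisible_by ::
    "nat \<Rightarrow> ((nat \<Rightarrow> complex) \<Rightarrow> complex) \<Rightarrow> ((nat \<Rightarrow> complex) \<Rightarrow> complex) \<Rightarrow> bool"
  where "divisible_by m f g \<longleftrightarrow>
    (\<exists>q\<in>Hinf m. inverse_in_Linf m q \<and> (\<forall>z\<in>polydisc m. f z = g z * q z))"

definition sequence_based ::
    "nat \<Rightarrow> ((nat \<Rightarrow> complex) \<Rightarrow> complex) set \<Rightarrow> (nat \<Rightarrow> (nat \<Rightarrow> complex) \<Rightarrow> complex) \<Rightarrow> bool"
  where "sequence_based n M f \<longleftrightarrow>
    invariant_subspace n M \<and>
    is_direct_sum n M (\<lambda>l. layer n (f l) l) \<and>
    (\<forall>l. f l \<in> Hinf (n - 1) \<and> inverse_in_Linf (n - 1) (f l)) \<and>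
    (\<forall>l. divisible_by (n - 1) (f l) (f (Suc l)))"

definition unitary_operator ::
    "nat \<Rightarrow> ((nat \<Rightarrow> complex) \<Rightarrow> complex) set \<Rightarrow> ((nat \<Rightarrow> complex) \<Rightarrow> complex) set \<Rightarrow>
      (((nat \<Rightarrow> complex) \<Rightarrow> complex) \<Rightarrow> ((nat \<Rightarrow> complex) \<Rightarrow> complex)) \<Rightarrow> bool"
  where "unitary_operator n M1 M2 U \<longleftrightarrow>
    bij_betw U M1 M2 \<and>
    (\<forall>f\<in>M1. \<forall>g\<in>M1. U (\<lambda>z\<in>polydisc n. f z + g z) = (\<lambda>z\<in>polydisc n. U f z + U g z)) \<and>
    (\<forall>a. \<forall>f\<in>M1. U (\<lambda>z\<in>polydisc n. a * f z) = (\<lambda>z\<in>polydisc n. a * U f z)) \<and>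
    (\<forall>f\<in>M1. \<forall>g\<in>M1. H2_inner n (U f) (U g) = H2_inner n f g)"

definition unitarily_equivalent ::
    "nat \<Rightarrow> ((nat \<Rightarrow> complex) \<Rightarrow> complex) set \<Rightarrow> ((nat \<Rightarrow> complex) \<Rightarrow> complex) set \<Rightarrow> bool"
  where "unitarily_equivalent n M1 M2 \<longleftrightarrow>
    (\<exists>U. unitary_operator n M1 M2 U \<and>
      (\<forall>\<phi>\<in>Hinf n. \<forall>f\<in>M1.
        U (\<lambda>z\<in>polydisc n. \<phi> z * f z) = (\<lambda>z\<in>polydisc n. \<phi> z * U f z)))"

definition unimodular :: "nat \<Rightarrow> ((nat \<Rightarrow> complex) \<Rightarrow> complex) \<Rightarrow> bool"
  where "unimodular n h \<longleftrightarrow>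
    h \<in> borel_measurable (torus n) \<and> (AE \<zeta> in torus n. cmod (h \<zeta>) = 1)"

definition depends_only_on :: "nat \<Rightarrow> nat set \<Rightarrow> ((nat \<Rightarrow> complex) \<Rightarrow> complex) \<Rightarrow> bool"
  where "depends_only_on n I h \<longleftrightarrow>
    (\<forall>\<zeta>\<in>space (torus n). \<forall>\<xi>\<in>space (torus n). (\<forall>i\<in>I. \<zeta> i = \<xi> i) \<longrightarrow> h \<zeta> = h \<xi>)"

text \<open>\<open>M\<^sub>2 = h M\<^sub>1\<close> as sets of almost-everywhere classes of boundary functions.\<close>

definition boundary_multiple ::
    "nat \<Rightarrow> ((nat \<Rightarrow> complex) \<Rightarrow> complex) set \<Rightarrow> ((nat \<Rightarrow> complex) \<Rightarrow> complex) \<Rightarrow>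
      ((nat \<Rightarrow> complex) \<Rightarrow> complex) set \<Rightarrow> bool"
  where "boundary_multiple n M2 h M1 \<longleftrightarrow>
    (\<forall>f\<in>M1. \<exists>g\<in>M2. AE \<zeta> in torus n. boundary_fun n g \<zeta> = h \<zeta> * boundary_fun n f \<zeta>) \<and>
    (\<forall>g\<in>M2. \<exists>f\<in>M1. AE \<zeta> in torus n. boundary_fun n g \<zeta> = h \<zeta> * boundary_fun n f \<zeta>)"

end

theory Submission
  imports Defs "HOL-Complex_Analysis.Complex_Analysis" "HOL-Probability.Probability"
begin

text \<open>
  A function in the Hardy space is determined by its boundary function on the torus, and inner
  products can be computed there. A unimodular function \<open>h\<close> with \<open>M2 = h M1\<close> therefore defines a
  unitary operator by multiplication of boundary functions. It commutes with multiplication by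
  bounded holomorphic functions (\<open>unitary_from_unimodular\<close>), since invariant subspaces are stable
  under these (\<open>invariant_subspace_Hinf_mult\<close>).

  Conversely, let \<open>U\<close> be a unitary equivalence. It preserves the inner products of all monomial
  multiples of two elements \<open>x\<close> and \<open>y\<close>, and these are the Fourier coefficients of
  \<open>x\<^sup>* * cnj y\<^sup>*\<close>. Hence this product does not change when \<open>x\<close> and \<open>y\<close> are replaced by \<open>U x\<close>
  and \<open>U y\<close> (\<open>unitary_boundary_relation\<close>). Taking for \<open>y\<close> the function \<open>f 0\<close>, an element of
  \<open>M1\<close> whose boundary function vanishes almost nowhere, one finds that \<open>U\<close> is multiplication by the
  unimodular quotient \<open>h\<close> of the boundary functions of \<open>U y\<close> and \<open>y\<close>. In this quotient the numerator
  has no negative frequencies in the last variable, and the denominator does not depend on that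
  variable and has a bounded inverse, so \<open>h\<close> has no negative frequencies in the last variable.
  The preimage of \<open>g 0\<close> shows in the same way that \<open>cnj h\<close> has none. Thus only the frequency
  \<open>0\<close> occurs in the last variable, and \<open>h\<close> equals its average over it (\<open>last_variable_independent\<close>).

  Four facts of harmonic analysis carry this argument. Functions on the polydisc that are continuous
  and holomorphic in each variable have power series (\<open>holomorphic_polydisc_has_power_series\<close>).
  Radial limits exist almost everywhere (\<open>radial_limit_exists\<close>) and the radial maximal function is
  square integrable (\<open>radial_sup_integral\<close>). The maximal inequality behind this is proved directly on
  the torus, for Poisson means along the orbits of the diagonal rotations. Inner products are
  integrals over the torus (\<open>H2_inner_bdry\<close>). An integrable function on the torus is determined by its
  Fourier coefficients (\<open>null_coeffs_imp_AE_0\<close>).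
\<close>

section \<open>The circle\<close>

lemma space_circle [simp]: "space circle = sphere 0 1"
  by (simp add: circle_def space_restrict_space)

lemma sets_circle [measurable_cong]: "sets circle = sets (restrict_space borel (sphere 0 1))"
  by (simp add: circle_def)

lemma measurable_cis_circle [measurable]: "cis \<in> borel \<rightarrow>\<^sub>M restrict_space borel (sphere 0 1)"
  by (rule measurable_restrict_space2)
    (auto intro!: borel_measurable_continuous_onI continuous_intros simp: cis_conv_exp)

lemma prob_space_circle: "prob_space circle"
  unfolding circle_def
  by (intro prob_space.prob_space_distr prob_space_uniform_measure) auto

lemma borel_measurable_circle_continuous:
  fixes f :: "complex \<Rightarrow> 'a::topological_space"
  assumes "continuous_on (sphere 0 1) f"
  shows "f \<in> borel_measurable circle"
  using borel_measurable_continuous_on_restrict[OF assms]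
  by (simp add: measurable_cong_sets[OF sets_circle refl])

text \<open>The half-open interval parametrises the circle injectively, so that rotations become shifts
  modulo a period.\<close>

lemma nn_integral_circle:
  assumes [measurable]: "f \<in> borel_measurable circle"
  shows "(\<integral>\<^sup>+w. f w \<partial>circle) = (\<integral>\<^sup>+t. f (cis t) * indicator {0..<2*pi} t \<partial>lborel) / ennreal (2 * pi)"
proof -
  have [measurable]: "f \<in> borel_measurable (restrict_space borel (sphere 0 1))"
    using assms by (simp add: measurable_cong_sets[OF sets_circle refl])
  have "(\<integral>\<^sup>+w. f w \<partial>circle) = (\<integral>\<^sup>+t. f (cis t) * indicator {0..2*pi} t \<partial>lborel) / ennreal (2 * pi)"
    unfolding circle_def
    by (subst nn_integral_distr, measurable, subst nn_integral_uniform_measure)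
      auto
  also have "(\<integral>\<^sup>+t. f (cis t) * indicator {0..2*pi} t \<partial>lborel) = (\<integral>\<^sup>+t. f (cis t) * indicator {0..<2*pi} t \<partial>lborel)"
  proof (rule nn_integral_cong_AE)
    have "AE t in lborel. t \<noteq> 2 * pi"
      by (rule AE_lborel_singleton)
    then show "AE t in lborel. f (cis t) * indicator {0..2*pi} t = f (cis t) * indicator {0..<2*pi} t"
      by eventually_elim (auto split: split_indicator)
  qed
  finally show ?thesis .
qed

text \<open>The part of the shifted period that sticks out beyond \<open>2 * pi\<close> is moved back by one period.\<close>

lemma nn_integral_periodic_shift:
  fixes g :: "real \<Rightarrow> ennreal"
  assumes [measurable]: "g \<in> borel_measurable borel" and per: "\<And>t. g (t + 2*pi) = g t"
    and a: "0 \<le> a" "a \<le> 2*pi"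
  shows "(\<integral>\<^sup>+t. g (a + t) * indicator {0..<2*pi} t \<partial>lborel) = (\<integral>\<^sup>+t. g t * indicator {0..<2*pi} t \<partial>lborel)"
proof -
  have "(\<integral>\<^sup>+t. g t * indicator {a..<a + 2*pi} t \<partial>lborel) =
        (\<integral>\<^sup>+t. g (a + t) * indicator {0..<2*pi} t \<partial>lborel)"
    by (subst nn_integral_real_affine[where c=1 and t=a])
      (auto intro!: nn_integral_cong split: split_indicator)
  moreover have "(\<integral>\<^sup>+t. g t * indicator {2*pi..<a + 2*pi} t \<partial>lborel) = (\<integral>\<^sup>+t. g t * indicator {0..<a} t \<partial>lborel)"
    by (subst nn_integral_real_affine[where c=1 and t="2*pi"])
      (use per in \<open>auto intro!: nn_integral_cong split: split_indicator simp: add.commute\<close>)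
  moreover have "(\<integral>\<^sup>+t. g t * indicator {a..<a + 2*pi} t \<partial>lborel) =
     (\<integral>\<^sup>+t. g t * indicator {a..<2*pi} t \<partial>lborel) + (\<integral>\<^sup>+t. g t * indicator {2*pi..<a + 2*pi} t \<partial>lborel)"
    using a by (subst nn_integral_add[symmetric]) (auto intro!: nn_integral_cong split: split_indicator)
  moreover have "(\<integral>\<^sup>+t. g t * indicator {0..<2*pi} t \<partial>lborel) =
     (\<integral>\<^sup>+t. g t * indicator {a..<2*pi} t \<partial>lborel) + (\<integral>\<^sup>+t. g t * indicator {0..<a} t \<partial>lborel)"
    using a by (subst nn_integral_add[symmetric]) (auto intro!: nn_integral_cong split: split_indicator)
  ultimately show ?thesis by simp
qed

lemma measurable_circle_mult [measurable]:
  "cmod u = 1 \<Longrightarrow> (\<lambda>w. u * w) \<in> circle \<rightarrow>\<^sub>M circle"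
  unfolding measurable_cong_sets[OF sets_circle sets_circle]
  by (rule measurable_restrict_space3) (auto simp: norm_mult)

lemma measurable_circle_cnj [measurable]: "cnj \<in> circle \<rightarrow>\<^sub>M circle"
  unfolding measurable_cong_sets[OF sets_circle sets_circle]
  by (rule measurable_restrict_space3) (auto intro!: borel_measurable_continuous_onI continuous_intros)

lemma borel_measurable_circle_cis:
  assumes "f \<in> borel_measurable circle"
  shows "(\<lambda>t. f (cis t)) \<in> borel_measurable borel"
  using measurable_compose[OF measurable_cis_circle, of f] assms
  by (simp add: measurable_cong_sets[OF sets_circle refl])

lemma nn_integral_circle_rotate:
  assumes u: "cmod u = 1" and f [measurable]: "f \<in> borel_measurable circle"
  shows "(\<integral>\<^sup>+w. f (u * w) \<partial>circle) = (\<integral>\<^sup>+w. f w \<partial>circle)"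
proof -
  define a where "a = Arg2pi u"
  have a: "0 \<le> a" "a \<le> 2*pi" "u = cis a"
    using Arg2pi[of u] u by (auto simp: a_def cis_conv_exp is_Arg_def mult_ac)
  have m: "(\<lambda>w. f (u * w)) \<in> borel_measurable circle"
    using measurable_compose[OF measurable_circle_mult[OF u] f] .
  show ?thesis
    unfolding nn_integral_circle[OF f] nn_integral_circle[OF m]
    unfolding a(3) cis_mult
    by (subst nn_integral_periodic_shift[OF _ _ a(1,2)])
      (auto intro: borel_measurable_circle_cis[OF f] simp: cis_mult[symmetric])
qed

lemma cis_2pi_minus: "cis (2*pi - t) = cis (- t)"
  using cis_mult[of "2*pi" "- t"] by simp

lemma nn_integral_circle_cnj:
  assumes f [measurable]: "f \<in> borel_measurable circle"
  shows "(\<integral>\<^sup>+w. f (cnj w) \<partial>circle) = (\<integral>\<^sup>+w. f w \<partial>circle)"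
proof -
  have m: "(\<lambda>w. f (cnj w)) \<in> borel_measurable circle"
    using measurable_compose[OF measurable_circle_cnj f] .
  have [measurable]: "(\<lambda>t. f (cis t)) \<in> borel_measurable borel"
    by (rule borel_measurable_circle_cis[OF f])
  have "(\<integral>\<^sup>+t. f (cis t) * indicator {0..<2*pi} t \<partial>lborel) =
        (\<integral>\<^sup>+t. f (cis (- t)) * indicator {0<..2*pi} t \<partial>lborel)"
    by (subst nn_integral_real_affine[where c="-1" and t="2*pi"])
      (auto intro!: nn_integral_cong split: split_indicator simp: cis_2pi_minus)
  also have "\<dots> = (\<integral>\<^sup>+t. f (cis (- t)) * indicator {0..<2*pi} t \<partial>lborel)"
  proof (rule nn_integral_cong_AE)
    have "AE t in lborel. t \<noteq> 2 * pi" "AE t in lborel. t \<noteq> (0::real)"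
      by (rule AE_lborel_singleton)+
    then show "AE t in lborel. f (cis (-t)) * indicator {0<..2*pi} t = f (cis (-t)) * indicator {0..<2*pi} t"
      by eventually_elim (auto split: split_indicator)
  qed
  finally show ?thesis
    unfolding nn_integral_circle[OF f] nn_integral_circle[OF m] by (simp add: cis_cnj)
qed

lemma distr_circle_rotate:
  assumes u: "cmod u = 1"
  shows "distr circle circle (\<lambda>w. u * w) = circle"
proof (rule measure_eqI)
  fix A assume "A \<in> sets (distr circle circle ((*) u))"
  then have [measurable]: "A \<in> sets circle" by simp
  note [measurable] = measurable_circle_mult[OF u]
  have "emeasure (distr circle circle (\<lambda>w. u * w)) A = (\<integral>\<^sup>+w. indicator A (u * w) \<partial>circle)"
    by (subst nn_integral_distr[symmetric, where M=circle and M'=circle]) (auto)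
  also have "\<dots> = emeasure circle A"
    by (subst nn_integral_circle_rotate[OF u]) auto
  finally show "emeasure (distr circle circle (\<lambda>w. u * w)) A = emeasure circle A" .
qed auto

lemma integrable_circle_continuous:
  fixes f :: "complex \<Rightarrow> complex"
  assumes "continuous_on (sphere 0 1) f"
  shows "integrable circle f"
proof -
  interpret prob_space circle by (rule prob_space_circle)
  have "bounded (f ` sphere 0 1)"
    by (intro compact_imp_bounded compact_continuous_image assms) auto
  then obtain B where "\<forall>x\<in>sphere 0 1. cmod (f x) \<le> B" by (auto simp: bounded_iff)
  then show ?thesis
    by (intro integrable_const_bound[where B=B] borel_measurable_circle_continuous assms) auto
qed

text \<open>The parameter interval is rescaled to \<open>{0..1}\<close>, the domain of \<open>circlepath\<close>: this links
  \<open>circle\<close> to contour integrals.\<close>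

lemma integral_circle_continuous:
  fixes f :: "complex \<Rightarrow> complex"
  assumes f: "continuous_on (sphere 0 1) f"
  shows "((\<lambda>t. f (cis (2 * pi * t))) has_integral (LINT w|circle. f w)) {0..1}"
proof -
  have c: "continuous_on X (\<lambda>t. f (cis (h t)))" if "continuous_on X h" for X and h :: "real \<Rightarrow> real"
    by (rule continuous_on_compose2[OF f])
      (auto intro!: continuous_intros that simp: cis_conv_exp)
  have [measurable]: "(\<lambda>t. f (cis t)) \<in> borel_measurable borel"
    by (intro borel_measurable_continuous_onI c continuous_intros)
  have fm: "f \<in> borel_measurable (restrict_space borel (sphere 0 1))"
    using borel_measurable_circle_continuous[OF f] by (simp add: measurable_cong_sets[OF sets_circle refl])
  have "(LINT w|circle. f w) = (LINT t|uniform_measure lborel {0..2 * pi}. f (cis t))"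
    unfolding circle_def by (rule integral_distr) (auto intro: fm)
  also have "\<dots> = (LINT t|lborel. (indicator {0..2*pi} t / (2*pi)) *\<^sub>R f (cis t))"
  proof -
    have "uniform_measure lborel {0..2 * pi} = density lborel (\<lambda>t. ennreal (indicator {0..2*pi} t / (2*pi)))"
      unfolding uniform_measure_def
      by (intro density_cong) (auto split: split_indicator simp: divide_ennreal[symmetric] ennreal_divide_times ennreal_1[symmetric] simp del: ennreal_1)
    then show ?thesis by (simp add: integral_density)
  qed
  also have "\<dots> = (LINT t:{0..1}|lborel. f (cis (2 * pi * t)))"
    unfolding set_lebesgue_integral_def
    apply (subst lborel_integral_real_affine[where c="2*pi" and t=0])
     apply simp
    apply (subst integral_scaleR_right[symmetric])
    apply (rule Bochner_Integration.integral_cong)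
    apply (auto split: split_indicator simp: zero_le_mult_iff mult_le_cancel_left1 not_le[THEN iffD2, OF pi_gt_zero])
    done
  finally have 1: "(LINT w|circle. f w) = (LINT t:{0..1}|lborel. f (cis (2 * pi * t)))" .
  have "set_integrable lborel {0..1} (\<lambda>t. f (cis (2 * pi * t)))"
    unfolding set_integrable_def by (intro borel_integrable_compact c continuous_intros) auto
  then show ?thesis
    unfolding 1 by (simp add: set_borel_integral_eq_integral has_integral_integral[symmetric])
qed

text \<open>On the unit circle \<open>1 / w = cnj w\<close>, so Cauchy's formula says that the Szego kernel
  \<open>1 / (1 - z * cnj w)\<close> reproduces the values of \<open>f\<close>.\<close>

lemma Cauchy_integral_circle:
  assumes cont: "continuous_on (cball 0 1) f" and hol: "f holomorphic_on ball 0 1" and z: "cmod z < 1"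
  shows "(LINT w|circle. f w / (1 - z * cnj w)) = f z"
proof -
  have nz: "1 - z * cnj w \<noteq> 0" if "cmod w = 1" for w
  proof
    assume "1 - z * cnj w = 0"
    then have "cmod (z * cnj w) = 1" by (metis eq_iff_diff_eq_0 norm_one)
    then show False using z that by (simp add: norm_mult)
  qed
  have "((\<lambda>u. f u/(u-z)) has_contour_integral (2 * of_real pi * \<i> * f z)) (circlepath 0 1)"
    by (rule Cauchy_integral_circlepath[OF cont hol]) (use z in auto)
  then have "((\<lambda>t. f (cis (2*pi*t)) / (cis (2*pi*t) - z) * (2*pi*\<i>*cis (2*pi*t))) has_integral (2 * of_real pi * \<i> * f z)) {0..1}"
    unfolding has_contour_integral_def
    by (rule has_integral_eq_rhs[OF has_integral_eq, rotated])
       (simp_all add: vector_derivative_circlepath01, simp_all add: circlepath cis_conv_exp mult_ac)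
  from has_integral_mult_right[OF this, of "1 / (2 * of_real pi * \<i>)"]
  have 1: "((\<lambda>t. f (cis (2*pi*t)) / (1 - z * cnj (cis (2*pi*t)))) has_integral f z) {0..1}"
  proof (rule has_integral_eq_rhs[OF has_integral_eq, rotated])
    fix t :: real
    define w where "w = cis (2*pi*t)"
    have w: "cmod w = 1" "w \<noteq> 0" by (auto simp: w_def)
    have "w * cnj w = 1" using w by (simp add: complex_norm_square[symmetric])
    then have "w * (1 - z * cnj w) = w - z" by (simp add: algebra_simps)
    moreover have "w \<noteq> z" using w z by auto
    ultimately show "1 / (2 * complex_of_real pi * \<i>) * (f (cis (2*pi*t)) / (cis (2*pi*t) - z) * (complex_of_real (2*pi)*\<i>*cis (2*pi*t))) =
         f (cis (2*pi*t)) / (1 - z * cnj (cis (2*pi*t)))"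
      unfolding w_def[symmetric] using nz[OF w(1)] w(2) by (auto simp: field_simps)
  qed simp
  have "continuous_on (sphere 0 1) (\<lambda>w. f w / (1 - z * cnj w))"
    using nz by (intro continuous_intros continuous_on_subset[OF cont]) auto
  from has_integral_unique[OF integral_circle_continuous[OF this] 1] show ?thesis .
qed

lemma circle_mean_value:
  assumes "continuous_on (cball 0 1) f" "f holomorphic_on ball 0 1"
  shows "(LINT w|circle. f w) = f 0"
  using Cauchy_integral_circle[OF assms, of 0] by simp

text \<open>Since \<open>w * cnj w = 1\<close> on the circle, the integrand is a power of \<open>w\<close> or the conjugate of one,
  to which the mean value property applies.\<close>

lemma integral_circle_monomials:
  "(LINT w|circle. w ^ a * cnj w ^ b) = (if a = b then 1 else 0)"
proof -
  interpret prob_space circle by (rule prob_space_circle)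
  have 1: "(LINT w|circle. w ^ k) = (if k = 0 then 1 else 0)" for k
    by (subst circle_mean_value) (auto intro!: continuous_intros holomorphic_intros simp: power_0_left)
  have w: "w * cnj w = 1" if "cmod w = 1" for w
    using that by (simp add: complex_norm_square[symmetric])
  show ?thesis
  proof (cases "b \<le> a")
    case True
    have "(LINT w|circle. w ^ a * cnj w ^ b) = (LINT w|circle. w ^ (a - b))"
    proof (rule Bochner_Integration.integral_cong)
      fix w assume "w \<in> space circle"
      then have "(w * cnj w) ^ b = 1" using w[of w] by simp
      moreover have "w ^ a * cnj w ^ b = (w * cnj w) ^ b * w ^ (a - b)"
        using power_add[of w b "a - b"] True by (simp add: power_mult_distrib mult_ac)
      ultimately show "w ^ a * cnj w ^ b = w ^ (a - b)" by simp
    qed simp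
    then show ?thesis using True by (simp add: 1)
  next
    case False
    have "(LINT w|circle. w ^ a * cnj w ^ b) = (LINT w|circle. cnj (w ^ (b - a)))"
    proof (rule Bochner_Integration.integral_cong)
      fix w assume "w \<in> space circle"
      then have "(w * cnj w) ^ a = 1" using w[of w] by simp
      moreover have "w ^ a * cnj w ^ b = (w * cnj w) ^ a * cnj (w ^ (b - a))"
        using power_add[of "cnj w" a "b - a"] False by (simp add: power_mult_distrib mult_ac)
      ultimately show "w ^ a * cnj w ^ b = cnj (w ^ (b - a))" by simp
    qed simp
    then show ?thesis using False by (simp add: 1 del: complex_cnj_power)
  qed
qed

section \<open>The Poisson kernel\<close>

definition poisson :: "complex \<Rightarrow> real"
  where "poisson z = (1 - (cmod z)\<^sup>2) / (cmod (1 - z))\<^sup>2"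

lemma poisson_nonneg: "cmod z \<le> 1 \<Longrightarrow> poisson z \<ge> 0"
  by (simp add: poisson_def power_le_one)

lemma poisson_cnj [simp]: "poisson (cnj z) = poisson z"
  unfolding poisson_def by (metis complex_cnj_diff complex_cnj_one complex_mod_cnj)

lemma borel_measurable_poisson [measurable]: "poisson \<in> borel_measurable borel"
  unfolding poisson_def by measurable

lemma continuous_on_poisson: "cmod a < 1 \<Longrightarrow> continuous_on (sphere 0 1) (\<lambda>w. poisson (a * w))"
  unfolding poisson_def
proof (intro continuous_intros ballI)
  fix w :: complex assume "cmod a < 1" "w \<in> sphere 0 1"
  then have "cmod (a * w) < 1" by (simp add: norm_mult)
  then show "(cmod (1 - a * w))\<^sup>2 \<noteq> 0" by auto
qed

text \<open>This is Cauchy's formula at the point \<open>r\<close> for \<open>f w * (1 - r\<^sup>2) / (1 - r * w)\<close>, a function that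
  has the value \<open>f r\<close> there: on the circle its denominator and the Cauchy kernel multiply up to
  \<open>(cmod (1 - r * w))\<^sup>2\<close>.\<close>

lemma poisson_integral:
  assumes cont: "continuous_on (cball 0 1) f" and hol: "f holomorphic_on ball 0 1" and r: "0 \<le> r" "r < 1"
  shows "(LINT w|circle. of_real (poisson (of_real r * w)) * f w) = f (of_real r)"
proof -
  define g where "g w = f w * (1 - (of_real r)\<^sup>2) / (1 - of_real r * w)" for w
  have nz: "1 - of_real r * w \<noteq> 0" if "cmod w \<le> 1" for w
  proof
    assume "1 - of_real r * w = 0"
    then have "cmod (of_real r * w) = 1" by (metis eq_iff_diff_eq_0 norm_one)
    moreover have "r * cmod w \<le> r * 1" using that r by (intro mult_left_mono) auto
    ultimately show False using r by (simp add: norm_mult)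
  qed
  have "continuous_on (cball 0 1) g" "g holomorphic_on ball 0 1"
    unfolding g_def using nz by (auto intro!: continuous_intros holomorphic_intros cont hol)
  from Cauchy_integral_circle[OF this, of "of_real r"] r
  have "(LINT w|circle. g w / (1 - of_real r * cnj w)) = g (of_real r)" by simp
  also have "g (of_real r) = f (of_real r)"
    using nz[of "of_real r"] r by (simp add: g_def power2_eq_square)
  also have "(LINT w|circle. g w / (1 - of_real r * cnj w)) = (LINT w|circle. of_real (poisson (of_real r * w)) * f w)"
  proof (rule Bochner_Integration.integral_cong)
    fix w assume "w \<in> space circle"
    then have w: "cmod w = 1" by simp
    have "of_real ((cmod (1 - of_real r * w))\<^sup>2) = (1 - of_real r * w) * (1 - of_real r * cnj w)"
      by (simp only: complex_norm_square) simp
    then show "g w / (1 - of_real r * cnj w) = of_real (poisson (of_real r * w)) * f w"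
      using w r unfolding g_def poisson_def by (simp add: norm_mult)
  qed simp
  finally show ?thesis .
qed

lemma poisson_eq_Re:
  assumes "cmod z < 1"
  shows "poisson z = Re ((1 + z) / (1 - z))"
proof -
  have "(1 + z) / (1 - z) = (1 + z) * cnj (1 - z) / of_real ((cmod (1 - z))\<^sup>2)"
    by (subst complex_div_cnj) simp
  moreover have "Re ((1 + z) * cnj (1 - z)) = 1 - (cmod z)\<^sup>2"
    unfolding cmod_power2 by (simp add: algebra_simps power2_eq_square)
  ultimately show ?thesis by (simp add: poisson_def Re_divide_of_real)
qed

text \<open>As a function of \<open>w\<close> the second factor is the real part of a function holomorphic near the closed
  disc, which is reproduced by the Poisson integral of the first factor.\<close>

lemma poisson_semigroup:
  assumes r: "0 \<le> r" "r < 1" and s: "0 \<le> s" "s < 1" and x: "cmod x = 1"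
  shows "(LINT w|circle. poisson (of_real r * w) * poisson (of_real s * (x * w))) = poisson (of_real (r * s) * x)"
proof -
  define f where "f w = (1 + of_real s * (x * w)) / (1 - of_real s * (x * w))" for w
  have lt: "cmod (of_real s * (x * w)) < 1" if "cmod w \<le> 1" for w
    using mult_left_mono[OF that s(1)] s x by (simp add: norm_mult)
  have nz: "1 - of_real s * (x * w) \<noteq> 0" if "cmod w \<le> 1" for w
    using lt[OF that] by auto
  have f: "continuous_on (cball 0 1) f" "f holomorphic_on ball 0 1"
    unfolding f_def using nz by (auto intro!: continuous_intros holomorphic_intros)
  have int: "integrable circle (\<lambda>w. of_real (poisson (of_real r * w)) * f w)"
    using r by (intro integrable_circle_continuous continuous_intros continuous_on_poisson continuous_on_subset[OF f(1)]) auto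
  have "poisson (of_real (r * s) * x) = Re (f (of_real r))"
    using r by (subst poisson_eq_Re) (use lt[of "of_real r"] in \<open>auto simp: f_def mult_ac norm_mult\<close>)
  also have "f (of_real r) = (LINT w|circle. of_real (poisson (of_real r * w)) * f w)"
    by (rule poisson_integral[OF f r, symmetric])
  also have "Re \<dots> = (LINT w|circle. Re (of_real (poisson (of_real r * w)) * f w))"
    using int by (rule integral_Re[symmetric])
  also have "\<dots> = (LINT w|circle. poisson (of_real r * w) * poisson (of_real s * (x * w)))"
  proof (rule Bochner_Integration.integral_cong)
    fix w assume "w \<in> space circle"
    then have "Re (f w) = poisson (of_real s * (x * w))"
      using lt[of w] by (simp add: poisson_eq_Re f_def)
    then show "Re (of_real (poisson (of_real r * w)) * f w) = poisson (of_real r * w) * poisson (of_real s * (x * w))"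
      by simp
  qed simp
  finally show ?thesis by simp
qed

text \<open>Moving the point \<open>r * x\<close> towards the origin to \<open>r * s * x\<close> at most halves its distance to \<open>1\<close>,
  because \<open>1 - s \<le> 1 - r * s\<close>, and it at most doubles the numerator of the kernel.\<close>

lemma poisson_mult_le_aux:
  assumes "0 \<le> r" "r \<le> s" "s < 1" "cmod x = 1"
  shows "poisson (of_real (r * s) * x) \<le> 8 * poisson (of_real r * x)"
proof -
  define w where "w = of_real r * x"
  have w: "cmod w = r" using assms by (simp add: w_def norm_mult)
  have e: "of_real (r * s) * x = of_real s * w" by (simp add: w_def)
  have "1 - s * r \<le> cmod (1 - of_real s * w)"
    using norm_triangle_ineq2[of 1 "of_real s * w"] assms w by (simp add: norm_mult)
  moreover have "s * r \<le> s" using assms by (simp add: mult_left_le)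
  moreover have "cmod (1 - w) \<le> cmod (1 - of_real s * w) + cmod (of_real s * w - w)"
    using norm_triangle_ineq[of "1 - of_real s * w" "of_real s * w - w"] by simp
  moreover have "cmod (of_real s * w - w) = (1 - s) * r"
  proof -
    have "of_real s * w - w = of_real (s - 1) * w" by (simp add: algebra_simps)
    then show ?thesis using assms w by (simp add: norm_mult del: of_real_diff)
  qed
  moreover have "(1 - s) * r \<le> 1 - s" using assms by (simp add: mult_left_le)
  ultimately have "cmod (1 - w) \<le> 2 * cmod (1 - of_real s * w)" by linarith
  then have 1: "(cmod (1 - w))\<^sup>2 \<le> 4 * (cmod (1 - of_real s * w))\<^sup>2"
    using power_mono[of "cmod (1 - w)" "2 * cmod (1 - of_real s * w)" 2] by (simp add: power_mult_distrib)
  have r1: "r < 1" using assms by simp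
  have "r\<^sup>2 + s\<^sup>2 - 1 \<le> r\<^sup>2 * s\<^sup>2"
  proof -
    have "0 \<le> (1 - r\<^sup>2) * (1 - s\<^sup>2)" using assms r1 by (intro mult_nonneg_nonneg) (auto simp: power_le_one)
    then show ?thesis by (simp add: algebra_simps)
  qed
  moreover have "r\<^sup>2 \<le> s\<^sup>2" using assms by (intro power_mono) auto
  ultimately have 2: "1 - r\<^sup>2 * s\<^sup>2 \<le> 2 * (1 - r\<^sup>2)" by simp
  have pos: "cmod (1 - w) > 0" "cmod (1 - of_real s * w) > 0"
    using w r1 assms \<open>s * r \<le> s\<close> \<open>1 - s * r \<le> cmod (1 - of_real s * w)\<close> by auto
  have "(1 - r\<^sup>2 * s\<^sup>2) / (cmod (1 - of_real s * w))\<^sup>2 \<le> 2 * (1 - r\<^sup>2) / (cmod (1 - of_real s * w))\<^sup>2"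
    by (intro divide_right_mono 2) simp
  also have "\<dots> \<le> 2 * (1 - r\<^sup>2) / ((cmod (1 - w))\<^sup>2 / 4)"
    using 1 pos r1 assms by (intro divide_left_mono) (auto simp: power_le_one)
  finally show ?thesis
    unfolding e w_def[symmetric] poisson_def using w assms by (simp add: norm_mult power_mult_distrib mult_ac)
qed

text \<open>Together with \<open>poisson_semigroup\<close>, this bounds the composition of two Poisson means by their sum,
  which is what makes the maximal inequality below work.\<close>

lemma poisson_mult_le:
  assumes "0 \<le> r" "r < 1" "0 \<le> s" "s < 1" "cmod x = 1"
  shows "poisson (of_real (r * s) * x) \<le> 8 * (poisson (of_real r * x) + poisson (of_real s * x))"
proof -
  have nn: "poisson (of_real r * x) \<ge> 0" "poisson (of_real s * x) \<ge> 0"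
    using assms by (auto intro!: poisson_nonneg simp: norm_mult)
  show ?thesis
  proof (cases "r \<le> s")
    case True
    with poisson_mult_le_aux[of r s x] assms nn show ?thesis by simp
  next
    case False
    with poisson_mult_le_aux[of s r x] assms nn show ?thesis by (simp add: mult.commute[of s r])
  qed
qed

section \<open>The torus and the radial maximal inequality\<close>

lemma space_torus: "space (torus n) = {..<n} \<rightarrow>\<^sub>E sphere 0 1"
  by (simp add: torus_def space_PiM)

lemma prob_space_torus: "prob_space (torus n)"
  unfolding torus_def by (intro prob_space_PiM prob_space_circle)

lemma norm_torus: "\<zeta> \<in> space (torus n) \<Longrightarrow> i < n \<Longrightarrow> cmod (\<zeta> i) = 1"
  by (auto simp: space_torus PiE_iff)

lemma measurable_circle_borel [measurable]:
  "(\<lambda>w. w) \<in> borel_measurable circle"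
  "fst \<in> borel_measurable (circle \<Otimes>\<^sub>M M)"
  "snd \<in> borel_measurable (M \<Otimes>\<^sub>M circle)"
proof -
  show 1: "(\<lambda>w. w) \<in> borel_measurable circle"
    by (intro borel_measurable_circle_continuous continuous_intros)
  show "fst \<in> borel_measurable (circle \<Otimes>\<^sub>M M)" "snd \<in> borel_measurable (M \<Otimes>\<^sub>M circle)"
    using measurable_compose[OF measurable_fst 1] measurable_compose[OF measurable_snd 1] by auto
qed

lemma measurable_into_circle:
  assumes "f \<in> borel_measurable M" "\<And>x. x \<in> space M \<Longrightarrow> cmod (f x) = 1"
  shows "f \<in> M \<rightarrow>\<^sub>M circle"
  unfolding measurable_cong_sets[OF refl sets_circle]
  by (rule measurable_restrict_space2) (use assms in auto)

lemma measurable_torus_component [measurable]: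
  assumes "f \<in> N \<rightarrow>\<^sub>M torus n" "i < n"
  shows "(\<lambda>x. f x i) \<in> borel_measurable N"
  using measurable_compose[OF measurable_compose[OF assms(1)[unfolded torus_def] measurable_component_singleton[of i]] measurable_circle_borel(1)]
  using assms(2) by simp

text \<open>Multiplication of all coordinates by one number: a rotation of the torus if \<open>c\<close> has modulus \<open>1\<close>,
  the radial approach to the boundary if \<open>0 \<le> c < 1\<close>.\<close>

definition dil :: "nat \<Rightarrow> complex \<Rightarrow> (nat \<Rightarrow> complex) \<Rightarrow> nat \<Rightarrow> complex"
  where "dil n c \<zeta> = (\<lambda>i\<in>{..<n}. c * \<zeta> i)"

lemma dil_apply [simp]: "i < n \<Longrightarrow> dil n c \<zeta> i = c * \<zeta> i"
  by (simp add: dil_def)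

lemma dil_dil [simp]: "dil n a (dil n b \<zeta>) = dil n (a * b) \<zeta>"
  by (auto simp: dil_def fun_eq_iff)

lemma dil_1: "\<zeta> \<in> extensional {..<n} \<Longrightarrow> dil n 1 \<zeta> = \<zeta>"
  by (auto simp: dil_def fun_eq_iff extensional_def)

lemma dil_1_torus [simp]: "\<zeta> \<in> space (torus n) \<Longrightarrow> dil n 1 \<zeta> = \<zeta>"
  by (rule dil_1) (auto simp: space_torus PiE_def)

lemma measurable_dil [measurable]:
  assumes f: "f \<in> N \<rightarrow>\<^sub>M circle" and g: "g \<in> N \<rightarrow>\<^sub>M torus n"
  shows "(\<lambda>x. dil n (f x) (g x)) \<in> N \<rightarrow>\<^sub>M torus n"
  unfolding dil_def torus_def
proof (rule measurable_restrict)
  fix i assume i: "i \<in> {..<n}"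
  have [measurable]: "f \<in> borel_measurable N" "(\<lambda>x. g x i) \<in> borel_measurable N"
    using measurable_compose[OF f measurable_circle_borel(1)] measurable_torus_component[OF g] i by auto
  show "(\<lambda>x. f x * g x i) \<in> N \<rightarrow>\<^sub>M circle"
    by (rule measurable_into_circle)
      (use i measurable_space[OF f] measurable_space[OF g] in \<open>auto simp: norm_mult norm_torus[OF measurable_space[OF g]]\<close>)
qed

lemma distr_torus_rotate:
  assumes u: "cmod u = 1"
  shows "distr (torus n) (torus n) (dil n u) = torus n"
proof -
  have "distr (PiM {..<n} (\<lambda>_. circle)) (PiM {..<n} (\<lambda>_. circle)) (compose {..<n} (\<lambda>w. u * w)) =
        PiM {..<n} (\<lambda>_. distr circle circle (\<lambda>w. u * w))"
    by (rule distr_PiM_finite_prob_space') (auto simp: prob_space_circle u)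
  moreover have "compose {..<n} (\<lambda>w. u * w) = dil n u"
    by (auto simp: compose_def dil_def fun_eq_iff)
  ultimately show ?thesis
    by (simp add: torus_def distr_circle_rotate[OF u])
qed

lemma measurable_dil_const [measurable]: "cmod u = 1 \<Longrightarrow> dil n u \<in> torus n \<rightarrow>\<^sub>M torus n"
  by (rule measurable_dil) auto

lemma nn_integral_torus_rotate:
  assumes u: "cmod u = 1" and f [measurable]: "f \<in> borel_measurable (torus n)"
  shows "(\<integral>\<^sup>+\<zeta>. f (dil n u \<zeta>) \<partial>torus n) = (\<integral>\<^sup>+\<zeta>. f \<zeta> \<partial>torus n)"
  using nn_integral_distr[OF measurable_dil_const[OF u], of f n] by (simp add: distr_torus_rotate[OF u])

text \<open>The maximal function of the Poisson means is made linear by a measurable choice \<open>r\<close> of the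
  radius at each point: any bound for the operator \<open>S\<close> that does not depend on \<open>r\<close> bounds the maximal
  function. Such a bound comes from the identity \<open>\<parallel>S\<parallel>\<^sup>2 = \<parallel>S S\<^sup>*\<parallel>\<close>. By the semigroup property
  the kernel of \<open>S S\<^sup>*\<close> is a Poisson kernel for the product of two radii, hence at most eight times
  the sum of the kernels of \<open>S\<close> and \<open>S\<^sup>*\<close>. So \<open>\<parallel>S\<parallel>\<^sup>2 \<le> 16 \<parallel>S\<parallel>\<close>, and \<open>\<parallel>S\<parallel> \<le> 16\<close>. The radii
  stay below some \<open>\<rho> < 1\<close>, which guarantees that the norm is finite in the first place. All functions
  are nonnegative, so that Tonelli's theorem applies to every interchange of integrals.\<close>

locale radial_maximal =
  fixes n :: nat and r :: "(nat \<Rightarrow> complex) \<Rightarrow> real" and \<rho> :: real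
  assumes r_measurable [measurable]: "r \<in> borel_measurable (torus n)"
    and r_nonneg: "\<And>\<zeta>. \<zeta> \<in> space (torus n) \<Longrightarrow> 0 \<le> r \<zeta>"
    and r_le: "\<And>\<zeta>. \<zeta> \<in> space (torus n) \<Longrightarrow> r \<zeta> \<le> \<rho>"
    and \<rho>_less_1: "\<rho> < 1"
begin

sublocale C: prob_space circle by (rule prob_space_circle)
sublocale T: prob_space "torus n" by (rule prob_space_torus)
sublocale CT: pair_sigma_finite circle "torus n" ..

definition K :: "(nat \<Rightarrow> complex) \<Rightarrow> complex \<Rightarrow> ennreal"
  where "K \<zeta> w = ennreal (poisson (of_real (r \<zeta>) * w))"

definition S :: "((nat \<Rightarrow> complex) \<Rightarrow> ennreal) \<Rightarrow> (nat \<Rightarrow> complex) \<Rightarrow> ennreal"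
  where "S G \<zeta> = (\<integral>\<^sup>+w. K \<zeta> w * G (dil n w \<zeta>) \<partial>circle)"

text \<open>The adjoint of \<open>S\<close>.\<close>

definition S' :: "((nat \<Rightarrow> complex) \<Rightarrow> ennreal) \<Rightarrow> (nat \<Rightarrow> complex) \<Rightarrow> ennreal"
  where "S' g \<eta> = (\<integral>\<^sup>+w. K (dil n (cnj w) \<eta>) w * g (dil n (cnj w) \<eta>) \<partial>circle)"

lemma r_less_1: "\<zeta> \<in> space (torus n) \<Longrightarrow> r \<zeta> < 1"
  using r_le[of \<zeta>] \<rho>_less_1 by simp

lemma dil_space: "cmod w = 1 \<Longrightarrow> \<zeta> \<in> space (torus n) \<Longrightarrow> dil n w \<zeta> \<in> space (torus n)"
  by (rule measurable_space[OF measurable_dil_const])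

lemma K_measurable [measurable (raw)]:
  assumes f: "f \<in> N \<rightarrow>\<^sub>M torus n" and g: "g \<in> N \<rightarrow>\<^sub>M circle"
  shows "(\<lambda>x. K (f x) (g x)) \<in> borel_measurable N"
proof -
  have [measurable]: "g \<in> borel_measurable N" "(\<lambda>x. r (f x)) \<in> borel_measurable N"
    using measurable_compose[OF g measurable_circle_borel(1)] measurable_compose[OF f r_measurable] by auto
  show ?thesis unfolding K_def by measurable
qed

lemma S_measurable [measurable]:
  assumes [measurable]: "G \<in> borel_measurable (torus n)"
  shows "S G \<in> borel_measurable (torus n)"
  unfolding S_def by measurable

lemma S'_measurable [measurable]:
  assumes [measurable]: "G \<in> borel_measurable (torus n)"
  shows "S' G \<in> borel_measurable (torus n)"
  unfolding S'_def by measurable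

text \<open>Tonelli and the rotation \<open>\<zeta> = cnj w \<cdot> \<eta>\<close> of the torus.\<close>

lemma S_adjoint:
  assumes [measurable]: "G \<in> borel_measurable (torus n)" "g \<in> borel_measurable (torus n)"
  shows "(\<integral>\<^sup>+\<zeta>. S G \<zeta> * g \<zeta> \<partial>torus n) = (\<integral>\<^sup>+\<eta>. G \<eta> * S' g \<eta> \<partial>torus n)"
proof -
  have "(\<integral>\<^sup>+\<zeta>. S G \<zeta> * g \<zeta> \<partial>torus n) = (\<integral>\<^sup>+\<zeta>. \<integral>\<^sup>+w. K \<zeta> w * G (dil n w \<zeta>) * g \<zeta> \<partial>circle \<partial>torus n)"
    unfolding S_def by (intro nn_integral_cong nn_integral_multc[symmetric]) measurable
  also have "\<dots> = (\<integral>\<^sup>+w. \<integral>\<^sup>+\<zeta>. K \<zeta> w * G (dil n w \<zeta>) * g \<zeta> \<partial>torus n \<partial>circle)"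
    by (rule CT.Fubini') measurable
  also have "\<dots> = (\<integral>\<^sup>+w. \<integral>\<^sup>+\<eta>. K (dil n (cnj w) \<eta>) w * G \<eta> * g (dil n (cnj w) \<eta>) \<partial>torus n \<partial>circle)"
  proof (rule nn_integral_cong)
    fix w assume "w \<in> space circle"
    then have w: "cmod w = 1" "cmod (cnj w) = 1" "w * cnj w = 1" by (simp_all add: complex_norm_square[symmetric])
    have [measurable]: "w \<in> space circle" using w by simp
    show "(\<integral>\<^sup>+\<zeta>. K \<zeta> w * G (dil n w \<zeta>) * g \<zeta> \<partial>torus n) =
          (\<integral>\<^sup>+\<eta>. K (dil n (cnj w) \<eta>) w * G \<eta> * g (dil n (cnj w) \<eta>) \<partial>torus n)"
      by (subst nn_integral_torus_rotate[OF w(2), symmetric]) (measurable, auto intro!: nn_integral_cong simp: w)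
  qed
  also have "\<dots> = (\<integral>\<^sup>+\<eta>. \<integral>\<^sup>+w. K (dil n (cnj w) \<eta>) w * G \<eta> * g (dil n (cnj w) \<eta>) \<partial>circle \<partial>torus n)"
    by (rule CT.Fubini'[symmetric]) measurable
  also have "\<dots> = (\<integral>\<^sup>+\<eta>. G \<eta> * S' g \<eta> \<partial>torus n)"
    unfolding S'_def
    by (intro nn_integral_cong, subst nn_integral_cmult[symmetric]) (measurable, auto intro!: nn_integral_cong simp: mult_ac)
  finally show ?thesis .
qed

text \<open>The kernel of \<open>S S\<^sup>*\<close>: its value at \<open>x\<close> is the Poisson kernel for the product of the radii
  chosen at \<open>\<eta>\<close> and at the rotated point.\<close>

lemma K_convolution:
  assumes x: "cmod x = 1" and \<eta>: "\<eta> \<in> space (torus n)"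
  shows "(\<integral>\<^sup>+v. K \<eta> (v * x) * K (dil n x \<eta>) v \<partial>circle) \<le> 8 * (K \<eta> x + K (dil n x \<eta>) x)"
proof -
  define a where "a = r \<eta>"
  define b where "b = r (dil n x \<eta>)"
  have a: "0 \<le> a" "a < 1" and b: "0 \<le> b" "b < 1"
    using r_nonneg[OF \<eta>] r_less_1[OF \<eta>] r_nonneg[OF dil_space[OF x \<eta>]] r_less_1[OF dil_space[OF x \<eta>]]
    by (auto simp: a_def b_def)
  have nn: "poisson (of_real t * w) \<ge> 0" if "0 \<le> t" "t < 1" "cmod w = 1" for t w
    using that by (auto intro!: poisson_nonneg simp: norm_mult)
  have "continuous_on (sphere 0 1) (\<lambda>w. poisson ((of_real a * x) * w))"
    using a x by (intro continuous_on_poisson) (simp add: norm_mult)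
  moreover have "continuous_on (sphere 0 1) (\<lambda>w. poisson (of_real b * w))"
    using b by (intro continuous_on_poisson) simp
  ultimately have c: "continuous_on (sphere 0 1) (\<lambda>w. poisson (of_real b * w) * poisson (of_real a * (x * w)))"
    by (intro continuous_intros) (auto simp: mult_ac)
  have "continuous_on (sphere 0 1) (\<lambda>w. complex_of_real (poisson (of_real b * w) * poisson (of_real a * (x * w))))"
    by (intro continuous_intros c)
  from integrable_circle_continuous[OF this]
  have int: "integrable circle (\<lambda>w. poisson (of_real b * w) * poisson (of_real a * (x * w)))"
    using integrable_Re by fastforce
  have "(\<integral>\<^sup>+v. K \<eta> (v * x) * K (dil n x \<eta>) v \<partial>circle) =
        (\<integral>\<^sup>+v. ennreal (poisson (of_real b * v) * poisson (of_real a * (x * v))) \<partial>circle)"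
    using nn[OF b] nn[OF a] x by (intro nn_integral_cong)
      (auto simp: K_def a_def[symmetric] b_def[symmetric] ennreal_mult' mult_ac norm_mult)
  also have "\<dots> = ennreal (LINT v|circle. poisson (of_real b * v) * poisson (of_real a * (x * v)))"
    using nn[OF b] nn[OF a] x by (intro nn_integral_eq_integral int) (auto intro!: mult_nonneg_nonneg simp: norm_mult)
  also have "\<dots> = ennreal (poisson (of_real (b * a) * x))"
    by (subst poisson_semigroup[OF b a x]) simp
  also have "\<dots> \<le> ennreal (8 * (poisson (of_real b * x) + poisson (of_real a * x)))"
    by (intro ennreal_leI poisson_mult_le a b x)
  also have "\<dots> = 8 * (K \<eta> x + K (dil n x \<eta>) x)"
    unfolding K_def a_def[symmetric] b_def[symmetric] using nn[OF b x] nn[OF a x]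
    by (subst ennreal_mult) (simp_all add: add.commute)
  finally show ?thesis .
qed

text \<open>Writing the square as a double integral over \<open>w\<close> and \<open>v\<close>, rotating \<open>\<eta>\<close> by \<open>w\<close> and putting
  \<open>w = v * x\<close> leaves \<open>v\<close> only in the product of the two kernels, and \<open>K_convolution\<close> removes it.
  The two terms of the bound are equal, as the substitutions \<open>\<eta> \<mapsto> cnj x \<cdot> \<eta>\<close> and
  \<open>x \<mapsto> cnj x\<close> show.\<close>

lemma S'_square:
  assumes [measurable]: "g \<in> borel_measurable (torus n)"
  shows "(\<integral>\<^sup>+\<eta>. (S' g \<eta>)\<^sup>2 \<partial>torus n) \<le> 16 * (\<integral>\<^sup>+\<eta>. g \<eta> * S g \<eta> \<partial>torus n)"
proof -
  let ?k = "\<lambda>\<eta> w. K (dil n (cnj w) \<eta>) w * g (dil n (cnj w) \<eta>)"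
  have "(\<integral>\<^sup>+\<eta>. (S' g \<eta>)\<^sup>2 \<partial>torus n) = (\<integral>\<^sup>+\<eta>. \<integral>\<^sup>+v. \<integral>\<^sup>+w. ?k \<eta> w * ?k \<eta> v \<partial>circle \<partial>circle \<partial>torus n)"
    unfolding S'_def power2_eq_square
    by (intro nn_integral_cong, subst nn_integral_multc[symmetric], measurable,
        subst nn_integral_cmult[symmetric], measurable,
        intro nn_integral_cong, simp add: mult_ac)
  also have "\<dots> = (\<integral>\<^sup>+v. \<integral>\<^sup>+\<eta>. \<integral>\<^sup>+w. ?k \<eta> w * ?k \<eta> v \<partial>circle \<partial>torus n \<partial>circle)"
    by (rule CT.Fubini') measurable
  also have "\<dots> = (\<integral>\<^sup>+v. \<integral>\<^sup>+w. \<integral>\<^sup>+\<eta>. ?k \<eta> w * ?k \<eta> v \<partial>torus n \<partial>circle \<partial>circle)"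
  proof (intro nn_integral_cong)
    fix v assume [measurable]: "v \<in> space circle"
    have [measurable]: "cnj v \<in> space circle" using \<open>v \<in> space circle\<close> by simp
    show "(\<integral>\<^sup>+\<eta>. \<integral>\<^sup>+w. ?k \<eta> w * ?k \<eta> v \<partial>circle \<partial>torus n) = (\<integral>\<^sup>+w. \<integral>\<^sup>+\<eta>. ?k \<eta> w * ?k \<eta> v \<partial>torus n \<partial>circle)"
      by (rule CT.Fubini') measurable
  qed
  also have "\<dots> = (\<integral>\<^sup>+v. \<integral>\<^sup>+x. \<integral>\<^sup>+\<eta>. (K \<eta> (v * x) * K (dil n x \<eta>) v) * (g \<eta> * g (dil n x \<eta>)) \<partial>torus n \<partial>circle \<partial>circle)"
  proof (rule nn_integral_cong)
    fix v assume v[measurable]: "v \<in> space circle"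
    then have v1: "cmod v = 1" "cnj v * v = 1" by (simp_all add: complex_norm_square[symmetric] mult.commute)
    have [measurable]: "cnj v \<in> space circle" using v by simp
    have "(\<integral>\<^sup>+w. \<integral>\<^sup>+\<eta>. ?k \<eta> w * ?k \<eta> v \<partial>torus n \<partial>circle) =
          (\<integral>\<^sup>+x. \<integral>\<^sup>+\<eta>. ?k \<eta> (v * x) * ?k \<eta> v \<partial>torus n \<partial>circle)"
      by (rule nn_integral_circle_rotate[OF v1(1), symmetric]) measurable
    also have "\<dots> = (\<integral>\<^sup>+x. \<integral>\<^sup>+\<eta>. (K \<eta> (v * x) * K (dil n x \<eta>) v) * (g \<eta> * g (dil n x \<eta>)) \<partial>torus n \<partial>circle)"
    proof (rule nn_integral_cong)
      fix x assume "x \<in> space circle"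
      then have x: "cmod x = 1" "cnj x * x = 1" by (simp_all add: complex_norm_square[symmetric] mult.commute)
      have vx: "cmod (v * x) = 1" using v1 x by (simp add: norm_mult)
      have e1: "v * (x * cnj v) = (cnj v * v) * x" by (simp only: mult_ac)
      have e2: "v * (x * (cnj v * cnj x)) = (cnj v * v) * (cnj x * x)" by (simp only: mult_ac)
      have e: "v * (x * cnj v) = x" "v * (x * (cnj v * cnj x)) = 1"
        unfolding e1 e2 v1 x by simp_all
      have [measurable]: "v * x \<in> space circle" "cnj (v * x) \<in> space circle" using v1 x by (auto simp: norm_mult)
      show "(\<integral>\<^sup>+\<eta>. ?k \<eta> (v * x) * ?k \<eta> v \<partial>torus n) =
            (\<integral>\<^sup>+\<eta>. (K \<eta> (v * x) * K (dil n x \<eta>) v) * (g \<eta> * g (dil n x \<eta>)) \<partial>torus n)"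
        by (subst nn_integral_torus_rotate[OF vx, symmetric]) (measurable, auto intro!: nn_integral_cong simp: e mult_ac)
    qed
    finally show "(\<integral>\<^sup>+w. \<integral>\<^sup>+\<eta>. ?k \<eta> w * ?k \<eta> v \<partial>torus n \<partial>circle) = \<dots>" .
  qed
  also have "\<dots> = (\<integral>\<^sup>+x. \<integral>\<^sup>+v. \<integral>\<^sup>+\<eta>. (K \<eta> (v * x) * K (dil n x \<eta>) v) * (g \<eta> * g (dil n x \<eta>)) \<partial>torus n \<partial>circle \<partial>circle)"
  proof -
    interpret CC: pair_sigma_finite circle circle ..
    have [measurable]: "(\<lambda>p. fst p * snd p) \<in> circle \<Otimes>\<^sub>M circle \<rightarrow>\<^sub>M circle"
      by (rule measurable_into_circle) (auto simp: space_pair_measure norm_mult)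
    have [measurable]: "(\<lambda>p. snd p * fst p) \<in> circle \<Otimes>\<^sub>M circle \<rightarrow>\<^sub>M circle"
      by (rule measurable_into_circle) (auto simp: space_pair_measure norm_mult)
    have [measurable]: "(\<lambda>p. snd (fst p) * fst (fst p)) \<in> (circle \<Otimes>\<^sub>M circle) \<Otimes>\<^sub>M torus n \<rightarrow>\<^sub>M circle"
      by (rule measurable_into_circle) (auto simp: space_pair_measure norm_mult)
    show ?thesis
      by (rule CC.Fubini') measurable
  qed
  also have "\<dots> = (\<integral>\<^sup>+x. \<integral>\<^sup>+\<eta>. (\<integral>\<^sup>+v. K \<eta> (v * x) * K (dil n x \<eta>) v \<partial>circle) * (g \<eta> * g (dil n x \<eta>)) \<partial>torus n \<partial>circle)"
  proof (rule nn_integral_cong)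
    fix x assume x[measurable]: "x \<in> space circle"
    have [measurable]: "(\<lambda>v. v * x) \<in> circle \<rightarrow>\<^sub>M circle"
      by (rule measurable_into_circle) (use x in \<open>auto simp: norm_mult\<close>)
    have "(\<integral>\<^sup>+v. \<integral>\<^sup>+\<eta>. (K \<eta> (v * x) * K (dil n x \<eta>) v) * (g \<eta> * g (dil n x \<eta>)) \<partial>torus n \<partial>circle) =
      (\<integral>\<^sup>+\<eta>. \<integral>\<^sup>+v. (K \<eta> (v * x) * K (dil n x \<eta>) v) * (g \<eta> * g (dil n x \<eta>)) \<partial>circle \<partial>torus n)"
      by (rule CT.Fubini'[symmetric]) measurable
    also have "\<dots> = (\<integral>\<^sup>+\<eta>. (\<integral>\<^sup>+v. K \<eta> (v * x) * K (dil n x \<eta>) v \<partial>circle) * (g \<eta> * g (dil n x \<eta>)) \<partial>torus n)"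
      by (intro nn_integral_cong nn_integral_multc) measurable
    finally show "(\<integral>\<^sup>+v. \<integral>\<^sup>+\<eta>. (K \<eta> (v * x) * K (dil n x \<eta>) v) * (g \<eta> * g (dil n x \<eta>)) \<partial>torus n \<partial>circle) = \<dots>" .
  qed
  also have "\<dots> \<le> (\<integral>\<^sup>+x. \<integral>\<^sup>+\<eta>. (8 * (K \<eta> x + K (dil n x \<eta>) x)) * (g \<eta> * g (dil n x \<eta>)) \<partial>torus n \<partial>circle)"
    by (intro nn_integral_mono mult_right_mono K_convolution) auto
  also have "\<dots> = 8 * ((\<integral>\<^sup>+x. \<integral>\<^sup>+\<eta>. K \<eta> x * (g \<eta> * g (dil n x \<eta>)) \<partial>torus n \<partial>circle) +
       (\<integral>\<^sup>+x. \<integral>\<^sup>+\<eta>. K (dil n x \<eta>) x * (g \<eta> * g (dil n x \<eta>)) \<partial>torus n \<partial>circle))"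
  proof -
    let ?c = "\<lambda>x \<eta>. g \<eta> * g (dil n x \<eta>)"
    have "(\<integral>\<^sup>+\<eta>. (8 * (K \<eta> x + K (dil n x \<eta>) x)) * ?c x \<eta> \<partial>torus n) =
      8 * ((\<integral>\<^sup>+\<eta>. K \<eta> x * ?c x \<eta> \<partial>torus n) + (\<integral>\<^sup>+\<eta>. K (dil n x \<eta>) x * ?c x \<eta> \<partial>torus n))"
      if [measurable]: "x \<in> space circle" for x
      unfolding mult.assoc distrib_right
      by (rule trans[OF nn_integral_cmult], measurable, rule arg_cong[where f="(*) 8"], rule nn_integral_add; measurable)
    then have "(\<integral>\<^sup>+x. \<integral>\<^sup>+\<eta>. (8 * (K \<eta> x + K (dil n x \<eta>) x)) * ?c x \<eta> \<partial>torus n \<partial>circle) =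
      (\<integral>\<^sup>+x. 8 * ((\<integral>\<^sup>+\<eta>. K \<eta> x * ?c x \<eta> \<partial>torus n) + (\<integral>\<^sup>+\<eta>. K (dil n x \<eta>) x * ?c x \<eta> \<partial>torus n)) \<partial>circle)"
      by (rule nn_integral_cong)
    also have "\<dots> = 8 * ((\<integral>\<^sup>+x. \<integral>\<^sup>+\<eta>. K \<eta> x * ?c x \<eta> \<partial>torus n \<partial>circle) +
       (\<integral>\<^sup>+x. \<integral>\<^sup>+\<eta>. K (dil n x \<eta>) x * ?c x \<eta> \<partial>torus n \<partial>circle))"
      by (rule trans[OF nn_integral_cmult], measurable, rule arg_cong[where f="(*) 8"], rule nn_integral_add; measurable)
    finally show ?thesis .
  qed
  also have "(\<integral>\<^sup>+x. \<integral>\<^sup>+\<eta>. K (dil n x \<eta>) x * (g \<eta> * g (dil n x \<eta>)) \<partial>torus n \<partial>circle) =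
      (\<integral>\<^sup>+x. \<integral>\<^sup>+\<eta>. K \<eta> (cnj (cnj x)) * (g \<eta> * g (dil n (cnj x) \<eta>)) \<partial>torus n \<partial>circle)"
  proof (rule nn_integral_cong)
    fix x assume [measurable]: "x \<in> space circle"
    then have x: "cmod x = 1" "cmod (cnj x) = 1" "x * cnj x = 1" by (simp_all add: complex_norm_square[symmetric])
    have [measurable]: "cnj x \<in> space circle" using x by simp
    show "(\<integral>\<^sup>+\<eta>. K (dil n x \<eta>) x * (g \<eta> * g (dil n x \<eta>)) \<partial>torus n) =
       (\<integral>\<^sup>+\<eta>. K \<eta> (cnj (cnj x)) * (g \<eta> * g (dil n (cnj x) \<eta>)) \<partial>torus n)"
      by (subst nn_integral_torus_rotate[OF x(2), symmetric]) (measurable, auto intro!: nn_integral_cong simp: x mult_ac)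
  qed
  also have "\<dots> = (\<integral>\<^sup>+x. \<integral>\<^sup>+\<eta>. K \<eta> (cnj x) * (g \<eta> * g (dil n x \<eta>)) \<partial>torus n \<partial>circle)"
    by (rule nn_integral_circle_cnj) measurable
  also have "\<dots> = (\<integral>\<^sup>+x. \<integral>\<^sup>+\<eta>. K \<eta> x * (g \<eta> * g (dil n x \<eta>)) \<partial>torus n \<partial>circle)"
  proof -
    have "poisson (of_real a * cnj x) = poisson (of_real a * x)" for a x
      using poisson_cnj[of "of_real a * x"] by simp
    then show ?thesis unfolding K_def by simp
  qed
  also have "(\<integral>\<^sup>+x. \<integral>\<^sup>+\<eta>. K \<eta> x * (g \<eta> * g (dil n x \<eta>)) \<partial>torus n \<partial>circle) = (\<integral>\<^sup>+\<eta>. g \<eta> * S g \<eta> \<partial>torus n)"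
    unfolding S_def
    by (subst CT.Fubini'[symmetric], measurable, intro nn_integral_cong, subst nn_integral_cmult[symmetric], measurable,
        simp add: mult_ac)
  finally show ?thesis by (simp add: distrib_left distrib_right mult_2[symmetric] flip: mult.assoc)
qed

text \<open>A crude bound, in which the constant depends on \<open>\<rho>\<close>; it starts the improvement below.\<close>

lemma S_bounded:
  obtains c :: real where "c \<ge> 0"
    "\<And>G. G \<in> borel_measurable (torus n) \<Longrightarrow> (\<integral>\<^sup>+\<zeta>. (S G \<zeta>)\<^sup>2 \<partial>torus n) \<le> ennreal c * (\<integral>\<^sup>+\<zeta>. (G \<zeta>)\<^sup>2 \<partial>torus n)"
proof
  \<comment> \<open>A bound for the Poisson kernel at radii up to \<open>\<rho>\<close>.\<close>
  define B where "B = 1 / (1 - \<rho>)\<^sup>2"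
  show "B\<^sup>2 \<ge> 0" by simp
  fix G :: "(nat \<Rightarrow> complex) \<Rightarrow> ennreal" assume [measurable]: "G \<in> borel_measurable (torus n)"
  have K: "K \<zeta> w \<le> ennreal B" if "\<zeta> \<in> space (torus n)" "cmod w = 1" for \<zeta> w
  proof -
    have "1 - r \<zeta> \<le> cmod (1 - of_real (r \<zeta>) * w)"
      using norm_triangle_ineq2[of 1 "of_real (r \<zeta>) * w"] r_nonneg[OF that(1)] that(2) by (simp add: norm_mult)
    with r_le[OF that(1)] have "1 - \<rho> \<le> cmod (1 - of_real (r \<zeta>) * w)" by simp
    then have "(1 - \<rho>)\<^sup>2 \<le> (cmod (1 - of_real (r \<zeta>) * w))\<^sup>2"
      using \<rho>_less_1 by (intro power_mono) auto
    then have "poisson (of_real (r \<zeta>) * w) \<le> B"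
      unfolding poisson_def B_def using \<rho>_less_1 by (intro frac_le) auto
    then show ?thesis by (simp add: K_def ennreal_leI)
  qed
  have "(S G \<zeta>)\<^sup>2 \<le> ennreal (B\<^sup>2) * (\<integral>\<^sup>+w. (G (dil n w \<zeta>))\<^sup>2 \<partial>circle)" if [measurable]: "\<zeta> \<in> space (torus n)" for \<zeta>
  proof -
    have "(S G \<zeta>)\<^sup>2 \<le> (\<integral>\<^sup>+w. (K \<zeta> w)\<^sup>2 \<partial>circle) * (\<integral>\<^sup>+w. (G (dil n w \<zeta>))\<^sup>2 \<partial>circle)"
      unfolding S_def by (rule Cauchy_Schwarz_nn_integral) measurable
    also have "(\<integral>\<^sup>+w. (K \<zeta> w)\<^sup>2 \<partial>circle) \<le> (\<integral>\<^sup>+w. (ennreal B)\<^sup>2 \<partial>circle)"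
      by (intro nn_integral_mono power_mono K) (use that in auto)
    also have "\<dots> = ennreal (B\<^sup>2)" by (simp add: C.emeasure_space_1[simplified] B_def ennreal_power)
    finally show ?thesis by (simp add: mult_right_mono)
  qed
  then have "(\<integral>\<^sup>+\<zeta>. (S G \<zeta>)\<^sup>2 \<partial>torus n) \<le> (\<integral>\<^sup>+\<zeta>. ennreal (B\<^sup>2) * (\<integral>\<^sup>+w. (G (dil n w \<zeta>))\<^sup>2 \<partial>circle) \<partial>torus n)"
    by (rule nn_integral_mono)
  also have "\<dots> = ennreal (B\<^sup>2) * (\<integral>\<^sup>+\<zeta>. \<integral>\<^sup>+w. (G (dil n w \<zeta>))\<^sup>2 \<partial>circle \<partial>torus n)"
    by (rule nn_integral_cmult) measurable
  also have "(\<integral>\<^sup>+\<zeta>. \<integral>\<^sup>+w. (G (dil n w \<zeta>))\<^sup>2 \<partial>circle \<partial>torus n) = (\<integral>\<^sup>+w. \<integral>\<^sup>+\<zeta>. (G (dil n w \<zeta>))\<^sup>2 \<partial>torus n \<partial>circle)"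
    by (rule CT.Fubini') measurable
  also have "\<dots> = (\<integral>\<^sup>+w. \<integral>\<^sup>+\<zeta>. (G \<zeta>)\<^sup>2 \<partial>torus n \<partial>circle)"
    by (intro nn_integral_cong nn_integral_torus_rotate) auto
  also have "\<dots> = (\<integral>\<^sup>+\<zeta>. (G \<zeta>)\<^sup>2 \<partial>torus n)"
    using C.emeasure_space_1 by simp
  finally show "(\<integral>\<^sup>+\<zeta>. (S G \<zeta>)\<^sup>2 \<partial>torus n) \<le> ennreal (B\<^sup>2) * (\<integral>\<^sup>+\<zeta>. (G \<zeta>)\<^sup>2 \<partial>torus n)" .
qed

text \<open>With \<open>\<langle>_, _\<rangle>\<close> the integral of the product, \<open>\<parallel>S G\<parallel>\<^sup>4 = \<langle>G, S\<^sup>* S G\<rangle>\<^sup>2 \<le> \<parallel>G\<parallel>\<^sup>2 \<parallel>S\<^sup>* S G\<parallel>\<^sup>2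
  \<le> 16 \<parallel>G\<parallel>\<^sup>2 \<langle>S G, S S G\<rangle>\<close>, and the last factor is at most \<open>sqrt c * \<parallel>S G\<parallel>\<^sup>2\<close>.\<close>

lemma S_improve:
  assumes c: "c \<ge> 0"
    "\<And>G. G \<in> borel_measurable (torus n) \<Longrightarrow> (\<integral>\<^sup>+\<zeta>. (S G \<zeta>)\<^sup>2 \<partial>torus n) \<le> ennreal c * (\<integral>\<^sup>+\<zeta>. (G \<zeta>)\<^sup>2 \<partial>torus n)"
    and G [measurable]: "G \<in> borel_measurable (torus n)"
    and fin: "(\<integral>\<^sup>+\<zeta>. (G \<zeta>)\<^sup>2 \<partial>torus n) < \<infinity>"
  shows "(\<integral>\<^sup>+\<zeta>. (S G \<zeta>)\<^sup>2 \<partial>torus n) \<le> ennreal (16 * sqrt c) * (\<integral>\<^sup>+\<zeta>. (G \<zeta>)\<^sup>2 \<partial>torus n)"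
proof -
  define A where "A = (\<integral>\<^sup>+\<zeta>. (S G \<zeta>)\<^sup>2 \<partial>torus n)"
  define B where "B = (\<integral>\<^sup>+\<zeta>. (G \<zeta>)\<^sup>2 \<partial>torus n)"
  define E where "E = (\<integral>\<^sup>+\<zeta>. S G \<zeta> * S (S G) \<zeta> \<partial>torus n)"
  have A: "A \<le> ennreal c * B" unfolding A_def B_def by (rule c(2)) measurable
  have E: "E\<^sup>2 \<le> A * (ennreal c * A)"
  proof -
    have "E\<^sup>2 \<le> A * (\<integral>\<^sup>+\<zeta>. (S (S G) \<zeta>)\<^sup>2 \<partial>torus n)"
      unfolding E_def A_def by (rule Cauchy_Schwarz_nn_integral) measurable
    also have "\<dots> \<le> A * (ennreal c * A)"
      unfolding A_def by (intro mult_left_mono c(2)) auto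
    finally show ?thesis .
  qed
  have "A\<^sup>2 = (\<integral>\<^sup>+\<zeta>. G \<zeta> * S' (S G) \<zeta> \<partial>torus n)\<^sup>2"
    unfolding A_def using S_adjoint[OF G S_measurable[OF G]] by (simp add: power2_eq_square)
  also have "\<dots> \<le> B * (\<integral>\<^sup>+\<zeta>. (S' (S G) \<zeta>)\<^sup>2 \<partial>torus n)"
    unfolding B_def by (rule Cauchy_Schwarz_nn_integral) measurable
  also have "\<dots> \<le> B * (16 * E)"
    unfolding E_def by (intro mult_left_mono S'_square) auto
  finally have AE: "A\<^sup>2 \<le> B * (16 * E)" .
  obtain b where b: "B = ennreal b" "b \<ge> 0" using fin by (cases B) (auto simp: B_def[symmetric])
  then have "A < \<infinity>" using A by (metis ennreal_mult_less_top ennreal_less_top infinity_ennreal_def le_less_trans)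
  then obtain a where a: "A = ennreal a" "a \<ge> 0" by (cases A) auto
  have "E < \<infinity>"
  proof -
    have "E\<^sup>2 < \<infinity>" using E a c by (simp add: ennreal_mult_less_top le_less_trans flip: ennreal_mult')
    then show ?thesis by (simp add: power_less_top_ennreal)
  qed
  then obtain e where e: "E = ennreal e" "e \<ge> 0" by (cases E) auto
  have e1: "e\<^sup>2 \<le> c * a\<^sup>2" using E unfolding a(1) e(1)
    using a(2) e(2) c by (simp add: ennreal_power power2_eq_square mult_ac flip: ennreal_mult)
  then have "e \<le> sqrt c * a"
    using real_sqrt_le_mono[OF e1] a(2) e(2) by (simp add: real_sqrt_mult)
  moreover have "ennreal (a\<^sup>2) \<le> ennreal (b * (16 * e))"
  proof -
    have "ennreal (a\<^sup>2) = A\<^sup>2" using a by (simp add: ennreal_power)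
    also have "\<dots> \<le> ennreal (b * (16 * e))" using AE b e by (simp add: ennreal_mult)
    finally show ?thesis .
  qed
  then have "a\<^sup>2 \<le> b * (16 * e)" using b e by (simp)
  ultimately have "a * a \<le> (16 * sqrt c * b) * a"
    using mult_left_mono[of e "sqrt c * a" "16 * b"] b by (simp add: power2_eq_square mult_ac)
  moreover have "0 \<le> 16 * sqrt c * b" using b c by simp
  ultimately have "a \<le> 16 * sqrt c * b"
    using a(2) by (metis mult_le_cancel_right_pos order_le_less)
  then show ?thesis
    unfolding A_def[symmetric] B_def[symmetric] a(1) b(1) using b c by (simp flip: ennreal_mult'')
qed

text \<open>The infimum \<open>m\<close> of all admissible constants satisfies \<open>m \<le> 16 * sqrt m\<close>, hence \<open>m \<le> 256\<close>. The
  constant \<open>257\<close> avoids the question whether the infimum is admissible.\<close>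

lemma S_norm:
  assumes [measurable]: "G \<in> borel_measurable (torus n)"
  shows "(\<integral>\<^sup>+\<zeta>. (S G \<zeta>)\<^sup>2 \<partial>torus n) \<le> 257 * (\<integral>\<^sup>+\<zeta>. (G \<zeta>)\<^sup>2 \<partial>torus n)"
proof -
  define V where "V = {c. c > (0::real) \<and> (\<forall>G\<in>borel_measurable (torus n).
     (\<integral>\<^sup>+\<zeta>. (S G \<zeta>)\<^sup>2 \<partial>torus n) \<le> ennreal c * (\<integral>\<^sup>+\<zeta>. (G \<zeta>)\<^sup>2 \<partial>torus n))}"
  obtain c0 :: real where c0: "c0 \<ge> 0"
    "\<And>G. G \<in> borel_measurable (torus n) \<Longrightarrow> (\<integral>\<^sup>+\<zeta>. (S G \<zeta>)\<^sup>2 \<partial>torus n) \<le> ennreal c0 * (\<integral>\<^sup>+\<zeta>. (G \<zeta>)\<^sup>2 \<partial>torus n)"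
    using S_bounded by blast
  have "(\<integral>\<^sup>+\<zeta>. (S G \<zeta>)\<^sup>2 \<partial>torus n) \<le> ennreal (c0 + 1) * (\<integral>\<^sup>+\<zeta>. (G \<zeta>)\<^sup>2 \<partial>torus n)"
    if "(G :: _ \<Rightarrow> ennreal) \<in> borel_measurable (torus n)" for G
    using c0(2)[OF that] by (rule order_trans) (use c0(1) in \<open>intro mult_right_mono ennreal_leI, auto\<close>)
  then have ne: "V \<noteq> {}" using c0(1) unfolding V_def by (auto intro!: exI[of _ "c0 + 1"])
  have improve: "16 * sqrt c \<in> V" if "c \<in> V" for c
  proof -
    have "(\<integral>\<^sup>+\<zeta>. (S G \<zeta>)\<^sup>2 \<partial>torus n) \<le> ennreal (16 * sqrt c) * (\<integral>\<^sup>+\<zeta>. (G \<zeta>)\<^sup>2 \<partial>torus n)"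
      if [measurable]: "G \<in> borel_measurable (torus n)" for G
    proof (cases "(\<integral>\<^sup>+\<zeta>. (G \<zeta>)\<^sup>2 \<partial>torus n) < \<infinity>")
      case True
      then show ?thesis using \<open>c \<in> V\<close> by (intro S_improve) (auto simp: V_def)
    next
      case False
      then have "(\<integral>\<^sup>+\<zeta>. (G \<zeta>)\<^sup>2 \<partial>torus n) = top" by (simp add: less_top[symmetric])
      then show ?thesis using \<open>c \<in> V\<close> by (simp add: V_def ennreal_mult_top)
    qed
    then show ?thesis using that by (auto simp: V_def)
  qed
  define m where "m = Inf V"
  have bdd: "bdd_below V" by (rule bdd_belowI[of _ 0]) (auto simp: V_def)
  have m0: "m \<ge> 0" unfolding m_def by (rule cInf_greatest[OF ne]) (auto simp: V_def)
  have "m\<^sup>2 / 256 \<le> c" if "c \<in> V" for c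
  proof -
    have "m \<le> 16 * sqrt c" unfolding m_def by (rule cInf_lower[OF improve[OF that] bdd])
    then have "m\<^sup>2 \<le> (16 * sqrt c)\<^sup>2" using m0 by (rule power_mono)
    also have "\<dots> = 256 * c" using that by (simp add: V_def power_mult_distrib)
    finally show ?thesis by simp
  qed
  then have "m\<^sup>2 / 256 \<le> m" unfolding m_def by (intro cInf_greatest[OF ne])
  then have "m * m \<le> 256 * m" by (simp add: power2_eq_square)
  then have "m \<le> 256" using m0 by (metis mult_le_cancel_right_pos order_le_less zero_le_numeral)
  then obtain c where c: "c \<in> V" "c < 257"
    using cInf_lessD[OF ne, of 257] m_def by auto
  have "(\<integral>\<^sup>+\<zeta>. (S G \<zeta>)\<^sup>2 \<partial>torus n) \<le> ennreal c * (\<integral>\<^sup>+\<zeta>. (G \<zeta>)\<^sup>2 \<partial>torus n)"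
    using c by (auto simp: V_def)
  also have "\<dots> \<le> ennreal 257 * (\<integral>\<^sup>+\<zeta>. (G \<zeta>)\<^sup>2 \<partial>torus n)"
    using c by (intro mult_right_mono ennreal_leI) auto
  finally show ?thesis by simp
qed

end

definition poisson_mean :: "nat \<Rightarrow> ((nat \<Rightarrow> complex) \<Rightarrow> ennreal) \<Rightarrow> real \<Rightarrow> (nat \<Rightarrow> complex) \<Rightarrow> ennreal"
  where "poisson_mean n G s \<zeta> = (\<integral>\<^sup>+w. ennreal (poisson (of_real s * w)) * G (dil n w \<zeta>) \<partial>circle)"

lemma poisson_mean_measurable [measurable]:
  assumes [measurable]: "G \<in> borel_measurable (torus n)" "r \<in> borel_measurable (torus n)"
  shows "(\<lambda>\<zeta>. poisson_mean n G (r \<zeta>) \<zeta>) \<in> borel_measurable (torus n)"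
proof -
  interpret C: prob_space circle by (rule prob_space_circle)
  have [measurable]: "(\<lambda>p. r (fst p)) \<in> borel_measurable (torus n \<Otimes>\<^sub>M circle)" by measurable
  show ?thesis unfolding poisson_mean_def by measurable
qed

text \<open>The radius is chosen, at each point, among the finitely many elements of \<open>R\<close> so as to attain the
  maximum.\<close>

theorem radial_maximal_inequality:
  assumes R: "finite R" "R \<noteq> {}" "R \<subseteq> {0..<1}" and G [measurable]: "G \<in> borel_measurable (torus n)"
  shows "(\<integral>\<^sup>+\<zeta>. (MAX s\<in>R. poisson_mean n G s \<zeta>)\<^sup>2 \<partial>torus n) \<le> 257 * (\<integral>\<^sup>+\<zeta>. (G \<zeta>)\<^sup>2 \<partial>torus n)"
proof -
  have "\<exists>r\<in>borel_measurable (torus n). \<forall>\<zeta>. r \<zeta> \<in> R \<and> (\<forall>s\<in>R. poisson_mean n G s \<zeta> \<le> poisson_mean n G (r \<zeta>) \<zeta>)"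
    using R(1,2)
  proof (induction rule: finite_ne_induct)
    case (singleton x)
    then show ?case by (intro bexI[of _ "\<lambda>_. x"]) auto
  next
    case (insert x F)
    then obtain r where r [measurable]: "r \<in> borel_measurable (torus n)"
      and r2: "\<And>\<zeta>. r \<zeta> \<in> F" "\<And>\<zeta> s. s \<in> F \<Longrightarrow> poisson_mean n G s \<zeta> \<le> poisson_mean n G (r \<zeta>) \<zeta>" by auto
    define r' where "r' \<zeta> = (if poisson_mean n G x \<zeta> \<le> poisson_mean n G (r \<zeta>) \<zeta> then r \<zeta> else x)" for \<zeta>
    have "r' \<in> borel_measurable (torus n)" unfolding r'_def by measurable
    moreover have "\<forall>\<zeta>. r' \<zeta> \<in> insert x F \<and> (\<forall>s\<in>insert x F. poisson_mean n G s \<zeta> \<le> poisson_mean n G (r' \<zeta>) \<zeta>)"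
      unfolding r'_def using r2 by (auto intro: order_trans dest: linear[THEN disjE] simp: not_le) (meson order_trans less_imp_le)
    ultimately show ?case by blast
  qed
  then obtain r where r [measurable]: "r \<in> borel_measurable (torus n)"
    and r2: "\<And>\<zeta>. r \<zeta> \<in> R" "\<And>\<zeta> s. s \<in> R \<Longrightarrow> poisson_mean n G s \<zeta> \<le> poisson_mean n G (r \<zeta>) \<zeta>" by auto
  interpret radial_maximal n r "Max R"
    by unfold_locales (use r2(1) R in \<open>auto simp: subset_iff\<close>)
  have "(MAX s\<in>R. poisson_mean n G s \<zeta>) \<le> S G \<zeta>" for \<zeta>
    using r2(2) R by (auto simp: S_def K_def poisson_mean_def)
  then have "(\<integral>\<^sup>+\<zeta>. (MAX s\<in>R. poisson_mean n G s \<zeta>)\<^sup>2 \<partial>torus n) \<le> (\<integral>\<^sup>+\<zeta>. (S G \<zeta>)\<^sup>2 \<partial>torus n)"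
    by (intro nn_integral_mono power_mono) auto
  also have "\<dots> \<le> 257 * (\<integral>\<^sup>+\<zeta>. (G \<zeta>)\<^sup>2 \<partial>torus n)"
    by (rule S_norm) measurable
  finally show ?thesis .
qed

section \<open>Power series on the polydisc\<close>

abbreviation mon :: "nat \<Rightarrow> (nat \<Rightarrow> nat) \<Rightarrow> (nat \<Rightarrow> complex) \<Rightarrow> complex"
  where "mon n \<alpha> z \<equiv> (\<Prod>i<n. z i ^ \<alpha> i)"

definition deg :: "nat \<Rightarrow> (nat \<Rightarrow> nat) \<Rightarrow> nat"
  where "deg n \<alpha> = (\<Sum>i<n. \<alpha> i)"

definition closed_polydisc :: "nat \<Rightarrow> (nat \<Rightarrow> complex) set"
  where "closed_polydisc n = ({..<n} \<rightarrow>\<^sub>E cball 0 1)"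

lemma torus_subset_closed_polydisc: "space (torus n) \<subseteq> closed_polydisc n"
  unfolding space_torus closed_polydisc_def by (rule PiE_mono) auto

lemma compact_PiE_lessThan:
  fixes S :: "'a::topological_space set"
  assumes "compact S"
  shows "compact ({..<n::nat} \<rightarrow>\<^sub>E S)"
proof -
  have "({..<n} \<rightarrow>\<^sub>E S) = Pi\<^sub>E UNIV (\<lambda>i. if i < n then S else {undefined})"
  proof (rule set_eqI)
    fix x show "x \<in> ({..<n} \<rightarrow>\<^sub>E S) \<longleftrightarrow> x \<in> Pi\<^sub>E UNIV (\<lambda>i. if i < n then S else {undefined})"
      unfolding PiE_iff by (auto simp: extensional_def split: if_splits)
  qed
  moreover have "compactin (product_topology (\<lambda>_. euclidean) UNIV) (Pi\<^sub>E UNIV (\<lambda>i. if i < n then S else {undefined}))"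
    unfolding compactin_PiE using assms by auto
  ultimately show ?thesis by (simp add: euclidean_product_topology)
qed

lemma compact_torus: "compact (space (torus n))"
  unfolding space_torus by (rule compact_PiE_lessThan) simp

lemma borel_measurable_torus_continuous:
  fixes f :: "(nat \<Rightarrow> complex) \<Rightarrow> 'a::topological_space"
  assumes "continuous_on (space (torus n)) f"
  shows "f \<in> borel_measurable (torus n)"
proof -
  have "(\<lambda>\<zeta>. \<zeta> i) \<in> borel_measurable (torus n)" for i
  proof (cases "i < n")
    case False
    then have "(\<lambda>\<zeta>. \<zeta> i) \<in> borel_measurable (torus n) \<longleftrightarrow> (\<lambda>\<zeta>. undefined :: complex) \<in> borel_measurable (torus n)"
      by (intro measurable_cong) (auto simp: space_torus PiE_iff extensional_def)
    then show ?thesis by simp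
  qed (use measurable_torus_component[of "\<lambda>\<zeta>. \<zeta>"] in auto)
  then have "(\<lambda>\<zeta>. \<zeta>) \<in> borel_measurable (torus n)"
    by (rule measurable_coordinatewise_then_product)
  then have "(\<lambda>\<zeta>. \<zeta>) \<in> torus n \<rightarrow>\<^sub>M restrict_space borel (space (torus n))"
    by (intro measurable_restrict_space2) auto
  from measurable_compose[OF this borel_measurable_continuous_on_restrict[OF assms]]
  show ?thesis by simp
qed

lemma continuous_torus_bounded:
  fixes f :: "(nat \<Rightarrow> complex) \<Rightarrow> 'a::real_normed_vector"
  assumes "continuous_on (space (torus n)) f"
  shows "bounded (f ` space (torus n))"
  by (intro compact_imp_bounded compact_continuous_image assms compact_torus)

lemma integrable_torus_continuous:
  fixes f :: "(nat \<Rightarrow> complex) \<Rightarrow> 'a::{banach, second_countable_topology}"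
  assumes "continuous_on (space (torus n)) f"
  shows "integrable (torus n) f"
proof -
  interpret prob_space "torus n" by (rule prob_space_torus)
  obtain B where "\<forall>x\<in>space (torus n). norm (f x) \<le> B"
    using continuous_torus_bounded[OF assms] by (auto simp: bounded_iff)
  then show ?thesis
    by (intro integrable_const_bound[where B=B] borel_measurable_torus_continuous assms) auto
qed

lemma torus_uniform_limit_integral:
  fixes f :: "'b \<Rightarrow> (nat \<Rightarrow> complex) \<Rightarrow> complex"
  assumes c: "\<And>A. continuous_on (space (torus n)) (f A)"
    and u: "uniform_limit (space (torus n)) f g F" and F: "F \<noteq> bot"
  shows "((\<lambda>A. LINT \<zeta>|torus n. f A \<zeta>) \<longlongrightarrow> (LINT \<zeta>|torus n. g \<zeta>)) F"
proof (rule tendstoI)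
  interpret prob_space "torus n" by (rule prob_space_torus)
  have g: "continuous_on (space (torus n)) g"
    by (rule uniform_limit_theorem[OF _ u F]) (simp add: c)
  fix e :: real assume e: "e > 0"
  have "\<forall>\<^sub>F A in F. \<forall>\<zeta>\<in>space (torus n). dist (f A \<zeta>) (g \<zeta>) < e / 2"
    using u e unfolding uniform_limit_iff by (meson half_gt_zero)
  then show "\<forall>\<^sub>F A in F. dist (LINT \<zeta>|torus n. f A \<zeta>) (LINT \<zeta>|torus n. g \<zeta>) < e"
  proof eventually_elim
    case (elim A)
    have i: "integrable (torus n) (f A)" "integrable (torus n) g"
      by (intro integrable_torus_continuous c g)+
    have "dist (LINT \<zeta>|torus n. f A \<zeta>) (LINT \<zeta>|torus n. g \<zeta>) = cmod (LINT \<zeta>|torus n. f A \<zeta> - g \<zeta>)"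
      using i by (simp add: dist_norm)
    also have "\<dots> \<le> (LINT \<zeta>|torus n. cmod (f A \<zeta> - g \<zeta>))" by (rule integral_norm_bound)
    also have "\<dots> \<le> (LINT \<zeta>|torus n. e / 2)"
      using i elim by (intro integral_mono) (auto simp: dist_norm less_imp_le)
    also have "\<dots> < e" using e by (simp add: prob_space)
    finally show ?case .
  qed
qed

lemma continuous_on_coordinate [simp, continuous_intros]:
  "continuous_on X (\<lambda>x. x i :: 'b::topological_space)"
  by (rule continuous_on_subset[OF continuous_on_product_coordinates]) simp

lemma continuous_on_dil [continuous_intros]:
  assumes "continuous_on X c" "continuous_on X g"
  shows "continuous_on X (\<lambda>x. dil n (c x) (g x))"
proof (rule continuous_on_coordinatewise_then_product)
  fix i
  show "continuous_on X (\<lambda>x. dil n (c x) (g x) i)"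
  proof (cases "i < n")
    case True
    then show ?thesis
      using continuous_on_mult[OF assms(1) continuous_on_product_then_coordinatewise[OF assms(2), of i]] by simp
  next
    case False
    then show ?thesis by (simp add: dil_def)
  qed
qed

lemma continuous_on_mon [continuous_intros]:
  "continuous_on X g \<Longrightarrow> continuous_on X (\<lambda>x. mon n \<alpha> (g x))"
  by (intro continuous_on_prod continuous_on_power) (rule continuous_on_product_then_coordinatewise)

lemma dil_in_PiE: "dil n c z \<in> ({..<n} \<rightarrow>\<^sub>E S) \<longleftrightarrow> (\<forall>i<n. c * z i \<in> S)"
  unfolding dil_def restrict_PiE_iff by auto

lemma in_closed_polydisc: "z \<in> closed_polydisc n \<longleftrightarrow> (\<forall>i<n. cmod (z i) \<le> 1) \<and> z \<in> extensional {..<n}"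
  unfolding closed_polydisc_def PiE_iff by auto

lemma in_polydisc: "z \<in> polydisc n \<longleftrightarrow> (\<forall>i<n. cmod (z i) < 1) \<and> z \<in> extensional {..<n}"
  unfolding polydisc_def PiE_iff by auto

lemma dil_polydisc:
  assumes "z \<in> closed_polydisc n" "cmod c < 1"
  shows "dil n c z \<in> polydisc n"
proof -
  have "cmod c * cmod (z i) < 1" if "i < n" for i
  proof -
    have "cmod c * cmod (z i) \<le> cmod c * 1"
      using assms that by (intro mult_left_mono) (auto simp: in_closed_polydisc)
    then show ?thesis using assms by simp
  qed
  then show ?thesis unfolding polydisc_def dil_in_PiE by (simp add: norm_mult)
qed

lemma dil_torus_polydisc: "\<zeta> \<in> space (torus n) \<Longrightarrow> cmod c < 1 \<Longrightarrow> dil n c \<zeta> \<in> polydisc n"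
  using dil_polydisc torus_subset_closed_polydisc by blast

lemma mon_dil: "mon n \<alpha> (dil n c z) = c ^ deg n \<alpha> * mon n \<alpha> z"
  by (simp add: deg_def power_mult_distrib prod.distrib power_sum)

lemma norm_mon_torus: "\<zeta> \<in> space (torus n) \<Longrightarrow> cmod (mon n \<alpha> \<zeta>) = 1"
  by (simp add: prod_norm[symmetric] norm_power norm_torus)

lemma norm_mon_closed_polydisc: "z \<in> closed_polydisc n \<Longrightarrow> cmod (mon n \<alpha> z) \<le> 1"
  by (auto simp: prod_norm[symmetric] norm_power in_closed_polydisc intro!: prod_le_1 power_le_one)

lemma product_sigma_finite_circle: "product_sigma_finite (\<lambda>_::nat. circle)"
proof -
  interpret prob_space circle by (rule prob_space_circle)
  show ?thesis by unfold_locales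
qed

lemma integral_torus_monomials:
  assumes "\<alpha> \<in> multiindices n" "\<beta> \<in> multiindices n"
  shows "(LINT \<zeta>|torus n. mon n \<alpha> \<zeta> * cnj (mon n \<beta> \<zeta>)) = (if \<alpha> = \<beta> then 1 else 0)"
proof -
  interpret product_sigma_finite "\<lambda>_::nat. circle" by (rule product_sigma_finite_circle)
  have "(LINT \<zeta>|torus n. mon n \<alpha> \<zeta> * cnj (mon n \<beta> \<zeta>)) =
        (LINT \<zeta>|torus n. (\<Prod>i<n. \<zeta> i ^ \<alpha> i * cnj (\<zeta> i) ^ \<beta> i))"
    by (simp add: prod.distrib)
  also have "\<dots> = (\<Prod>i<n. LINT w|circle. w ^ \<alpha> i * cnj w ^ \<beta> i)"
    unfolding torus_def
    by (intro product_integral_prod integrable_circle_continuous continuous_intros) auto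
  also have "\<dots> = (\<Prod>i<n. if \<alpha> i = \<beta> i then 1 else 0)"
    by (simp add: integral_circle_monomials)
  also have "\<dots> = (if \<alpha> = \<beta> then 1 else 0)"
  proof (cases "\<alpha> = \<beta>")
    case False
    then obtain i where "i < n" "\<alpha> i \<noteq> \<beta> i"
      using assms by (auto simp: multiindices_def PiE_iff extensional_def fun_eq_iff) metis
    then show ?thesis using False by (auto intro!: prod_zero bexI[of _ i])
  qed simp
  finally show ?thesis .
qed

lemma geometric_multi_summable:
  fixes x :: "nat \<Rightarrow> complex"
  assumes "\<And>i. i < n \<Longrightarrow> cmod (x i) < 1"
  shows "(\<lambda>\<alpha>. cmod (mon n \<alpha> x)) summable_on multiindices n"
proof -
  have 1: "(\<lambda>k. norm (x i ^ k)) summable_on UNIV" if "i < n" for i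
    using assms[OF that] by (intro summable_nonneg_imp_summable_on) (auto simp: norm_power summable_geometric)
  have "Infinite_Set_Sum.abs_summable_on (\<lambda>\<alpha>. \<Prod>i\<in>{..<n}. x i ^ \<alpha> i) (PiE {..<n} (\<lambda>_. UNIV))"
    by (rule Infinite_Set_Sum.abs_summable_on_prod_PiE) (use 1 in \<open>auto simp: abs_summable_equivalent[symmetric]\<close>)
  then show ?thesis
    by (simp add: abs_summable_equivalent[symmetric] multiindices_def)
qed

text \<open>The product of the geometric series in the single variables.\<close>

lemma geometric_multi_has_sum:
  fixes x :: "nat \<Rightarrow> complex"
  assumes "\<And>i. i < n \<Longrightarrow> cmod (x i) < 1"
  shows "((\<lambda>\<alpha>. mon n \<alpha> x) has_sum (\<Prod>i<n. 1 / (1 - x i))) (multiindices n)"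
proof -
  have 1: "(\<lambda>k. norm (x i ^ k)) summable_on UNIV" if "i < n" for i
    using assms[OF that] by (intro summable_nonneg_imp_summable_on) (auto simp: norm_power summable_geometric)
  have "infsum (\<lambda>\<alpha>. mon n \<alpha> x) (multiindices n) = (\<Prod>i<n. infsum (\<lambda>k. x i ^ k) UNIV)"
    unfolding multiindices_def by (rule infsum_prod_PiE_abs) (use 1 in auto)
  also have "\<dots> = (\<Prod>i<n. 1 / (1 - x i))"
  proof (rule prod.cong)
    fix i assume "i \<in> {..<n}"
    then have i: "i < n" by simp
    have "((\<lambda>k. x i ^ k) has_sum (1 / (1 - x i))) UNIV"
      using geometric_sums[OF assms[OF i]] assms[OF i]
      by (intro norm_summable_imp_has_sum) (auto simp: norm_power summable_geometric)
    then show "infsum (\<lambda>k. x i ^ k) UNIV = 1 / (1 - x i)" by (rule infsumI)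
  qed simp
  finally show ?thesis
    using has_sum_infsum[OF abs_summable_summable[OF geometric_multi_summable[of n x, OF assms]]] by simp
qed

lemma continuous_on_fun_upd:
  fixes g :: "'x::topological_space \<Rightarrow> nat \<Rightarrow> complex"
  assumes "continuous_on X g" "continuous_on X h"
  shows "continuous_on X (\<lambda>x. (g x)(i := h x))"
proof (rule continuous_on_coordinatewise_then_product)
  fix j show "continuous_on X (\<lambda>x. ((g x)(i := h x)) j)"
    using assms by (cases "j = i") (simp_all add: continuous_on_product_then_coordinatewise)
qed

text \<open>Induction on the number of variables: the formula for the first \<open>n\<close> variables is applied with the
  last one fixed, and the values so obtained are expressed by the formula for one variable.\<close>

lemma polydisc_Cauchy_integral:
  assumes "continuous_on (closed_polydisc n) F"
    and "\<And>z i. z \<in> closed_polydisc n \<Longrightarrow> i < n \<Longrightarrow> (\<lambda>w. F (z(i := w))) holomorphic_on ball 0 1"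
    and "z \<in> polydisc n"
  shows "(LINT \<zeta>|torus n. F \<zeta> * (\<Prod>i<n. 1 / (1 - z i * cnj (\<zeta> i)))) = F z"
  using assms
proof (induction n arbitrary: F z)
  case 0
  interpret prob_space "torus 0" by (rule prob_space_torus)
  have "(LINT \<zeta>|torus 0. F \<zeta> * (\<Prod>i<0. 1 / (1 - z i * cnj (\<zeta> i)))) = (LINT \<zeta>|torus 0. F z)"
    using "0.prems"(3) by (intro Bochner_Integration.integral_cong) (auto simp: space_torus polydisc_def)
  then show ?case by (simp add: prob_space)
next
  case (Suc n)
  interpret product_sigma_finite "\<lambda>_::nat. circle" by (rule product_sigma_finite_circle)
  let ?k = "\<lambda>i \<zeta>. 1 / (1 - z i * cnj (\<zeta> i))"
  have zn: "cmod (z i) < 1" if "i < Suc n" for i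
    using Suc.prems(3) that by (auto simp: in_polydisc)
  have nz: "1 - z i * cnj w \<noteq> 0" if "i < Suc n" "cmod w = 1" for w i
  proof
    assume "1 - z i * cnj w = 0"
    then have "cmod (z i * cnj w) = 1" by (metis eq_iff_diff_eq_0 norm_one)
    then show False using zn[OF that(1)] that by (simp add: norm_mult)
  qed
  have upd: "\<zeta>(n := w) \<in> closed_polydisc (Suc n)" if "\<zeta> \<in> closed_polydisc n" "cmod w \<le> 1" for \<zeta> w
    using that by (auto simp: in_closed_polydisc extensional_def less_Suc_eq)
  have cF: "continuous_on (closed_polydisc n) (\<lambda>\<zeta>. F (\<zeta>(n := w)))" if "cmod w \<le> 1" for w
    by (rule continuous_on_compose2[OF Suc.prems(1) continuous_on_fun_upd[OF continuous_on_id continuous_on_const]])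
      (use upd that in blast)
  have 1: "F z = (LINT \<zeta>|torus n. F (\<zeta>(n := z n)) * (\<Prod>i<n. ?k i \<zeta>))"
  proof -
    define z' where "z' = restrict z {..<n}"
    have z': "z' \<in> polydisc n" using Suc.prems(3) by (auto simp: z'_def in_polydisc)
    have e: "z'(n := z n) = z" using Suc.prems(3)
      by (auto simp: z'_def in_polydisc extensional_def fun_eq_iff)
    have "(\<lambda>w. F ((\<zeta>(i := w))(n := z n))) holomorphic_on ball 0 1"
      if "\<zeta> \<in> closed_polydisc n" "i < n" for \<zeta> i
    proof -
      have "(\<zeta>(i := w))(n := z n) = (\<zeta>(n := z n))(i := w)" for w
        using that(2) by (intro fun_upd_twist) auto
      then show ?thesis
        using Suc.prems(2)[OF upd[OF that(1), of "z n"], of i] zn[of n] that by (simp del: fun_upd_apply)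
    qed
    from Suc.IH[OF cF this z'] zn[of n] have "(LINT \<zeta>|torus n. F (\<zeta>(n := z n)) * (\<Prod>i<n. 1 / (1 - z' i * cnj (\<zeta> i)))) = F (z'(n := z n))"
      by (simp del: fun_upd_apply)
    moreover have "(\<Prod>i<n. 1 / (1 - z' i * cnj (\<zeta> i))) = (\<Prod>i<n. ?k i \<zeta>)" for \<zeta>
      by (rule prod.cong) (auto simp: z'_def)
    ultimately show ?thesis by (simp add: e)
  qed
  have 2: "F (\<zeta>(n := z n)) = (LINT w|circle. F (\<zeta>(n := w)) / (1 - z n * cnj w))" if \<zeta>: "\<zeta> \<in> space (torus n)" for \<zeta>
  proof (rule Cauchy_integral_circle[symmetric])
    have \<zeta>': "\<zeta> \<in> closed_polydisc n" using that torus_subset_closed_polydisc by blast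
    show "continuous_on (cball 0 1) (\<lambda>w. F (\<zeta>(n := w)))"
      by (rule continuous_on_compose2[OF Suc.prems(1) continuous_on_fun_upd[OF continuous_on_const continuous_on_id]])
        (use upd[OF \<zeta>'] in auto)
    show "(\<lambda>w. F (\<zeta>(n := w))) holomorphic_on ball 0 1"
      using Suc.prems(2)[OF upd[OF \<zeta>', of 0], of n] by (simp del: fun_upd_apply)
  qed (use zn in auto)
  have int: "integrable (torus (Suc n)) (\<lambda>\<zeta>. F \<zeta> * (\<Prod>i<Suc n. ?k i \<zeta>))"
    by (intro integrable_torus_continuous continuous_on_mult continuous_on_prod continuous_on_divide
        continuous_on_diff continuous_on_const continuous_on_cnj continuous_on_subset[OF Suc.prems(1)]
        torus_subset_closed_polydisc continuous_on_product_then_coordinatewise[OF continuous_on_id])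
      (use nz norm_torus in auto)
  have "(LINT \<zeta>|torus (Suc n). F \<zeta> * (\<Prod>i<Suc n. ?k i \<zeta>)) =
    (LINT \<zeta>|torus n. LINT w|circle. F (\<zeta>(n := w)) * (\<Prod>i<Suc n. ?k i (\<zeta>(n := w))))"
    using int unfolding torus_def lessThan_Suc by (intro product_integral_insert) auto
  also have "\<dots> = (LINT \<zeta>|torus n. F (\<zeta>(n := z n)) * (\<Prod>i<n. ?k i \<zeta>))"
  proof (rule Bochner_Integration.integral_cong)
    fix \<zeta> assume \<zeta>: "\<zeta> \<in> space (torus n)"
    have "(LINT w|circle. F (\<zeta>(n := w)) * (\<Prod>i<Suc n. ?k i (\<zeta>(n := w)))) =
      (LINT w|circle. F (\<zeta>(n := w)) / (1 - z n * cnj w) * (\<Prod>i<n. ?k i \<zeta>))"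
      by (intro Bochner_Integration.integral_cong) (auto simp: mult_ac)
    then show "(LINT w|circle. F (\<zeta>(n := w)) * (\<Prod>i<Suc n. ?k i (\<zeta>(n := w)))) = F (\<zeta>(n := z n)) * (\<Prod>i<n. ?k i \<zeta>)"
      by (simp only: 2[OF \<zeta>] integral_mult_left_zero)
  qed simp
  finally show ?case by (simp add: 1)
qed

lemma power_series_summable:
  assumes ps: "\<And>z. z \<in> polydisc n \<Longrightarrow> ((\<lambda>\<alpha>. c \<alpha> * mon n \<alpha> z) has_sum f z) (multiindices n)"
    and r: "0 \<le> r" "r < 1"
  shows "(\<lambda>\<alpha>. cmod (c \<alpha>) * r ^ deg n \<alpha>) summable_on multiindices n"
proof -
  \<comment> \<open>At the point \<open>(r, \<dots>, r)\<close> the moduli of all terms are as large as on the torus of radius \<open>r\<close>.\<close>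
  define z where "z = dil n (of_real r) (\<lambda>i\<in>{..<n}. 1)"
  have "z \<in> polydisc n" unfolding z_def by (rule dil_polydisc) (use r in \<open>auto simp: in_closed_polydisc\<close>)
  from has_sum_imp_summable[OF ps[OF this]]
  have "(\<lambda>\<alpha>. norm (c \<alpha> * mon n \<alpha> z)) summable_on multiindices n"
    by (simp only: summable_on_iff_abs_summable_on_complex)
  moreover have "mon n \<alpha> z = of_real r ^ deg n \<alpha>" for \<alpha>
    unfolding z_def mon_dil by simp
  ultimately show ?thesis using r by (simp add: norm_mult norm_power)
qed

text \<open>On a polydisc of radius \<open>r < 1\<close> the terms are dominated by those at the point \<open>(r, \<dots>, r)\<close>. The
  set \<open>X\<close> and the map \<open>g\<close> allow the torus as well as a complex line to parametrise the points.\<close>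

lemma power_series_uniform:
  assumes ps: "\<And>z. z \<in> polydisc n \<Longrightarrow> ((\<lambda>\<alpha>. c \<alpha> * mon n \<alpha> z) has_sum f z) (multiindices n)"
    and r: "0 \<le> r" "r < 1"
    and X: "\<And>x. x \<in> X \<Longrightarrow> \<exists>\<zeta> w. g x = dil n w \<zeta> \<and> cmod w \<le> r \<and> \<zeta> \<in> closed_polydisc n"
  shows "uniform_limit X (\<lambda>A x. \<Sum>\<alpha>\<in>A. c \<alpha> * mon n \<alpha> (g x)) (\<lambda>x. f (g x)) (finite_subsets_at_top (multiindices n))"
proof (rule Weierstrass_m_test_general'[OF _ _ power_series_summable[OF ps r]])
  fix \<alpha> x assume "x \<in> X"
  then obtain \<zeta> w where e: "g x = dil n w \<zeta>" "cmod w \<le> r" "\<zeta> \<in> closed_polydisc n" using X by blast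
  have "cmod w ^ deg n \<alpha> * cmod (mon n \<alpha> \<zeta>) \<le> r ^ deg n \<alpha> * 1"
    using e r norm_mon_closed_polydisc[OF e(3)] by (intro mult_mono power_mono) auto
  then show "cmod (c \<alpha> * mon n \<alpha> (g x)) \<le> cmod (c \<alpha>) * r ^ deg n \<alpha>"
    unfolding e mon_dil by (simp add: norm_mult norm_power mult_left_mono)
next
  fix x assume "x \<in> X"
  then obtain \<zeta> w where e: "g x = dil n w \<zeta>" "cmod w \<le> r" "\<zeta> \<in> closed_polydisc n" using X by blast
  have "g x \<in> polydisc n" unfolding e(1) by (rule dil_polydisc) (use e r in auto)
  then show "((\<lambda>\<alpha>. c \<alpha> * mon n \<alpha> (g x)) has_sum f (g x)) (multiindices n)" by (rule ps)
qed

text \<open>Termwise integration and orthogonality of the monomials; in particular the coefficients are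
  determined by the function.\<close>

lemma power_series_coeff:
  assumes ps: "\<And>z. z \<in> polydisc n \<Longrightarrow> ((\<lambda>\<alpha>. c \<alpha> * mon n \<alpha> z) has_sum f z) (multiindices n)"
    and r: "0 \<le> r" "r < 1" and \<alpha>: "\<alpha> \<in> multiindices n"
  shows "(LINT \<zeta>|torus n. f (dil n (of_real r) \<zeta>) * cnj (mon n \<alpha> \<zeta>)) = c \<alpha> * of_real r ^ deg n \<alpha>"
proof -
  let ?F = "finite_subsets_at_top (multiindices n)"
  have u: "uniform_limit (space (torus n)) (\<lambda>A \<zeta>. \<Sum>\<beta>\<in>A. c \<beta> * mon n \<beta> (dil n (of_real r) \<zeta>)) (\<lambda>\<zeta>. f (dil n (of_real r) \<zeta>)) ?F"
    by (rule power_series_uniform[OF ps r]) (use r torus_subset_closed_polydisc in \<open>force\<close>)+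
  have cn: "continuous_on (space (torus n)) (\<lambda>\<zeta>. \<Sum>\<beta>\<in>A. c \<beta> * mon n \<beta> (dil n (of_real r) \<zeta>))" for A
    by (intro continuous_intros)
  have fc: "continuous_on (space (torus n)) (\<lambda>\<zeta>. f (dil n (of_real r) \<zeta>))"
    by (rule uniform_limit_theorem[OF _ u]) (use cn in auto)
  have "uniform_limit (space (torus n)) (\<lambda>A \<zeta>. (\<Sum>\<beta>\<in>A. c \<beta> * mon n \<beta> (dil n (of_real r) \<zeta>)) * cnj (mon n \<alpha> \<zeta>))
    (\<lambda>\<zeta>. f (dil n (of_real r) \<zeta>) * cnj (mon n \<alpha> \<zeta>)) ?F"
    by (intro uniform_lim_mult u uniform_limit_const continuous_torus_bounded fc continuous_intros)
  then have "((\<lambda>A. LINT \<zeta>|torus n. (\<Sum>\<beta>\<in>A. c \<beta> * mon n \<beta> (dil n (of_real r) \<zeta>)) * cnj (mon n \<alpha> \<zeta>)) \<longlongrightarrow>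
     (LINT \<zeta>|torus n. f (dil n (of_real r) \<zeta>) * cnj (mon n \<alpha> \<zeta>))) ?F"
    by (rule torus_uniform_limit_integral[rotated]) (auto intro!: continuous_intros)
  moreover have "((\<lambda>A. LINT \<zeta>|torus n. (\<Sum>\<beta>\<in>A. c \<beta> * mon n \<beta> (dil n (of_real r) \<zeta>)) * cnj (mon n \<alpha> \<zeta>)) \<longlongrightarrow>
     c \<alpha> * of_real r ^ deg n \<alpha>) ?F"
  proof (rule tendsto_eventually)
    have "\<forall>\<^sub>F A in ?F. finite A \<and> {\<alpha>} \<subseteq> A \<and> A \<subseteq> multiindices n"
      unfolding eventually_finite_subsets_at_top using \<alpha> by (intro exI[of _ "{\<alpha>}"]) auto
    then show "\<forall>\<^sub>F A in ?F. (LINT \<zeta>|torus n. (\<Sum>\<beta>\<in>A. c \<beta> * mon n \<beta> (dil n (of_real r) \<zeta>)) * cnj (mon n \<alpha> \<zeta>)) = c \<alpha> * of_real r ^ deg n \<alpha>"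
    proof eventually_elim
      case (elim A)
      have "(LINT \<zeta>|torus n. (\<Sum>\<beta>\<in>A. c \<beta> * mon n \<beta> (dil n (of_real r) \<zeta>)) * cnj (mon n \<alpha> \<zeta>)) =
        (LINT \<zeta>|torus n. (\<Sum>\<beta>\<in>A. (c \<beta> * of_real r ^ deg n \<beta>) * (mon n \<beta> \<zeta> * cnj (mon n \<alpha> \<zeta>))))"
        unfolding mon_dil by (simp add: sum_distrib_right sum_distrib_left mult_ac)
      also have "\<dots> = (\<Sum>\<beta>\<in>A. (c \<beta> * of_real r ^ deg n \<beta>) * (LINT \<zeta>|torus n. mon n \<beta> \<zeta> * cnj (mon n \<alpha> \<zeta>)))"
        by (subst Bochner_Integration.integral_sum) (auto intro!: integrable_torus_continuous continuous_intros simp del: cnj_prod)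
      also have "\<dots> = (\<Sum>\<beta>\<in>A. if \<beta> = \<alpha> then c \<alpha> * of_real r ^ deg n \<alpha> else 0)"
        using elim \<alpha> by (intro sum.cong refl) (auto simp: integral_torus_monomials simp del: cnj_prod)
      also have "\<dots> = c \<alpha> * of_real r ^ deg n \<alpha>" using elim by auto
      finally show ?case .
    qed
  qed
  ultimately show ?thesis by (rule tendsto_unique[rotated]) simp
qed

lemma polydisc_as_dil:
  assumes "z \<in> polydisc n"
  obtains r z' where "0 < r" "r < 1" "z' \<in> polydisc n" "z = dil n (of_real r) z'"
proof -
  have "\<exists>r. 0 < r \<and> r < 1 \<and> (\<forall>i<n. cmod (z i) < r)"
  proof -
    have "Max (insert 0 ((\<lambda>i. cmod (z i)) ` {..<n})) < 1"
      using assms by (auto simp: in_polydisc)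
    from dense[OF this] obtain r where r: "Max (insert 0 ((\<lambda>i. cmod (z i)) ` {..<n})) < r" "r < 1" by blast
    then show ?thesis by (intro exI[of _ r]) (auto)
  qed
  then obtain r where r: "0 < r" "r < 1" "\<And>i. i < n \<Longrightarrow> cmod (z i) < r" by blast
  show ?thesis
  proof (rule that[OF r(1,2)])
    show "dil n (1 / of_real r) z \<in> polydisc n"
      unfolding polydisc_def dil_in_PiE using r by (simp add: norm_mult norm_divide)
    show "z = dil n (of_real r) (dil n (1 / of_real r) z)"
      using r assms by (simp) (metis dil_1 in_polydisc)
  qed
qed

lemma continuous_on_dil_torus:
  assumes "continuous_on (polydisc n) f" "cmod c < 1"
  shows "continuous_on (closed_polydisc n) (\<lambda>\<zeta>. f (dil n c \<zeta>))"
  by (rule continuous_on_compose2[OF assms(1)])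
    (use assms dil_polydisc in \<open>auto intro!: continuous_on_dil continuous_on_const continuous_on_id\<close>)

text \<open>Holomorphy in one coordinate, up to the boundary of the disc because of the dilation.\<close>

lemma dil_slice:
  assumes f: "holomorphic_polydisc n f" and y: "y \<in> closed_polydisc n" and i: "i < n" and r: "0 \<le> r" "r < 1"
  shows "continuous_on (cball 0 1) (\<lambda>w. f (dil n (of_real r) (y(i := w))))"
    "(\<lambda>w. f (dil n (of_real r) (y(i := w)))) holomorphic_on ball 0 1"
proof -
  have cl: "y(i := w) \<in> closed_polydisc n" if "cmod w \<le> 1" for w
    using y i that by (auto simp: in_closed_polydisc extensional_def)
  show "continuous_on (cball 0 1) (\<lambda>w. f (dil n (of_real r) (y(i := w))))"
  proof (rule continuous_on_compose2[where g=f and f="\<lambda>w. dil n (of_real r) (y(i := w))"])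
    show "continuous_on (polydisc n) f" using f by (simp add: holomorphic_polydisc_def)
    show "continuous_on (cball 0 1) (\<lambda>w. dil n (of_real r) (y(i := w)))"
      by (intro continuous_on_dil continuous_on_const continuous_on_fun_upd continuous_on_id)
    show "(\<lambda>w. dil n (of_real r) (y(i := w))) ` cball 0 1 \<subseteq> polydisc n"
      using r by (intro image_subsetI dil_polydisc cl) auto
  qed
  have e: "dil n (of_real r) (y(i := w)) = (dil n (of_real r) y)(i := of_real r * w)" for w
    using i by (auto simp: dil_def fun_eq_iff)
  have "dil n (of_real r) y \<in> polydisc n" by (rule dil_polydisc[OF y]) (use r in auto)
  then have "(\<lambda>w. f ((dil n (of_real r) y)(i := w))) holomorphic_on ball 0 1"
    using f i by (auto simp: holomorphic_polydisc_def)
  moreover have "(\<lambda>w. of_real r * w) ` ball 0 1 \<subseteq> ball (0::complex) 1"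
  proof (rule image_subsetI)
    fix w :: complex assume "w \<in> ball 0 1"
    then have "r * cmod w \<le> 1 * cmod w" "cmod w < 1" using r by (auto intro!: mult_left_le_one_le)
    then show "of_real r * w \<in> ball 0 1" using r by (simp add: norm_mult)
  qed
  moreover have "(\<lambda>w. of_real r * w) holomorphic_on ball 0 1" by (intro holomorphic_intros)
  ultimately show "(\<lambda>w. f (dil n (of_real r) (y(i := w)))) holomorphic_on ball 0 1"
    unfolding e using holomorphic_on_compose_gen[of "\<lambda>w. of_real r * w" "ball 0 1" "\<lambda>w. f ((dil n (of_real r) y)(i := w))" "ball 0 1"]
    by (simp add: o_def)
qed

text \<open>For each radius \<open>r\<close>, expanding the Cauchy kernel in a geometric series gives an expansion of
  \<open>z \<mapsto> f (r \<cdot> z)\<close> with some coefficients \<open>a r\<close>. By \<open>power_series_coeff\<close> the numbers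
  \<open>a r \<alpha> / r ^ deg n \<alpha>\<close> do not depend on \<open>r\<close>; they are the coefficients of \<open>f\<close>.\<close>

lemma holomorphic_polydisc_has_power_series:
  assumes f: "holomorphic_polydisc n f"
  shows "\<exists>c. has_power_series n f c"
proof -
  define a where "a r \<alpha> = (LINT \<zeta>|torus n. f (dil n (of_real r) \<zeta>) * cnj (mon n \<alpha> \<zeta>))" for r \<alpha>
  have cont: "continuous_on (closed_polydisc n) (\<lambda>\<zeta>. f (dil n (of_real r) \<zeta>))" if "0 \<le> r" "r < 1" for r
    using f that by (intro continuous_on_dil_torus) (auto simp: holomorphic_polydisc_def)
  have Cauchy: "(LINT \<zeta>|torus n. f (dil n (of_real r) \<zeta>) * (\<Prod>i<n. 1 / (1 - z i * cnj (\<zeta> i)))) = f (dil n (of_real r) z)"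
    if r: "0 \<le> r" "r < 1" and z: "z \<in> polydisc n" for r z
    by (rule polydisc_Cauchy_integral[OF cont[OF r] _ z]) (rule dil_slice(2)[OF f _ _ r])
  have ser: "((\<lambda>\<alpha>. a r \<alpha> * mon n \<alpha> z) has_sum f (dil n (of_real r) z)) (multiindices n)"
    if r: "0 \<le> r" "r < 1" and z: "z \<in> polydisc n" for r z
  proof -
    let ?F = "finite_subsets_at_top (multiindices n)"
    have z1: "cmod (z i) < 1" if "i < n" for i using z that by (auto simp: in_polydisc)
    have fc: "continuous_on (space (torus n)) (\<lambda>\<zeta>. f (dil n (of_real r) \<zeta>))"
      using cont[OF r] torus_subset_closed_polydisc continuous_on_subset by blast
    have u: "uniform_limit (space (torus n)) (\<lambda>A \<zeta>. \<Sum>\<alpha>\<in>A. mon n \<alpha> z * cnj (mon n \<alpha> \<zeta>)) (\<lambda>\<zeta>. \<Prod>i<n. 1 / (1 - z i * cnj (\<zeta> i))) ?F"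
    proof (rule Weierstrass_m_test_general'[OF _ _ geometric_multi_summable[OF z1]])
      fix \<alpha> \<zeta> assume "\<zeta> \<in> space (torus n)"
      then show "cmod (mon n \<alpha> z * cnj (mon n \<alpha> \<zeta>)) \<le> cmod (mon n \<alpha> z)"
        by (simp add: norm_mult norm_mon_torus del: cnj_prod)
    next
      fix \<zeta> assume \<zeta>: "\<zeta> \<in> space (torus n)"
      have "((\<lambda>\<alpha>. mon n \<alpha> (\<lambda>i. z i * cnj (\<zeta> i))) has_sum (\<Prod>i<n. 1 / (1 - z i * cnj (\<zeta> i)))) (multiindices n)"
        by (rule geometric_multi_has_sum) (use \<zeta> z1 norm_torus in \<open>auto simp: norm_mult\<close>)
      then show "((\<lambda>\<alpha>. mon n \<alpha> z * cnj (mon n \<alpha> \<zeta>)) has_sum (\<Prod>i<n. 1 / (1 - z i * cnj (\<zeta> i)))) (multiindices n)"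
        by (simp add: power_mult_distrib prod.distrib)
    qed
    have cn: "continuous_on (space (torus n)) (\<lambda>\<zeta>. \<Sum>\<alpha>\<in>A. mon n \<alpha> z * cnj (mon n \<alpha> \<zeta>))" for A
      by (intro continuous_intros)
    have kc: "continuous_on (space (torus n)) (\<lambda>\<zeta>. \<Prod>i<n. 1 / (1 - z i * cnj (\<zeta> i)))"
      by (rule uniform_limit_theorem[OF _ u]) (use cn in auto)
    have "uniform_limit (space (torus n)) (\<lambda>A \<zeta>. f (dil n (of_real r) \<zeta>) * (\<Sum>\<alpha>\<in>A. mon n \<alpha> z * cnj (mon n \<alpha> \<zeta>)))
       (\<lambda>\<zeta>. f (dil n (of_real r) \<zeta>) * (\<Prod>i<n. 1 / (1 - z i * cnj (\<zeta> i)))) ?F"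
      by (intro uniform_lim_mult u uniform_limit_const continuous_torus_bounded fc kc)
    then have "((\<lambda>A. LINT \<zeta>|torus n. f (dil n (of_real r) \<zeta>) * (\<Sum>\<alpha>\<in>A. mon n \<alpha> z * cnj (mon n \<alpha> \<zeta>))) \<longlongrightarrow>
        (LINT \<zeta>|torus n. f (dil n (of_real r) \<zeta>) * (\<Prod>i<n. 1 / (1 - z i * cnj (\<zeta> i))))) ?F"
      by (rule torus_uniform_limit_integral[rotated]) (auto intro!: continuous_intros fc)
    moreover have "(LINT \<zeta>|torus n. f (dil n (of_real r) \<zeta>) * (\<Sum>\<alpha>\<in>A. mon n \<alpha> z * cnj (mon n \<alpha> \<zeta>))) = (\<Sum>\<alpha>\<in>A. a r \<alpha> * mon n \<alpha> z)" for A
    proof -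
      have "(LINT \<zeta>|torus n. f (dil n (of_real r) \<zeta>) * (\<Sum>\<alpha>\<in>A. mon n \<alpha> z * cnj (mon n \<alpha> \<zeta>))) =
        (LINT \<zeta>|torus n. (\<Sum>\<alpha>\<in>A. mon n \<alpha> z * (f (dil n (of_real r) \<zeta>) * cnj (mon n \<alpha> \<zeta>))))"
        by (simp add: sum_distrib_left mult_ac)
      also have "\<dots> = (\<Sum>\<alpha>\<in>A. mon n \<alpha> z * (LINT \<zeta>|torus n. f (dil n (of_real r) \<zeta>) * cnj (mon n \<alpha> \<zeta>)))"
        by (subst Bochner_Integration.integral_sum) (auto intro!: integrable_torus_continuous continuous_intros fc simp del: cnj_prod)
      finally show ?thesis by (simp add: a_def mult.commute)
    qed
    ultimately show ?thesis
      unfolding has_sum_def Cauchy[OF that] by simp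
  qed
  have rescale: "a s \<alpha> = a r \<alpha> * of_real (s / r) ^ deg n \<alpha>"
    if "0 < s" "s < r" "r < 1" "\<alpha> \<in> multiindices n" for s r \<alpha>
  proof -
    have "(LINT \<zeta>|torus n. (\<lambda>z. f (dil n (of_real r) z)) (dil n (of_real (s / r)) \<zeta>) * cnj (mon n \<alpha> \<zeta>)) = a r \<alpha> * of_real (s / r) ^ deg n \<alpha>"
      by (rule power_series_coeff[where c="a r"]) (use that ser in auto)
    then show ?thesis using that by (simp add: a_def)
  qed
  \<comment> \<open>The coefficients read off at the radius \<open>1/2\<close>; any other radius gives the same.\<close>
  define c where "c = (\<lambda>\<alpha>\<in>multiindices n. a (1/2) \<alpha> * 2 ^ deg n \<alpha>)"
  have c: "c \<alpha> * of_real r ^ deg n \<alpha> = a r \<alpha>" if "0 < r" "r < 1" "\<alpha> \<in> multiindices n" for r \<alpha>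
  proof -
    have "a (1/2) \<alpha> * (2 ^ deg n \<alpha> * of_real r ^ deg n \<alpha>) = a r \<alpha>"
    proof (cases r "1/2 :: real" rule: linorder_cases)
      case less
      then have "a r \<alpha> = a (1/2) \<alpha> * (of_real (r / (1/2))) ^ deg n \<alpha>"
        using rescale[of r "1/2" \<alpha>] that by simp
      then show ?thesis by (simp add: power_mult_distrib mult.commute)
    next
      case equal
      have "2 ^ deg n \<alpha> * complex_of_real r ^ deg n \<alpha> = (2 * complex_of_real r) ^ deg n \<alpha>"
        by (simp only: power_mult_distrib)
      then show ?thesis unfolding equal by simp
    next
      case greater
      then have "a (1/2) \<alpha> * (2 ^ deg n \<alpha> * of_real r ^ deg n \<alpha>) = a r \<alpha> * (of_real (1/2 / r) * (2 * of_real r)) ^ deg n \<alpha>"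
        using rescale[of "1/2" r \<alpha>] that by (simp only: power_mult_distrib mult.assoc)
      then show ?thesis using that by simp
    qed
    then show ?thesis using that by (simp add: c_def mult_ac)
  qed
  have "has_power_series n f c"
    unfolding has_power_series_def
  proof (intro conjI ballI)
    show "c \<in> extensional (multiindices n)" by (simp add: c_def)
    fix z assume "z \<in> polydisc n"
    then obtain r z' where r: "0 < r" "r < 1" "z' \<in> polydisc n" "z = dil n (of_real r) z'" by (rule polydisc_as_dil)
    have "((\<lambda>\<alpha>. a r \<alpha> * mon n \<alpha> z') has_sum f z) (multiindices n)"
      using ser[of r z'] r by simp
    then show "((\<lambda>\<alpha>. c \<alpha> * mon n \<alpha> z) has_sum f z) (multiindices n)"
      unfolding r(4) mon_dil
    proof (rule has_sum_cong[THEN iffD1, rotated])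
      fix \<alpha> assume "\<alpha> \<in> multiindices n"
      from c[OF r(1,2) this] show "a r \<alpha> * mon n \<alpha> z' = c \<alpha> * (of_real r ^ deg n \<alpha> * mon n \<alpha> z')"
        by (simp only: mult.assoc[symmetric])
    qed
  qed
  then show ?thesis by blast
qed

section \<open>Radial limits of functions in the Hardy space\<close>

text \<open>A fixed sequence of radii that tends to \<open>1\<close>, for arguments about measurability and dominated
  convergence, which need sequences.\<close>

definition radius :: "nat \<Rightarrow> real"
  where "radius j = 1 - 1 / (real j + 2)"

lemma radius_bounds: "0 < radius j" "0 \<le> radius j" "radius j < 1"
  by (auto simp: radius_def field_simps)

lemma radius_tendsto: "radius \<longlonglongrightarrow> 1"
  unfolding radius_def by real_asymp

lemma radius_at_left: "filterlim radius (at_left 1) sequentially"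
  unfolding filterlim_at using radius_tendsto radius_bounds(3) by (auto intro!: always_eventually simp: less_imp_neq)

text \<open>Both sides are limits of the corresponding expressions for partial sums, which converge uniformly
  on the torus of radius \<open>r\<close>.\<close>

lemma Parseval_radius:
  assumes psf: "\<And>z. z \<in> polydisc n \<Longrightarrow> ((\<lambda>\<alpha>. c \<alpha> * mon n \<alpha> z) has_sum f z) (multiindices n)"
    and psg: "\<And>z. z \<in> polydisc n \<Longrightarrow> ((\<lambda>\<alpha>. d \<alpha> * mon n \<alpha> z) has_sum g z) (multiindices n)"
    and r: "0 \<le> r" "r < 1"
  shows "((\<lambda>\<alpha>. c \<alpha> * cnj (d \<alpha>) * of_real (r ^ (2 * deg n \<alpha>))) has_sum
    (LINT \<zeta>|torus n. f (dil n (of_real r) \<zeta>) * cnj (g (dil n (of_real r) \<zeta>)))) (multiindices n)"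
proof -
  let ?F = "finite_subsets_at_top (multiindices n)"
  let ?s = "\<lambda>c A \<zeta>. \<Sum>\<alpha>\<in>A. c \<alpha> * mon n \<alpha> (dil n (of_real r) \<zeta>)"
  have X: "\<exists>\<zeta>' w. dil n (complex_of_real r) \<zeta> = dil n w \<zeta>' \<and> cmod w \<le> r \<and> \<zeta>' \<in> closed_polydisc n"
    if "\<zeta> \<in> space (torus n)" for \<zeta>
    using that r torus_subset_closed_polydisc by (intro exI[of _ \<zeta>] exI[of _ "of_real r"]) auto
  have uf: "uniform_limit (space (torus n)) (?s c) (\<lambda>\<zeta>. f (dil n (of_real r) \<zeta>)) ?F"
    by (rule power_series_uniform[OF psf r X])
  have ug: "uniform_limit (space (torus n)) (?s d) (\<lambda>\<zeta>. g (dil n (of_real r) \<zeta>)) ?F"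
    by (rule power_series_uniform[OF psg r X])
  have cs: "continuous_on (space (torus n)) (?s c A)" for c A
    by (intro continuous_intros)
  have fc: "continuous_on (space (torus n)) (\<lambda>\<zeta>. f (dil n (of_real r) \<zeta>))"
    by (rule uniform_limit_theorem[OF _ uf]) (use cs in auto)
  have gc: "continuous_on (space (torus n)) (\<lambda>\<zeta>. g (dil n (of_real r) \<zeta>))"
    by (rule uniform_limit_theorem[OF _ ug]) (use cs in auto)
  have "uniform_limit (space (torus n)) (\<lambda>A \<zeta>. cnj (?s d A \<zeta>)) (\<lambda>\<zeta>. cnj (g (dil n (of_real r) \<zeta>))) ?F"
    using ug unfolding uniform_limit_iff dist_norm complex_cnj_diff[symmetric] complex_mod_cnj .
  then have "uniform_limit (space (torus n)) (\<lambda>A \<zeta>. ?s c A \<zeta> * cnj (?s d A \<zeta>))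
    (\<lambda>\<zeta>. f (dil n (of_real r) \<zeta>) * cnj (g (dil n (of_real r) \<zeta>))) ?F"
    by (intro uniform_lim_mult uf continuous_torus_bounded fc gc continuous_on_cnj)
  then have "((\<lambda>A. LINT \<zeta>|torus n. ?s c A \<zeta> * cnj (?s d A \<zeta>)) \<longlongrightarrow>
     (LINT \<zeta>|torus n. f (dil n (of_real r) \<zeta>) * cnj (g (dil n (of_real r) \<zeta>)))) ?F"
    by (rule torus_uniform_limit_integral[rotated]) (auto intro!: continuous_intros)
  moreover have "\<forall>\<^sub>F A in ?F. (LINT \<zeta>|torus n. ?s c A \<zeta> * cnj (?s d A \<zeta>)) =
     (\<Sum>\<alpha>\<in>A. c \<alpha> * cnj (d \<alpha>) * of_real (r ^ (2 * deg n \<alpha>)))"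
  proof -
    have "\<forall>\<^sub>F A in ?F. finite A \<and> A \<subseteq> multiindices n"
      by (rule eventually_finite_subsets_at_top_weakI) auto
    then show ?thesis
    proof eventually_elim
      case (elim A)
      let ?R = "\<lambda>\<alpha>. of_real r ^ deg n \<alpha> :: complex"
      have "(LINT \<zeta>|torus n. ?s c A \<zeta> * cnj (?s d A \<zeta>)) =
        (LINT \<zeta>|torus n. (\<Sum>\<alpha>\<in>A. \<Sum>\<beta>\<in>A. (c \<alpha> * ?R \<alpha> * cnj (d \<beta>) * ?R \<beta>) * (mon n \<alpha> \<zeta> * cnj (mon n \<beta> \<zeta>))))"
        unfolding mon_dil cnj_sum sum_product
        by (simp add: mult_ac del: cnj_prod)
      also have "\<dots> = (\<Sum>\<alpha>\<in>A. \<Sum>\<beta>\<in>A. (c \<alpha> * ?R \<alpha> * cnj (d \<beta>) * ?R \<beta>) * (LINT \<zeta>|torus n. mon n \<alpha> \<zeta> * cnj (mon n \<beta> \<zeta>)))"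
        by (simp add: Bochner_Integration.integral_sum integrable_torus_continuous continuous_intros del: cnj_prod)
      also have "\<dots> = (\<Sum>\<alpha>\<in>A. \<Sum>\<beta>\<in>A. if \<alpha> = \<beta> then c \<alpha> * ?R \<alpha> * cnj (d \<alpha>) * ?R \<alpha> else 0)"
        using elim by (intro sum.cong refl) (auto simp: integral_torus_monomials subset_iff simp del: cnj_prod)
      also have "\<dots> = (\<Sum>\<alpha>\<in>A. c \<alpha> * cnj (d \<alpha>) * of_real (r ^ (2 * deg n \<alpha>)))"
        using elim by (simp add: mult_2 power_add mult_ac)
      finally show ?case .
    qed
  qed
  ultimately show ?thesis
    unfolding has_sum_def by (rule Lim_transform_eventually)
qed

lemma Parseval_radius_norm:
  assumes ps: "\<And>z. z \<in> polydisc n \<Longrightarrow> ((\<lambda>\<alpha>. c \<alpha> * mon n \<alpha> z) has_sum f z) (multiindices n)"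
    and r: "0 \<le> r" "r < 1"
  shows "((\<lambda>\<alpha>. (cmod (c \<alpha>))\<^sup>2 * r ^ (2 * deg n \<alpha>)) has_sum
    (LINT \<zeta>|torus n. (cmod (f (dil n (of_real r) \<zeta>)))\<^sup>2)) (multiindices n)"
proof -
  have "((\<lambda>\<alpha>. complex_of_real ((cmod (c \<alpha>))\<^sup>2 * r ^ (2 * deg n \<alpha>))) has_sum
    of_real (LINT \<zeta>|torus n. (cmod (f (dil n (of_real r) \<zeta>)))\<^sup>2)) (multiindices n)"
    using Parseval_radius[OF ps ps r] by (simp only: complex_norm_square[symmetric] of_real_mult integral_complex_of_real)
  from has_sum_Re[OF this] show ?thesis by simp
qed

lemma continuous_dil_power_series:
  assumes ps: "\<And>z. z \<in> polydisc n \<Longrightarrow> ((\<lambda>\<alpha>. c \<alpha> * mon n \<alpha> z) has_sum f z) (multiindices n)"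
    and X: "continuous_on X w" "continuous_on X g" and r: "0 \<le> r" "r < 1"
    and Y: "\<And>x. x \<in> X \<Longrightarrow> cmod (w x) \<le> r" "\<And>x. x \<in> X \<Longrightarrow> g x \<in> closed_polydisc n"
  shows "continuous_on X (\<lambda>x. f (dil n (w x) (g x)))"
proof (rule uniform_limit_theorem)
  show "uniform_limit X (\<lambda>A x. \<Sum>\<alpha>\<in>A. c \<alpha> * mon n \<alpha> (dil n (w x) (g x))) (\<lambda>x. f (dil n (w x) (g x))) (finite_subsets_at_top (multiindices n))"
    by (rule power_series_uniform[OF ps r]) (use Y in blast)+
  show "\<forall>\<^sub>F A in finite_subsets_at_top (multiindices n). continuous_on X (\<lambda>x. \<Sum>\<alpha>\<in>A. c \<alpha> * mon n \<alpha> (dil n (w x) (g x)))"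
    by (intro always_eventually allI continuous_on_sum continuous_on_mult continuous_on_const continuous_on_mon continuous_on_dil X)
qed simp

text \<open>Along a complex line through the origin a power series is a uniform limit of polynomials in one
  variable.\<close>

lemma slice_holomorphic:
  assumes ps: "\<And>z. z \<in> polydisc n \<Longrightarrow> ((\<lambda>\<alpha>. c \<alpha> * mon n \<alpha> z) has_sum f z) (multiindices n)"
    and r: "0 \<le> r" "r < 1" and \<zeta>: "\<zeta> \<in> closed_polydisc n"
  shows "continuous_on (cball 0 1) (\<lambda>w. f (dil n (of_real r * w) \<zeta>))" "(\<lambda>w. f (dil n (of_real r * w) \<zeta>)) holomorphic_on ball 0 1"
proof -
  have u: "uniform_limit (cball 0 1) (\<lambda>A w. \<Sum>\<alpha>\<in>A. c \<alpha> * mon n \<alpha> (dil n (of_real r * w) \<zeta>)) (\<lambda>w. f (dil n (of_real r * w) \<zeta>)) (finite_subsets_at_top (multiindices n))"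
  proof (rule power_series_uniform[OF ps r])
    fix w :: complex assume "w \<in> cball 0 1"
    then have "cmod (of_real r * w) \<le> r" using r by (simp add: norm_mult mult_left_le)
    then show "\<exists>\<zeta>' v. dil n (of_real r * w) \<zeta> = dil n v \<zeta>' \<and> cmod v \<le> r \<and> \<zeta>' \<in> closed_polydisc n"
      using \<zeta> by blast
  qed
  have e: "\<forall>\<^sub>F A in finite_subsets_at_top (multiindices n).
     continuous_on (cball 0 1) (\<lambda>w. \<Sum>\<alpha>\<in>A. c \<alpha> * mon n \<alpha> (dil n (of_real r * w) \<zeta>)) \<and>
     (\<lambda>w. \<Sum>\<alpha>\<in>A. c \<alpha> * mon n \<alpha> (dil n (of_real r * w) \<zeta>)) holomorphic_on ball 0 1"
    unfolding mon_dil by (intro always_eventually allI conjI continuous_intros holomorphic_intros)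
  from holomorphic_uniform_limit[OF e u]
  show "continuous_on (cball 0 1) (\<lambda>w. f (dil n (of_real r * w) \<zeta>))" "(\<lambda>w. f (dil n (of_real r * w) \<zeta>)) holomorphic_on ball 0 1"
    by auto
qed

text \<open>The square of the radial maximal function. By continuity the rational radii suffice, and they make
  it a countable supremum. Squaring inside lets its integral be compared with squared norms.\<close>

definition radial_sup :: "nat \<Rightarrow> ((nat \<Rightarrow> complex) \<Rightarrow> complex) \<Rightarrow> (nat \<Rightarrow> complex) \<Rightarrow> ennreal"
  where "radial_sup n f \<zeta> = (SUP r\<in>{0..<1} \<inter> \<rat>. ennreal ((cmod (f (dil n (of_real r) \<zeta>)))\<^sup>2))"

lemma borel_measurable_dil:
  assumes ps: "\<And>z. z \<in> polydisc n \<Longrightarrow> ((\<lambda>\<alpha>. c \<alpha> * mon n \<alpha> z) has_sum f z) (multiindices n)"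
    and r: "0 \<le> r" "r < 1"
  shows "(\<lambda>\<zeta>. f (dil n (of_real r) \<zeta>)) \<in> borel_measurable (torus n)"
  by (intro borel_measurable_torus_continuous continuous_dil_power_series[OF ps _ _ r])
    (use r torus_subset_closed_polydisc in auto)

lemma continuous_radial:
  assumes ps: "\<And>z. z \<in> polydisc n \<Longrightarrow> ((\<lambda>\<alpha>. c \<alpha> * mon n \<alpha> z) has_sum f z) (multiindices n)"
    and \<zeta>: "\<zeta> \<in> space (torus n)"
  shows "continuous_on {0..<1} (\<lambda>r::real. f (dil n (of_real r) \<zeta>))"
proof (rule continuous_on_subset)
  show "continuous_on (\<Union>s\<in>{0..<1}. {- s<..<s}) (\<lambda>r::real. f (dil n (of_real r) \<zeta>))"
  proof (rule continuous_on_open_UN)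
    fix s :: real assume "s \<in> {0..<1}"
    then show "continuous_on {- s<..<s} (\<lambda>r::real. f (dil n (of_real r) \<zeta>))"
      by (intro continuous_dil_power_series[OF ps, where r=s])
        (use \<zeta> torus_subset_closed_polydisc in \<open>auto intro!: continuous_on_of_real continuous_on_id\<close>)
  qed auto
  show "{0..<1} \<subseteq> (\<Union>s\<in>{0..<1}. {- s<..<s::real})"
  proof
    fix x :: real assume "x \<in> {0..<1}"
    then show "x \<in> (\<Union>s\<in>{0..<1}. {- s<..<s})"
      by (intro UN_I[of "(1 + x) / 2"]) (auto simp: field_simps)
  qed
qed

lemma radial_sup_measurable:
  assumes ps: "\<And>z. z \<in> polydisc n \<Longrightarrow> ((\<lambda>\<alpha>. c \<alpha> * mon n \<alpha> z) has_sum f z) (multiindices n)"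
  shows "radial_sup n f \<in> borel_measurable (torus n)"
  unfolding radial_sup_def
proof (rule borel_measurable_SUP)
  show "countable ({0..<1} \<inter> \<rat> :: real set)" by (intro countable_Int2 countable_rat)
  fix r :: real assume "r \<in> {0..<1} \<inter> \<rat>"
  then have [measurable]: "(\<lambda>\<zeta>. f (dil n (of_real r) \<zeta>)) \<in> borel_measurable (torus n)"
    by (intro borel_measurable_dil[OF ps]) auto
  show "(\<lambda>\<zeta>. ennreal ((cmod (f (dil n (of_real r) \<zeta>)))\<^sup>2)) \<in> borel_measurable (torus n)"
    by measurable
qed

lemma radial_sup_ge:
  assumes ps: "\<And>z. z \<in> polydisc n \<Longrightarrow> ((\<lambda>\<alpha>. c \<alpha> * mon n \<alpha> z) has_sum f z) (multiindices n)"
    and \<zeta>: "\<zeta> \<in> space (torus n)" and r: "0 \<le> r" "r < 1"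
  shows "ennreal ((cmod (f (dil n (of_real r) \<zeta>)))\<^sup>2) \<le> radial_sup n f \<zeta>"
proof -
  have "\<exists>q\<in>\<rat>. r < q \<and> q < r + (1 - r) / (real k + 1)" for k
    using r by (intro Rats_dense_in_real) simp
  then obtain q where q: "\<And>k. q k \<in> \<rat>" "\<And>k. r < q k" "\<And>k. q k < r + (1 - r) / (real k + 1)"
    by metis
  have q1: "q k < 1" for k
  proof -
    have "(1 - r) / (real k + 1) \<le> (1 - r) / 1" using r by (intro divide_left_mono) auto
    then show ?thesis using q(3)[of k] by simp
  qed
  have "q \<longlonglongrightarrow> r"
  proof (rule tendsto_sandwich)
    show "(\<lambda>k. r) \<longlonglongrightarrow> r" by simp
    show "(\<lambda>k. r + (1 - r) / (real k + 1)) \<longlonglongrightarrow> r" by real_asymp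
  qed (use q(2,3) in \<open>auto intro!: always_eventually less_imp_le\<close>)
  then have "(\<lambda>k. f (dil n (of_real (q k)) \<zeta>)) \<longlonglongrightarrow> f (dil n (of_real r) \<zeta>)"
    using continuous_on_tendsto_compose[OF continuous_radial[OF ps \<zeta>], of q r sequentially]
      r q1 less_imp_le[OF le_less_trans[OF r(1) q(2)]] by (auto intro!: always_eventually)
  then have "(\<lambda>k. ennreal ((cmod (f (dil n (of_real (q k)) \<zeta>)))\<^sup>2)) \<longlonglongrightarrow> ennreal ((cmod (f (dil n (of_real r) \<zeta>)))\<^sup>2)"
    by (intro tendsto_ennrealI tendsto_intros)
  then show ?thesis
  proof (rule LIMSEQ_le_const2, intro exI allI impI)
    fix k
    show "ennreal ((cmod (f (dil n (of_real (q k)) \<zeta>)))\<^sup>2) \<le> radial_sup n f \<zeta>"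
      unfolding radial_sup_def by (rule SUP_upper) (use q(1)[of k] q1[of k] less_imp_le[OF le_less_trans[OF r(1) q(2)[of k]]] in auto)
  qed
qed

lemma nn_integral_dil_le:
  assumes ps: "\<And>z. z \<in> polydisc n \<Longrightarrow> ((\<lambda>\<alpha>. c \<alpha> * mon n \<alpha> z) has_sum f z) (multiindices n)"
    and sq: "(\<lambda>\<alpha>. (cmod (c \<alpha>))\<^sup>2) summable_on multiindices n" and r: "0 \<le> r" "r < 1"
  shows "(\<integral>\<^sup>+\<zeta>. ennreal ((cmod (f (dil n (of_real r) \<zeta>)))\<^sup>2) \<partial>torus n) \<le> ennreal (\<Sum>\<^sub>\<infinity>\<alpha>\<in>multiindices n. (cmod (c \<alpha>))\<^sup>2)"
proof -
  have "continuous_on (space (torus n)) (\<lambda>\<zeta>. (cmod (f (dil n (of_real r) \<zeta>)))\<^sup>2)"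
    by (intro continuous_intros continuous_dil_power_series[OF ps _ _ r]) (use r torus_subset_closed_polydisc in auto)
  then have "(\<integral>\<^sup>+\<zeta>. ennreal ((cmod (f (dil n (of_real r) \<zeta>)))\<^sup>2) \<partial>torus n) = ennreal (LINT \<zeta>|torus n. (cmod (f (dil n (of_real r) \<zeta>)))\<^sup>2)"
    by (intro nn_integral_eq_integral integrable_torus_continuous) auto
  also have "\<dots> \<le> ennreal (\<Sum>\<^sub>\<infinity>\<alpha>\<in>multiindices n. (cmod (c \<alpha>))\<^sup>2)"
    by (intro ennreal_leI has_sum_mono[OF Parseval_radius_norm[OF ps r] has_sum_infsum[OF sq]] mult_left_le power_le_one)
      (use r in auto)
  finally show ?thesis .
qed

text \<open>For finitely many radii, \<open>cmod f\<close> is bounded by Poisson means of its values on a larger torus of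
  radius \<open>\<rho> < 1\<close>, so the radial maximal inequality applies, with a constant that depends neither on
  \<open>\<rho>\<close> nor on the set of radii. Monotone convergence gives all rational radii.\<close>

lemma radial_sup_integral:
  assumes ps: "\<And>z. z \<in> polydisc n \<Longrightarrow> ((\<lambda>\<alpha>. c \<alpha> * mon n \<alpha> z) has_sum f z) (multiindices n)"
    and sq: "(\<lambda>\<alpha>. (cmod (c \<alpha>))\<^sup>2) summable_on multiindices n"
  shows "(\<integral>\<^sup>+\<zeta>. radial_sup n f \<zeta> \<partial>torus n) \<le> 257 * ennreal (\<Sum>\<^sub>\<infinity>\<alpha>\<in>multiindices n. (cmod (c \<alpha>))\<^sup>2)"
proof -
  let ?N = "ennreal (\<Sum>\<^sub>\<infinity>\<alpha>\<in>multiindices n. (cmod (c \<alpha>))\<^sup>2)"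
  let ?h = "\<lambda>r \<zeta>. ennreal ((cmod (f (dil n (of_real r) \<zeta>)))\<^sup>2)"
  define S where "S = {0..<1} \<inter> (\<rat> :: real set)"
  have "countable S" unfolding S_def by (intro countable_Int2 countable_rat)
  moreover have "0 \<in> S" by (simp add: S_def)
  ultimately have rq: "range (from_nat_into S) = S" by (intro range_from_nat_into) auto
  define q where "q = from_nat_into S"
  have "q i \<in> S" for i using from_nat_into[of S i] \<open>0 \<in> S\<close> unfolding q_def by blast
  then have q: "0 \<le> q i" "q i < 1" for i by (auto simp: S_def)
  define u where "u k \<zeta> = (SUP i\<in>{..k}. ?h (q i) \<zeta>)" for k :: nat and \<zeta>
  have um [measurable]: "u k \<in> borel_measurable (torus n)" for k
    unfolding u_def
  proof (rule borel_measurable_SUP)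
    fix i
    have [measurable]: "(\<lambda>\<zeta>. f (dil n (of_real (q i)) \<zeta>)) \<in> borel_measurable (torus n)"
      by (intro borel_measurable_dil[OF ps] q)
    show "?h (q i) \<in> borel_measurable (torus n)" by measurable
  qed auto
  have sup: "radial_sup n f \<zeta> = (SUP k. u k \<zeta>)" for \<zeta>
  proof -
    have "radial_sup n f \<zeta> = (SUP r\<in>range q. ?h r \<zeta>)"
      unfolding radial_sup_def q_def rq unfolding S_def by (rule refl)
    also have "\<dots> = (SUP i. ?h (q i) \<zeta>)" by (simp add: image_image)
    also have "\<dots> = (SUP k. u k \<zeta>)"
      unfolding u_def by (intro antisym SUP_least) (auto intro: SUP_upper2)
    finally show ?thesis .
  qed
  have "(\<integral>\<^sup>+\<zeta>. radial_sup n f \<zeta> \<partial>torus n) = (SUP k. \<integral>\<^sup>+\<zeta>. u k \<zeta> \<partial>torus n)"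
    unfolding sup by (intro nn_integral_monotone_convergence_SUP um)
      (auto simp: incseq_def le_fun_def u_def intro!: SUP_subset_mono)
  also have "\<dots> \<le> 257 * ?N"
  proof (rule SUP_least)
    fix k
    define R where "R = q ` {..k}"
    have R: "finite R" "R \<noteq> {}" "R \<subseteq> {0..<1}" using q by (auto simp: R_def)
    \<comment> \<open>A torus that lies outside all radii in \<open>R\<close> and inside the domain of \<open>f\<close>.\<close>
    define \<rho> where "\<rho> = (1 + Max R) / 2"
    have "Max R \<in> R" using R by (intro Max_in) auto
    then have "Max R \<in> {0..<1}" using R(3) by blast
    then have mr: "0 \<le> Max R" "Max R < 1" by auto
    then have \<rho>: "0 < \<rho>" "0 \<le> \<rho>" "\<rho> < 1" by (auto simp: \<rho>_def)
    have lt: "s < \<rho>" if "s \<in> R" for s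
      using Max_ge[OF R(1) that] mr by (auto simp: \<rho>_def)
    define R' where "R' = (\<lambda>s. s / \<rho>) ` R"
    have R': "finite R'" "R' \<noteq> {}" "R' \<subseteq> {0..<1}" using R lt \<rho> by (auto simp: R'_def)
    define G where "G \<zeta> = ennreal (cmod (f (dil n (of_real \<rho>) \<zeta>)))" for \<zeta>
    have [measurable]: "(\<lambda>\<zeta>. f (dil n (of_real \<rho>) \<zeta>)) \<in> borel_measurable (torus n)"
      by (intro borel_measurable_dil[OF ps] \<rho>)
    have G [measurable]: "G \<in> borel_measurable (torus n)" unfolding G_def by measurable
    have pm: "ennreal (cmod (f (dil n (of_real s) \<zeta>))) \<le> poisson_mean n G (s / \<rho>) \<zeta>"
      if s: "s \<in> R" and \<zeta>: "\<zeta> \<in> space (torus n)" for s \<zeta>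
    proof -
      define F where "F w = f (dil n (of_real \<rho> * w) \<zeta>)" for w
      have F: "continuous_on (cball 0 1) F" "F holomorphic_on ball 0 1"
        unfolding F_def using slice_holomorphic[OF ps \<rho>(2,3)] \<zeta> torus_subset_closed_polydisc by blast+
      have s1: "0 \<le> s / \<rho>" "s / \<rho> < 1" using R s lt[OF s] \<rho> by auto
      have "f (dil n (of_real s) \<zeta>) = F (of_real (s / \<rho>))" using \<rho> by (simp add: F_def)
      also have "\<dots> = (LINT w|circle. of_real (poisson (of_real (s / \<rho>) * w)) * F w)"
        by (rule poisson_integral[OF F s1, symmetric])
      finally have "ennreal (cmod (f (dil n (of_real s) \<zeta>))) = ennreal (cmod (LINT w|circle. of_real (poisson (of_real (s / \<rho>) * w)) * F w))"
        by simp
      also have "\<dots> \<le> (\<integral>\<^sup>+w. ennreal (cmod (of_real (poisson (of_real (s / \<rho>) * w)) * F w)) \<partial>circle)"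
        by (intro integral_norm_bound_ennreal integrable_circle_continuous continuous_intros continuous_on_poisson continuous_on_subset[OF F(1)])
          (use s1 in \<open>auto simp del: of_real_divide\<close>)
      also have "\<dots> = poisson_mean n G (s / \<rho>) \<zeta>"
        unfolding poisson_mean_def
      proof (rule nn_integral_cong)
        fix w assume "w \<in> space circle"
        then have w: "cmod w = 1" by simp
        have "poisson (of_real (s / \<rho>) * w) \<ge> 0"
          using s1 w by (intro poisson_nonneg) (simp add: norm_mult del: of_real_divide)
        then show "ennreal (cmod (of_real (poisson (of_real (s / \<rho>) * w)) * F w)) =
          ennreal (poisson (of_real (s / \<rho>) * w)) * G (dil n w \<zeta>)"
          by (simp add: norm_mult G_def F_def ennreal_mult' del: of_real_divide)
      qed
      finally show ?thesis .
    qed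
    have "u k \<zeta> \<le> (MAX s\<in>R'. poisson_mean n G s \<zeta>)\<^sup>2" if \<zeta>: "\<zeta> \<in> space (torus n)" for \<zeta>
      unfolding u_def
    proof (rule SUP_least)
      fix i assume "i \<in> {..k}"
      then have i: "q i \<in> R" by (auto simp: R_def)
      have "ennreal (cmod (f (dil n (of_real (q i)) \<zeta>))) \<le> (MAX s\<in>R'. poisson_mean n G s \<zeta>)"
        by (rule order_trans[OF pm[OF i \<zeta>] Max_ge]) (use R'(1) i in \<open>auto simp: R'_def\<close>)
      from power_mono[OF this, of 2] show "?h (q i) \<zeta> \<le> (MAX s\<in>R'. poisson_mean n G s \<zeta>)\<^sup>2"
        by (simp add: ennreal_power)
    qed
    then have "(\<integral>\<^sup>+\<zeta>. u k \<zeta> \<partial>torus n) \<le> (\<integral>\<^sup>+\<zeta>. (MAX s\<in>R'. poisson_mean n G s \<zeta>)\<^sup>2 \<partial>torus n)"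
      by (rule nn_integral_mono)
    also have "\<dots> \<le> 257 * (\<integral>\<^sup>+\<zeta>. (G \<zeta>)\<^sup>2 \<partial>torus n)"
      by (rule radial_maximal_inequality[OF R' G])
    also have "(\<integral>\<^sup>+\<zeta>. (G \<zeta>)\<^sup>2 \<partial>torus n) \<le> ?N"
      using nn_integral_dil_le[OF ps sq \<rho>(2,3)] by (simp add: G_def ennreal_power)
    finally show "(\<integral>\<^sup>+\<zeta>. u k \<zeta> \<partial>torus n) \<le> 257 * ?N" by (simp add: mult_left_mono)
  qed
  finally show ?thesis .
qed

text \<open>Fatou's theorem. Partial sums of the power series are continuous up to the torus. The maximal
  functions of the remainders have integrals that tend to \<open>0\<close>, so that at almost every point some
  remainder is uniformly small along the whole radius; there the function is Cauchy as \<open>r\<close> tends to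
  \<open>1\<close>.\<close>

lemma radial_limit_exists:
  assumes ps: "\<And>z. z \<in> polydisc n \<Longrightarrow> ((\<lambda>\<alpha>. c \<alpha> * mon n \<alpha> z) has_sum f z) (multiindices n)"
    and sq: "(\<lambda>\<alpha>. (cmod (c \<alpha>))\<^sup>2) summable_on multiindices n"
  shows "AE \<zeta> in torus n. \<exists>l. ((\<lambda>r::real. f (dil n (of_real r) \<zeta>)) \<longlongrightarrow> l) (at_left 1)"
proof -
  let ?T = "\<Sum>\<^sub>\<infinity>\<alpha>\<in>multiindices n. (cmod (c \<alpha>))\<^sup>2"
  have "\<exists>A. finite A \<and> A \<subseteq> multiindices n \<and> ?T - (\<Sum>\<alpha>\<in>A. (cmod (c \<alpha>))\<^sup>2) < 1 / real (Suc k)" for k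
  proof -
    have "\<forall>\<^sub>F A in finite_subsets_at_top (multiindices n). dist (\<Sum>\<alpha>\<in>A. (cmod (c \<alpha>))\<^sup>2) ?T < 1 / real (Suc k)"
      using has_sum_infsum[OF sq] unfolding has_sum_def tendsto_iff by simp
    moreover have "\<forall>\<^sub>F A in finite_subsets_at_top (multiindices n). finite A \<and> A \<subseteq> multiindices n"
      by (rule eventually_finite_subsets_at_top_weakI) auto
    ultimately have "\<forall>\<^sub>F A in finite_subsets_at_top (multiindices n). finite A \<and> A \<subseteq> multiindices n \<and> ?T - (\<Sum>\<alpha>\<in>A. (cmod (c \<alpha>))\<^sup>2) < 1 / real (Suc k)"
      by eventually_elim (auto simp: dist_real_def)
    then show ?thesis by (rule eventually_happens'[rotated]) simp
  qed
  then obtain A where A: "\<And>k. finite (A k)" "\<And>k. A k \<subseteq> multiindices n"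
    "\<And>k. ?T - (\<Sum>\<alpha>\<in>A k. (cmod (c \<alpha>))\<^sup>2) < 1 / real (Suc k)" by metis
  \<comment> \<open>Partial sums \<open>p k\<close>, remainders \<open>g k\<close> and their coefficients \<open>d k\<close>.\<close>
  define p where "p k z = (\<Sum>\<alpha>\<in>A k. c \<alpha> * mon n \<alpha> z)" for k z
  define g where "g k z = f z - p k z" for k z
  define d where "d k \<alpha> = (if \<alpha> \<in> A k then 0 else c \<alpha>)" for k \<alpha>
  have psg: "((\<lambda>\<alpha>. d k \<alpha> * mon n \<alpha> z) has_sum g k z) (multiindices n)" if "z \<in> polydisc n" for z k
  proof -
    have "((\<lambda>\<alpha>. c \<alpha> * mon n \<alpha> z) has_sum p k z) (A k)"
      unfolding p_def by (rule has_sum_finite) (rule A)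
    from has_sum_Diff[OF ps[OF that] this A(2)]
    have "((\<lambda>\<alpha>. c \<alpha> * mon n \<alpha> z) has_sum g k z) (multiindices n - A k)" by (simp add: g_def)
    then show ?thesis
      by (rule has_sum_cong_neutral[THEN iffD1, rotated -1]) (auto simp: d_def)
  qed
  have hd: "((\<lambda>\<alpha>. (cmod (d k \<alpha>))\<^sup>2) has_sum (?T - (\<Sum>\<alpha>\<in>A k. (cmod (c \<alpha>))\<^sup>2))) (multiindices n)" for k
  proof -
    have "((\<lambda>\<alpha>. (cmod (c \<alpha>))\<^sup>2) has_sum (\<Sum>\<alpha>\<in>A k. (cmod (c \<alpha>))\<^sup>2)) (A k)"
      by (rule has_sum_finite) (rule A)
    from has_sum_Diff[OF has_sum_infsum[OF sq] this A(2)]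
    show ?thesis by (rule has_sum_cong_neutral[THEN iffD1, rotated -1]) (auto simp: d_def)
  qed
  have [measurable]: "radial_sup n (g k) \<in> borel_measurable (torus n)" for k
    by (rule radial_sup_measurable[OF psg])
  have int: "(\<integral>\<^sup>+\<zeta>. (INF k. radial_sup n (g k) \<zeta>) \<partial>torus n) \<le> ennreal (257 * (1 / real (Suc k)))" for k
  proof -
    have "(\<integral>\<^sup>+\<zeta>. (INF k. radial_sup n (g k) \<zeta>) \<partial>torus n) \<le> (\<integral>\<^sup>+\<zeta>. radial_sup n (g k) \<zeta> \<partial>torus n)"
      by (intro nn_integral_mono INF_lower) auto
    also have "\<dots> \<le> 257 * ennreal (\<Sum>\<^sub>\<infinity>\<alpha>\<in>multiindices n. (cmod (d k \<alpha>))\<^sup>2)"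
      by (rule radial_sup_integral[OF psg has_sum_imp_summable[OF hd]])
    also have "\<dots> \<le> 257 * ennreal (1 / real (Suc k))"
      using A(3)[of k] by (intro mult_left_mono ennreal_leI) (auto simp: infsumI[OF hd])
    also have "\<dots> = ennreal (257 * (1 / real (Suc k)))" by (subst ennreal_mult') auto
    finally show ?thesis .
  qed
  have "(\<integral>\<^sup>+\<zeta>. (INF k. radial_sup n (g k) \<zeta>) \<partial>torus n) \<le> ennreal 0"
  proof (rule LIMSEQ_le_const)
    show "(\<lambda>k. ennreal (257 * (1 / real (Suc k)))) \<longlonglongrightarrow> ennreal 0"
      by (intro tendsto_ennrealI) real_asymp
  qed (use int in auto)
  then have "AE \<zeta> in torus n. (INF k. radial_sup n (g k) \<zeta>) = 0"
    by (subst nn_integral_0_iff_AE[symmetric]) auto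
  with AE_space show ?thesis
  proof eventually_elim
    case (elim \<zeta>)
    note \<zeta> = elim(1)
    let ?f = "\<lambda>r::real. f (dil n (of_real r) \<zeta>)"
    have near: "\<exists>k. \<forall>r. 0 \<le> r \<longrightarrow> r < 1 \<longrightarrow> cmod (?f r - p k (dil n (of_real r) \<zeta>)) < e" if e: "e > 0" for e :: real
    proof -
      have "(INF k. radial_sup n (g k) \<zeta>) < ennreal (e\<^sup>2)" using elim(2) e by simp
      then obtain k where k: "radial_sup n (g k) \<zeta> < ennreal (e\<^sup>2)" unfolding INF_less_iff by blast
      have "cmod (?f r - p k (dil n (of_real r) \<zeta>)) < e" if r: "0 \<le> r" "r < 1" for r
      proof -
        have "ennreal ((cmod (g k (dil n (of_real r) \<zeta>)))\<^sup>2) < ennreal (e\<^sup>2)"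
          using radial_sup_ge[OF psg \<zeta> r] k by (rule le_less_trans)
        then have "(cmod (g k (dil n (of_real r) \<zeta>)))\<^sup>2 < e\<^sup>2" by (simp add: ennreal_less_iff)
        then show ?thesis using e by (auto simp: g_def intro: power_less_imp_less_base)
      qed
      then show ?thesis by blast
    qed
    have "cauchy_filter (filtermap ?f (at_left 1))"
      unfolding cauchy_filter_metric_filtermap
    proof (intro allI impI)
      fix e :: real assume "e > 0"
      then have e3: "e / 3 > 0" by simp
      from near[OF e3] obtain k where k: "\<And>r. 0 \<le> r \<Longrightarrow> r < 1 \<Longrightarrow> cmod (?f r - p k (dil n (of_real r) \<zeta>)) < e / 3" by blast
      have "continuous_on UNIV (\<lambda>r::real. p k (dil n (of_real r) \<zeta>))"
        unfolding p_def mon_dil by (intro continuous_intros)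
      then have "((\<lambda>r::real. p k (dil n (of_real r) \<zeta>)) \<longlongrightarrow> p k (dil n (of_real 1) \<zeta>)) (at_left 1)"
        by (metis UNIV_I continuous_on_def tendsto_within_subset subset_UNIV)
      then have "\<forall>\<^sub>F r in at_left 1. dist (p k (dil n (of_real r) \<zeta>)) (p k (dil n (of_real 1) \<zeta>)) < e / 6"
        using \<open>e > 0\<close> by (intro tendstoD) auto
      moreover have "\<forall>\<^sub>F r in at_left (1::real). 0 \<le> r \<and> r < 1"
        using eventually_at_left_real[of 0 "1::real"] by (auto elim: eventually_mono)
      ultimately have ev: "\<forall>\<^sub>F r in at_left 1. (0 \<le> r \<and> r < 1) \<and> dist (p k (dil n (of_real r) \<zeta>)) (p k (dil n (of_real 1) \<zeta>)) < e / 6"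
        by eventually_elim auto
      show "\<exists>P. eventually P (at_left 1) \<and> (\<forall>x y. P x \<and> P y \<longrightarrow> dist (?f x) (?f y) < e)"
      proof (intro exI[of _ "\<lambda>r. (0 \<le> r \<and> r < 1) \<and> dist (p k (dil n (of_real r) \<zeta>)) (p k (dil n (of_real 1) \<zeta>)) < e / 6"] conjI ev allI impI)
        fix x y :: real
        let ?p = "\<lambda>r. p k (dil n (complex_of_real r) \<zeta>)"
        assume xy: "((0 \<le> x \<and> x < 1) \<and> dist (?p x) (?p 1) < e / 6) \<and> ((0 \<le> y \<and> y < 1) \<and> dist (?p y) (?p 1) < e / 6)"
        have "dist (?f x) (?f y) \<le> dist (?f x) (?p x) + (dist (?p x) (?p 1) + dist (?p y) (?p 1)) + dist (?f y) (?p y)"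
          using dist_triangle[of "?f x" "?f y" "?p x"] dist_triangle[of "?p x" "?f y" "?p y"] dist_triangle[of "?p x" "?p y" "?p 1"]
          by (simp add: dist_commute)
        also have "\<dots> < e"
          using k[of x] k[of y] xy by (simp add: dist_norm)
        finally show "dist (?f x) (?f y) < e" .
      qed
    qed
    from cauchy_filter_complete_converges[OF this complete_UNIV]
    show ?case by (auto simp: filterlim_def filtermap_bot_iff)
  qed
qed

section \<open>Hardy space functions and their boundary functions\<close>

(* As rules for the measurability prover, these facts lead it to factor arbitrary complex functions
   through the circle or the torus. *)
declare measurable_circle_cnj [measurable del] measurable_circle_borel(1) [measurable del]
  measurable_torus_component [measurable del]

lemma borel_measurable_cnj [measurable]: "cnj \<in> borel_measurable borel"
  by (intro borel_measurable_continuous_onI continuous_intros)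

lemma has_power_series_sum:
  "has_power_series n f c \<Longrightarrow> z \<in> polydisc n \<Longrightarrow> ((\<lambda>\<alpha>. c \<alpha> * mon n \<alpha> z) has_sum f z) (multiindices n)"
  by (simp add: has_power_series_def)

text \<open>Both sequences are given by the same integrals over the torus of radius \<open>1/2\<close>.\<close>

lemma has_power_series_unique:
  assumes c: "has_power_series n f c" and d: "has_power_series n f d"
  shows "c = d"
proof (rule extensionalityI)
  show "c \<in> extensional (multiindices n)" "d \<in> extensional (multiindices n)"
    using c d by (auto simp: has_power_series_def)
  fix \<alpha> assume "\<alpha> \<in> multiindices n"
  from power_series_coeff[OF has_power_series_sum[OF c] _ _ this, of "1/2"]
    power_series_coeff[OF has_power_series_sum[OF d] _ _ this, of "1/2"]
  have "c \<alpha> * of_real (1/2) ^ deg n \<alpha> = d \<alpha> * of_real (1/2) ^ deg n \<alpha>" by simp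
  then show "c \<alpha> = d \<alpha>" by simp
qed

lemma power_coeff_eq: "has_power_series n f c \<Longrightarrow> power_coeff n f = c"
  unfolding power_coeff_def by (rule the_equality) (auto intro: has_power_series_unique)

lemma H2_has_power_series: "f \<in> H2 n \<Longrightarrow> has_power_series n f (power_coeff n f)"
  by (auto simp: H2_def power_coeff_eq)

lemmas H2_sum = has_power_series_sum[OF H2_has_power_series]

lemma H2_summable: "f \<in> H2 n \<Longrightarrow> (\<lambda>\<alpha>. (cmod (power_coeff n f \<alpha>))\<^sup>2) summable_on multiindices n"
  by (auto simp: H2_def power_coeff_eq)

lemma H2_holomorphic: "f \<in> H2 n \<Longrightarrow> holomorphic_polydisc n f"
  by (auto simp: H2_def)

text \<open>By Parseval on the tori of radius \<open>r < 1\<close>, every finite part of the sum of squares is at most \<open>C\<close>.\<close>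

lemma H2I:
  assumes f: "holomorphic_polydisc n f"
    and C: "\<And>r. 0 \<le> r \<Longrightarrow> r < 1 \<Longrightarrow> (LINT \<zeta>|torus n. (cmod (f (dil n (of_real r) \<zeta>)))\<^sup>2) \<le> C"
  shows "f \<in> H2 n"
proof -
  obtain c where c: "has_power_series n f c" using holomorphic_polydisc_has_power_series[OF f] by blast
  have "(\<lambda>\<alpha>. (cmod (c \<alpha>))\<^sup>2) summable_on multiindices n"
  proof (rule nonneg_bdd_above_summable_on)
    show "bdd_above (sum (\<lambda>\<alpha>. (cmod (c \<alpha>))\<^sup>2) ` {A. A \<subseteq> multiindices n \<and> finite A})"
    proof (rule bdd_aboveI2)
      fix A assume A: "A \<in> {A. A \<subseteq> multiindices n \<and> finite A}"
      have "(\<Sum>\<alpha>\<in>A. (cmod (c \<alpha>))\<^sup>2 * radius j ^ (2 * deg n \<alpha>)) \<le> C" for j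
      proof -
        note hs = Parseval_radius_norm[OF has_power_series_sum[OF c] radius_bounds(2,3)]
        have "(\<Sum>\<alpha>\<in>A. (cmod (c \<alpha>))\<^sup>2 * radius j ^ (2 * deg n \<alpha>)) \<le> (LINT \<zeta>|torus n. (cmod (f (dil n (of_real (radius j)) \<zeta>)))\<^sup>2)"
          by (rule finite_sum_le_has_sum[OF hs]) (use A in \<open>auto simp: radius_bounds\<close>)
        also have "\<dots> \<le> C" by (rule C) (auto simp: radius_bounds)
        finally show ?thesis .
      qed
      moreover have "(\<lambda>j. \<Sum>\<alpha>\<in>A. (cmod (c \<alpha>))\<^sup>2 * radius j ^ (2 * deg n \<alpha>)) \<longlonglongrightarrow> (\<Sum>\<alpha>\<in>A. (cmod (c \<alpha>))\<^sup>2 * 1 ^ (2 * deg n \<alpha>))"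
        by (intro tendsto_intros radius_tendsto)
      ultimately show "(\<Sum>\<alpha>\<in>A. (cmod (c \<alpha>))\<^sup>2) \<le> C"
        by (intro LIMSEQ_le_const2) auto
    qed
  qed auto
  then show ?thesis using f c by (auto simp: H2_def)
qed

lemma H2_integral_dil_le:
  assumes f: "f \<in> H2 n" and r: "0 \<le> r" "r < 1"
  shows "(LINT \<zeta>|torus n. (cmod (f (dil n (of_real r) \<zeta>)))\<^sup>2) \<le> (\<Sum>\<^sub>\<infinity>\<alpha>\<in>multiindices n. (cmod (power_coeff n f \<alpha>))\<^sup>2)"
  by (rule has_sum_mono[OF Parseval_radius_norm[OF H2_sum[OF f] r] has_sum_infsum[OF H2_summable[OF f]]])
    (use r in \<open>auto intro!: mult_left_le power_le_one\<close>)

text \<open>A representative of the boundary function that is measurable, because it is defined as a limit of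
  a sequence of continuous functions.\<close>

definition bdry :: "nat \<Rightarrow> ((nat \<Rightarrow> complex) \<Rightarrow> complex) \<Rightarrow> (nat \<Rightarrow> complex) \<Rightarrow> complex"
  where "bdry n f \<zeta> = lim (\<lambda>j. f (dil n (of_real (radius j)) \<zeta>))"

lemma holomorphic_dil_measurable:
  assumes "holomorphic_polydisc n f" "0 \<le> r" "r < 1"
  shows "(\<lambda>\<zeta>. f (dil n (of_real r) \<zeta>)) \<in> borel_measurable (torus n)"
  using assms
  by (intro borel_measurable_torus_continuous continuous_on_subset[OF continuous_on_dil_torus torus_subset_closed_polydisc])
    (auto simp: holomorphic_polydisc_def)

lemma bdry_measurable: "holomorphic_polydisc n f \<Longrightarrow> bdry n f \<in> borel_measurable (torus n)"
  unfolding bdry_def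
  by (intro borel_measurable_lim_metric holomorphic_dil_measurable) (auto simp: radius_bounds)

lemma boundary_fun_eq: "boundary_fun n f \<zeta> = Lim (at_left 1) (\<lambda>r::real. f (dil n (of_real r) \<zeta>))"
  by (simp add: boundary_fun_def dil_def)

lemma bdry_eqI: "(\<lambda>j. f (dil n (of_real (radius j)) \<zeta>)) \<longlonglongrightarrow> l \<Longrightarrow> bdry n f \<zeta> = l"
  unfolding bdry_def by (rule limI)

lemma AE_radial_limit:
  assumes f: "f \<in> H2 n"
  shows "AE \<zeta> in torus n. ((\<lambda>r::real. f (dil n (of_real r) \<zeta>)) \<longlongrightarrow> bdry n f \<zeta>) (at_left 1)"
proof -
  have "AE \<zeta> in torus n. \<exists>l. ((\<lambda>r::real. f (dil n (of_real r) \<zeta>)) \<longlongrightarrow> l) (at_left 1)"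
    by (rule radial_limit_exists[OF H2_sum[OF f] H2_summable[OF f]])
  then show ?thesis
  proof eventually_elim
    case (elim \<zeta>)
    then obtain l where l: "((\<lambda>r::real. f (dil n (of_real r) \<zeta>)) \<longlongrightarrow> l) (at_left 1)" by blast
    then have "bdry n f \<zeta> = l"
      by (intro bdry_eqI) (rule filterlim_compose[OF l radius_at_left])
    with l show ?case by simp
  qed
qed

lemma AE_boundary_fun:
  assumes f: "f \<in> H2 n"
  shows "AE \<zeta> in torus n. boundary_fun n f \<zeta> = bdry n f \<zeta>"
  using AE_radial_limit[OF f]
  by eventually_elim (auto simp: boundary_fun_eq intro: tendsto_Lim)

lemma AE_bdry_tendsto:
  assumes f: "f \<in> H2 n"
  shows "AE \<zeta> in torus n. (\<lambda>j. f (dil n (of_real (radius j)) \<zeta>)) \<longlonglongrightarrow> bdry n f \<zeta>"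
  using AE_radial_limit[OF f] by eventually_elim (rule filterlim_compose[OF _ radius_at_left])

text \<open>The maximal function is an integrable majorant for all dilations at once. It turns almost
  everywhere convergence to the boundary function into convergence of integrals.\<close>

lemma H2_dominated:
  assumes f: "f \<in> H2 n"
  obtains w :: "(nat \<Rightarrow> complex) \<Rightarrow> real" where "integrable (torus n) w" "\<And>\<zeta>. w \<zeta> \<ge> 0"
    "AE \<zeta> in torus n. \<forall>j. (cmod (f (dil n (of_real (radius j)) \<zeta>)))\<^sup>2 \<le> w \<zeta>"
    "AE \<zeta> in torus n. (cmod (bdry n f \<zeta>))\<^sup>2 \<le> w \<zeta>"
proof (rule that[of "\<lambda>\<zeta>. enn2real (radial_sup n f \<zeta>)"])
  let ?w = "\<lambda>\<zeta>. enn2real (radial_sup n f \<zeta>)"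
  note ps = H2_sum[OF f]
  have [measurable]: "radial_sup n f \<in> borel_measurable (torus n)" by (rule radial_sup_measurable[OF ps])
  have fin: "(\<integral>\<^sup>+\<zeta>. radial_sup n f \<zeta> \<partial>torus n) < \<infinity>"
    by (rule le_less_trans[OF radial_sup_integral[OF ps H2_summable[OF f]]]) (auto simp: ennreal_mult_less_top)
  have ae: "AE \<zeta> in torus n. radial_sup n f \<zeta> < \<infinity>"
    using nn_integral_PInf_AE[of "radial_sup n f" "torus n"] fin by (auto simp: less_top)
  show "integrable (torus n) ?w"
  proof (rule integrableI_nonneg)
    have "(\<integral>\<^sup>+\<zeta>. ennreal (?w \<zeta>) \<partial>torus n) = (\<integral>\<^sup>+\<zeta>. radial_sup n f \<zeta> \<partial>torus n)"
      by (rule nn_integral_cong_AE) (use ae in eventually_elim, simp)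
    with fin show "(\<integral>\<^sup>+\<zeta>. ennreal (?w \<zeta>) \<partial>torus n) < \<infinity>" by simp
  qed auto
  show *: "AE \<zeta> in torus n. \<forall>j. (cmod (f (dil n (of_real (radius j)) \<zeta>)))\<^sup>2 \<le> ?w \<zeta>"
    using AE_space ae
  proof eventually_elim
    case (elim \<zeta>)
    show ?case
    proof
      fix j
      from enn2real_mono[OF radial_sup_ge[OF ps elim(1) radius_bounds(2,3)], of j] elim(2)
      show "(cmod (f (dil n (of_real (radius j)) \<zeta>)))\<^sup>2 \<le> ?w \<zeta>" by simp
    qed
  qed
  show "AE \<zeta> in torus n. (cmod (bdry n f \<zeta>))\<^sup>2 \<le> ?w \<zeta>"
    using * AE_bdry_tendsto[OF f]
  proof eventually_elim
    case (elim \<zeta>)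
    have "(\<lambda>j. (cmod (f (dil n (of_real (radius j)) \<zeta>)))\<^sup>2) \<longlonglongrightarrow> (cmod (bdry n f \<zeta>))\<^sup>2"
      by (intro tendsto_intros elim(2))
    then show ?case using elim(1) by (intro LIMSEQ_le_const2) auto
  qed
qed auto

lemma mult_le_sum_squares: "0 \<le> x \<Longrightarrow> 0 \<le> y \<Longrightarrow> x * y \<le> x\<^sup>2 + y\<^sup>2" for x y :: real
proof -
  assume "0 \<le> x" "0 \<le> y"
  then have "0 \<le> x * y" by simp
  then have "x * y \<le> 2 * (x * y)" by simp
  also have "\<dots> \<le> x\<^sup>2 + y\<^sup>2" using sum_squares_bound[of x y] by (simp add: mult.assoc)
  finally show ?thesis .
qed

lemma H2_product_limit:
  assumes f: "f \<in> H2 n" and g: "g \<in> H2 n"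
  shows "integrable (torus n) (\<lambda>\<zeta>. bdry n f \<zeta> * cnj (bdry n g \<zeta>))"
    and "(\<lambda>j. LINT \<zeta>|torus n. f (dil n (of_real (radius j)) \<zeta>) * cnj (g (dil n (of_real (radius j)) \<zeta>)))
      \<longlonglongrightarrow> (LINT \<zeta>|torus n. bdry n f \<zeta> * cnj (bdry n g \<zeta>))"
proof -
  note hf = H2_holomorphic[OF f] and hg = H2_holomorphic[OF g]
  obtain v where v: "integrable (torus n) v" "\<And>\<zeta>. v \<zeta> \<ge> 0"
    "AE \<zeta> in torus n. \<forall>j. (cmod (f (dil n (of_real (radius j)) \<zeta>)))\<^sup>2 \<le> v \<zeta>"
    by (rule H2_dominated[OF f]) blast
  obtain w where w: "integrable (torus n) w" "\<And>\<zeta>. w \<zeta> \<ge> 0"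
    "AE \<zeta> in torus n. \<forall>j. (cmod (g (dil n (of_real (radius j)) \<zeta>)))\<^sup>2 \<le> w \<zeta>"
    by (rule H2_dominated[OF g]) blast
  have [measurable]: "bdry n f \<in> borel_measurable (torus n)" "bdry n g \<in> borel_measurable (torus n)"
    by (intro bdry_measurable hf hg)+
  have [measurable]: "(\<lambda>\<zeta>. f (dil n (of_real (radius j)) \<zeta>)) \<in> borel_measurable (torus n)"
    "(\<lambda>\<zeta>. g (dil n (of_real (radius j)) \<zeta>)) \<in> borel_measurable (torus n)" for j
    by (intro holomorphic_dil_measurable hf hg radius_bounds)+
  have lim: "AE \<zeta> in torus n. (\<lambda>j. f (dil n (of_real (radius j)) \<zeta>) * cnj (g (dil n (of_real (radius j)) \<zeta>)))
     \<longlonglongrightarrow> bdry n f \<zeta> * cnj (bdry n g \<zeta>)"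
    using AE_bdry_tendsto[OF f] AE_bdry_tendsto[OF g] by eventually_elim (intro tendsto_intros)
  have bound: "AE \<zeta> in torus n. cmod (f (dil n (of_real (radius j)) \<zeta>) * cnj (g (dil n (of_real (radius j)) \<zeta>))) \<le> v \<zeta> + w \<zeta>" for j
    using v(3) w(3)
  proof eventually_elim
    case (elim \<zeta>)
    let ?a = "cmod (f (dil n (of_real (radius j)) \<zeta>))" and ?b = "cmod (g (dil n (of_real (radius j)) \<zeta>))"
    have "?a * ?b \<le> ?a\<^sup>2 + ?b\<^sup>2" by (rule mult_le_sum_squares) auto
    also have "\<dots> \<le> v \<zeta> + w \<zeta>" using elim by (intro add_mono) auto
    finally show ?case by (simp add: norm_mult)
  qed
  have vw: "integrable (torus n) (\<lambda>\<zeta>. v \<zeta> + w \<zeta>)" using v(1) w(1) by simp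
  show "integrable (torus n) (\<lambda>\<zeta>. bdry n f \<zeta> * cnj (bdry n g \<zeta>))"
    by (rule integrable_dominated_convergence[OF _ _ vw lim bound]) measurable
  show "(\<lambda>j. LINT \<zeta>|torus n. f (dil n (of_real (radius j)) \<zeta>) * cnj (g (dil n (of_real (radius j)) \<zeta>)))
      \<longlonglongrightarrow> (LINT \<zeta>|torus n. bdry n f \<zeta> * cnj (bdry n g \<zeta>))"
    by (rule integral_dominated_convergence[OF _ _ vw lim bound]) measurable
qed

text \<open>Abel summation of an absolutely convergent series: the sums are uniform limits of polynomials in
  the radius on \<open>{0..1}\<close>.\<close>

lemma infsum_radius_limit:
  fixes a :: "'a \<Rightarrow> complex"
  assumes a: "(\<lambda>x. cmod (a x)) summable_on X"
  shows "(\<lambda>j. \<Sum>\<^sub>\<infinity>x\<in>X. a x * of_real (radius j ^ d x)) \<longlonglongrightarrow> (\<Sum>\<^sub>\<infinity>x\<in>X. a x)"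
proof -
  have u: "uniform_limit {0..1} (\<lambda>A r. \<Sum>x\<in>A. a x * of_real (r ^ d x)) (\<lambda>r. \<Sum>\<^sub>\<infinity>x\<in>X. a x * of_real (r ^ d x)) (finite_subsets_at_top X)"
    by (rule Weierstrass_m_test_general[OF _ a]) (auto simp: norm_mult norm_power intro!: mult_left_le power_le_one)
  have "continuous_on {0..1} (\<lambda>r::real. \<Sum>\<^sub>\<infinity>x\<in>X. a x * of_real (r ^ d x))"
    by (rule uniform_limit_theorem[OF _ u]) (auto intro!: always_eventually continuous_intros)
  from continuous_on_tendsto_compose[OF this radius_tendsto]
  show ?thesis by (simp add: radius_bounds less_imp_le)
qed

text \<open>Parseval's identity on the torus of radius \<open>r\<close>, with \<open>r\<close> tending to \<open>1\<close> on both sides.\<close>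

theorem H2_inner_bdry:
  assumes f: "f \<in> H2 n" and g: "g \<in> H2 n"
  shows "H2_inner n f g = (LINT \<zeta>|torus n. bdry n f \<zeta> * cnj (bdry n g \<zeta>))"
proof (rule LIMSEQ_unique)
  let ?a = "\<lambda>\<alpha>. power_coeff n f \<alpha> * cnj (power_coeff n g \<alpha>)"
  show "(\<lambda>j. LINT \<zeta>|torus n. f (dil n (of_real (radius j)) \<zeta>) * cnj (g (dil n (of_real (radius j)) \<zeta>)))
      \<longlonglongrightarrow> (LINT \<zeta>|torus n. bdry n f \<zeta> * cnj (bdry n g \<zeta>))"
    by (rule H2_product_limit(2)[OF f g])
  have "(\<lambda>\<alpha>. cmod (?a \<alpha>)) summable_on multiindices n"
  proof (rule summable_on_comparison_test)
    show "(\<lambda>\<alpha>. (cmod (power_coeff n f \<alpha>))\<^sup>2 + (cmod (power_coeff n g \<alpha>))\<^sup>2) summable_on multiindices n"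
      by (intro summable_on_add H2_summable f g)
    fix \<alpha>
    let ?x = "cmod (power_coeff n f \<alpha>)" and ?y = "cmod (power_coeff n g \<alpha>)"
    show "cmod (?a \<alpha>) \<le> ?x\<^sup>2 + ?y\<^sup>2" by (simp add: norm_mult mult_le_sum_squares)
  qed auto
  from infsum_radius_limit[OF this, of "\<lambda>\<alpha>. 2 * deg n \<alpha>"]
  show "(\<lambda>j. LINT \<zeta>|torus n. f (dil n (of_real (radius j)) \<zeta>) * cnj (g (dil n (of_real (radius j)) \<zeta>))) \<longlonglongrightarrow> H2_inner n f g"
    using infsumI[OF Parseval_radius[OF H2_sum[OF f] H2_sum[OF g] radius_bounds(2,3)]]
    by (simp add: H2_inner_def)
qed

lemma H2_norm_bdry:
  assumes f: "f \<in> H2 n"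
  shows "(H2_norm n f)\<^sup>2 = (LINT \<zeta>|torus n. (cmod (bdry n f \<zeta>))\<^sup>2)"
proof -
  have "complex_of_real (\<Sum>\<^sub>\<infinity>\<alpha>\<in>multiindices n. (cmod (power_coeff n f \<alpha>))\<^sup>2) = H2_inner n f f"
    unfolding H2_inner_def complex_norm_square[symmetric]
    by (rule infsumI[symmetric], rule has_sum_of_real, rule has_sum_infsum, rule H2_summable[OF f])
  also have "\<dots> = complex_of_real (LINT \<zeta>|torus n. (cmod (bdry n f \<zeta>))\<^sup>2)"
    unfolding H2_inner_bdry[OF f f] complex_norm_square[symmetric] by (rule integral_complex_of_real)
  finally show ?thesis
    by (simp add: H2_norm_def infsum_nonneg)
qed

lemma H2_square_integrable:
  assumes f: "f \<in> H2 n"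
  shows "integrable (torus n) (\<lambda>\<zeta>. (cmod (bdry n f \<zeta>))\<^sup>2)"
proof -
  have "integrable (torus n) (\<lambda>\<zeta>. complex_of_real ((cmod (bdry n f \<zeta>))\<^sup>2))"
    using H2_product_limit(1)[OF f f] by (simp only: complex_norm_square)
  from integrable_Re[OF this] show ?thesis by simp
qed

section \<open>Algebraic closure properties\<close>

text \<open>Sums and products at one stroke.\<close>

lemma holomorphic_polydisc_binop:
  assumes f: "holomorphic_polydisc n f" and g: "holomorphic_polydisc n g"
    and c: "\<And>X (u :: (nat \<Rightarrow> complex) \<Rightarrow> complex) v. continuous_on X u \<Longrightarrow> continuous_on X v \<Longrightarrow> continuous_on X (\<lambda>x. h (u x) (v x))"
    and hol: "\<And>X u v. u holomorphic_on X \<Longrightarrow> v holomorphic_on X \<Longrightarrow> (\<lambda>x. h (u x) (v x)) holomorphic_on X"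
  shows "holomorphic_polydisc n (\<lambda>z\<in>polydisc n. h (f z) (g z))"
  unfolding holomorphic_polydisc_def
proof (intro conjI ballI allI impI)
  show "continuous_on (polydisc n) (\<lambda>z\<in>polydisc n. h (f z) (g z))"
    using c f g by (subst continuous_on_cong[OF refl, of _ _ "\<lambda>z. h (f z) (g z)"]) (auto simp: holomorphic_polydisc_def)
  fix z i assume z: "z \<in> polydisc n" and i: "i < n"
  have "(\<lambda>w. h (f (z(i := w))) (g (z(i := w)))) holomorphic_on ball 0 1"
    using f g z i by (intro hol) (auto simp: holomorphic_polydisc_def)
  moreover have "z(i := w) \<in> polydisc n" if "w \<in> ball 0 1" for w
    using z i that by (auto simp: in_polydisc extensional_def)
  ultimately show "(\<lambda>w. (\<lambda>z\<in>polydisc n. h (f z) (g z)) (z(i := w))) holomorphic_on ball 0 1"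
    by (subst holomorphic_cong[OF refl, of _ _ "\<lambda>w. h (f (z(i := w))) (g (z(i := w)))"]) auto
qed simp

lemma holomorphic_polydisc_const: "holomorphic_polydisc n (\<lambda>z\<in>polydisc n. c)"
  unfolding holomorphic_polydisc_def
proof (intro conjI ballI allI impI)
  show "continuous_on (polydisc n) (\<lambda>z\<in>polydisc n. c)"
    by (subst continuous_on_cong[OF refl, of _ _ "\<lambda>z. c"]) auto
  fix z i assume z: "z \<in> polydisc n" and i: "i < n"
  have "z(i := w) \<in> polydisc n" if "w \<in> ball 0 1" for w
    using z i that by (auto simp: in_polydisc extensional_def)
  then show "(\<lambda>w. (\<lambda>z\<in>polydisc n. c) (z(i := w))) holomorphic_on ball 0 1"
    by (subst holomorphic_cong[OF refl, of _ _ "\<lambda>w. c"]) auto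
qed simp

lemma holomorphic_polydisc_coord: "j < n \<Longrightarrow> holomorphic_polydisc n (\<lambda>z\<in>polydisc n. z j)"
  unfolding holomorphic_polydisc_def
proof (intro conjI ballI allI impI)
  show "continuous_on (polydisc n) (\<lambda>z\<in>polydisc n. z j)"
    by (subst continuous_on_cong[OF refl, of _ _ "\<lambda>z. z j"]) auto
  fix z i assume z: "z \<in> polydisc n" and i: "i < n"
  have "z(i := w) \<in> polydisc n" if "w \<in> ball 0 1" for w
    using z i that by (auto simp: in_polydisc extensional_def)
  moreover have "(\<lambda>w. (z(i := w)) j) holomorphic_on ball 0 1" by (cases "i = j") auto
  ultimately show "(\<lambda>w. (\<lambda>z\<in>polydisc n. z j) (z(i := w))) holomorphic_on ball 0 1"
    by (subst holomorphic_cong[OF refl, of _ _ "\<lambda>w. (z(i := w)) j"]) auto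
qed simp

lemma holomorphic_polydisc_add:
  "holomorphic_polydisc n f \<Longrightarrow> holomorphic_polydisc n g \<Longrightarrow> holomorphic_polydisc n (\<lambda>z\<in>polydisc n. f z + g z)"
  by (rule holomorphic_polydisc_binop) (auto intro: continuous_intros holomorphic_intros)

lemma holomorphic_polydisc_mult:
  "holomorphic_polydisc n f \<Longrightarrow> holomorphic_polydisc n g \<Longrightarrow> holomorphic_polydisc n (\<lambda>z\<in>polydisc n. f z * g z)"
  by (rule holomorphic_polydisc_binop) (auto intro: continuous_intros holomorphic_intros)

lemma dil_of_real_polydisc [simp]:
  "\<zeta> \<in> space (torus n) \<Longrightarrow> 0 \<le> r \<Longrightarrow> r < 1 \<Longrightarrow> dil n (of_real r) \<zeta> \<in> polydisc n"
  by (simp add: dil_torus_polydisc)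

lemma integrable_dil_square:
  assumes "holomorphic_polydisc n f" "0 \<le> r" "r < 1"
  shows "integrable (torus n) (\<lambda>\<zeta>. (cmod (f (dil n (of_real r) \<zeta>)))\<^sup>2)"
  using assms
  by (intro integrable_torus_continuous continuous_intros continuous_on_subset[OF continuous_on_dil_torus torus_subset_closed_polydisc])
    (auto simp: holomorphic_polydisc_def)

lemma H2_add:
  assumes f: "f \<in> H2 n" and g: "g \<in> H2 n"
  shows "(\<lambda>z\<in>polydisc n. f z + g z) \<in> H2 n"
proof (rule H2I)
  note hf = H2_holomorphic[OF f] and hg = H2_holomorphic[OF g]
  show "holomorphic_polydisc n (\<lambda>z\<in>polydisc n. f z + g z)" by (rule holomorphic_polydisc_add[OF hf hg])
  fix r :: real assume r: "0 \<le> r" "r < 1"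
  let ?f = "\<lambda>\<zeta>. f (dil n (of_real r) \<zeta>)" and ?g = "\<lambda>\<zeta>. g (dil n (of_real r) \<zeta>)"
  have "(LINT \<zeta>|torus n. (cmod ((\<lambda>z\<in>polydisc n. f z + g z) (dil n (of_real r) \<zeta>)))\<^sup>2) \<le>
     (LINT \<zeta>|torus n. 2 * (cmod (?f \<zeta>))\<^sup>2 + 2 * (cmod (?g \<zeta>))\<^sup>2)"
  proof (rule integral_mono)
    fix \<zeta> assume \<zeta>: "\<zeta> \<in> space (torus n)"
    have "(cmod (?f \<zeta> + ?g \<zeta>))\<^sup>2 \<le> (cmod (?f \<zeta>) + cmod (?g \<zeta>))\<^sup>2"
      by (intro power_mono norm_triangle_ineq) simp
    moreover have "0 \<le> (cmod (?f \<zeta>) - cmod (?g \<zeta>))\<^sup>2" by simp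
    ultimately show "(cmod ((\<lambda>z\<in>polydisc n. f z + g z) (dil n (of_real r) \<zeta>)))\<^sup>2 \<le> 2 * (cmod (?f \<zeta>))\<^sup>2 + 2 * (cmod (?g \<zeta>))\<^sup>2"
      using \<zeta> r by (simp add: power2_diff power2_sum)
  qed (intro integrable_dil_square holomorphic_polydisc_add hf hg r Bochner_Integration.integrable_add integrable_mult_right)+
  also have "\<dots> = 2 * (LINT \<zeta>|torus n. (cmod (?f \<zeta>))\<^sup>2) + 2 * (LINT \<zeta>|torus n. (cmod (?g \<zeta>))\<^sup>2)"
    using integrable_dil_square[OF hf r] integrable_dil_square[OF hg r] by simp
  also have "\<dots> \<le> 2 * (\<Sum>\<^sub>\<infinity>\<alpha>\<in>multiindices n. (cmod (power_coeff n f \<alpha>))\<^sup>2) + 2 * (\<Sum>\<^sub>\<infinity>\<alpha>\<in>multiindices n. (cmod (power_coeff n g \<alpha>))\<^sup>2)"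
    using H2_integral_dil_le[OF f r] H2_integral_dil_le[OF g r] by simp
  finally show "(LINT \<zeta>|torus n. (cmod ((\<lambda>z\<in>polydisc n. f z + g z) (dil n (of_real r) \<zeta>)))\<^sup>2) \<le> \<dots>" .
qed

lemma H2_Hinf_mult:
  assumes \<phi>: "\<phi> \<in> Hinf n" and f: "f \<in> H2 n"
  shows "(\<lambda>z\<in>polydisc n. \<phi> z * f z) \<in> H2 n"
proof -
  note hf = H2_holomorphic[OF f]
  have h\<phi>: "holomorphic_polydisc n \<phi>" using \<phi> by (simp add: Hinf_def)
  obtain C where C: "\<And>z. z \<in> polydisc n \<Longrightarrow> cmod (\<phi> z) \<le> C"
    using \<phi> by (auto simp: Hinf_def bounded_iff)
  show ?thesis
  proof (rule H2I)
    show h: "holomorphic_polydisc n (\<lambda>z\<in>polydisc n. \<phi> z * f z)" by (rule holomorphic_polydisc_mult[OF h\<phi> hf])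
    fix r :: real assume r: "0 \<le> r" "r < 1"
    have "(LINT \<zeta>|torus n. (cmod ((\<lambda>z\<in>polydisc n. \<phi> z * f z) (dil n (of_real r) \<zeta>)))\<^sup>2) \<le>
       (LINT \<zeta>|torus n. C\<^sup>2 * (cmod (f (dil n (of_real r) \<zeta>)))\<^sup>2)"
    proof (rule integral_mono)
      fix \<zeta> assume \<zeta>: "\<zeta> \<in> space (torus n)"
      have "dil n (of_real r) \<zeta> \<in> polydisc n" using \<zeta> r by (intro dil_torus_polydisc) auto
      from power_mono[OF C[OF this], of 2]
      show "(cmod ((\<lambda>z\<in>polydisc n. \<phi> z * f z) (dil n (of_real r) \<zeta>)))\<^sup>2 \<le> C\<^sup>2 * (cmod (f (dil n (of_real r) \<zeta>)))\<^sup>2"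
        using \<zeta> r by (simp add: norm_mult power_mult_distrib mult_right_mono)
    qed (intro integrable_dil_square h hf r integrable_mult_right)+
    also have "\<dots> = C\<^sup>2 * (LINT \<zeta>|torus n. (cmod (f (dil n (of_real r) \<zeta>)))\<^sup>2)" by simp
    also have "\<dots> \<le> C\<^sup>2 * (\<Sum>\<^sub>\<infinity>\<alpha>\<in>multiindices n. (cmod (power_coeff n f \<alpha>))\<^sup>2)"
      by (intro mult_left_mono H2_integral_dil_le f r) simp
    finally show "(LINT \<zeta>|torus n. (cmod ((\<lambda>z\<in>polydisc n. \<phi> z * f z) (dil n (of_real r) \<zeta>)))\<^sup>2) \<le> \<dots>" .
  qed
qed

lemma H2_const: "(\<lambda>z\<in>polydisc n. c) \<in> H2 n"
proof (rule H2I[OF holomorphic_polydisc_const])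
  fix r :: real assume r: "0 \<le> r" "r < 1"
  interpret prob_space "torus n" by (rule prob_space_torus)
  have "(LINT \<zeta>|torus n. (cmod ((\<lambda>z\<in>polydisc n. c) (dil n (of_real r) \<zeta>)))\<^sup>2) = (LINT \<zeta>|torus n. (cmod c)\<^sup>2)"
    using r by (intro Bochner_Integration.integral_cong) auto
  then show "(LINT \<zeta>|torus n. (cmod ((\<lambda>z\<in>polydisc n. c) (dil n (of_real r) \<zeta>)))\<^sup>2) \<le> (cmod c)\<^sup>2"
    by (simp add: prob_space)
qed

lemma Hinf_bound:
  assumes "\<phi> \<in> Hinf n"
  obtains C where "C \<ge> 0" "\<And>z. z \<in> polydisc n \<Longrightarrow> cmod (\<phi> z) \<le> C"
proof -
  obtain C where C: "\<And>z. z \<in> polydisc n \<Longrightarrow> cmod (\<phi> z) \<le> C"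
    using assms by (auto simp: Hinf_def bounded_iff)
  show ?thesis
    by (rule that[of "max 0 C"]) (use C in \<open>auto simp: le_max_iff_disj\<close>)
qed

lemma HinfI:
  assumes "holomorphic_polydisc n f" "\<And>z. z \<in> polydisc n \<Longrightarrow> cmod (f z) \<le> C"
  shows "f \<in> Hinf n"
  using assms by (auto simp: Hinf_def bounded_iff)

lemma Hinf_subset_H2: "\<phi> \<in> Hinf n \<Longrightarrow> \<phi> \<in> H2 n"
proof -
  assume \<phi>: "\<phi> \<in> Hinf n"
  have "(\<lambda>z\<in>polydisc n. \<phi> z * (\<lambda>z\<in>polydisc n. 1) z) = \<phi>"
    using \<phi> by (auto simp: Hinf_def holomorphic_polydisc_def extensional_def fun_eq_iff)
  with H2_Hinf_mult[OF \<phi> H2_const[of 1 n]] show ?thesis by simp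
qed

lemma Hinf_const: "(\<lambda>z\<in>polydisc n. c) \<in> Hinf n"
  by (rule HinfI[OF holomorphic_polydisc_const, of _ _ "cmod c"]) simp

lemma Hinf_coord: "j < n \<Longrightarrow> (\<lambda>z\<in>polydisc n. z j) \<in> Hinf n"
  by (rule HinfI[OF holomorphic_polydisc_coord, of _ _ 1]) (auto simp: in_polydisc less_imp_le)

lemma Hinf_add:
  assumes f: "f \<in> Hinf n" and g: "g \<in> Hinf n"
  shows "(\<lambda>z\<in>polydisc n. f z + g z) \<in> Hinf n"
proof -
  obtain C where C: "C \<ge> 0" "\<And>z. z \<in> polydisc n \<Longrightarrow> cmod (f z) \<le> C" by (rule Hinf_bound[OF f]) blast
  obtain D where D: "D \<ge> 0" "\<And>z. z \<in> polydisc n \<Longrightarrow> cmod (g z) \<le> D" by (rule Hinf_bound[OF g]) blast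
  show ?thesis
    by (rule HinfI[OF holomorphic_polydisc_add, of _ _ _ "C + D"])
      (use f g C D in \<open>auto simp: Hinf_def intro: norm_triangle_mono\<close>)
qed

lemma Hinf_mult:
  assumes f: "f \<in> Hinf n" and g: "g \<in> Hinf n"
  shows "(\<lambda>z\<in>polydisc n. f z * g z) \<in> Hinf n"
proof -
  obtain C where C: "C \<ge> 0" "\<And>z. z \<in> polydisc n \<Longrightarrow> cmod (f z) \<le> C" by (rule Hinf_bound[OF f]) blast
  obtain D where D: "D \<ge> 0" "\<And>z. z \<in> polydisc n \<Longrightarrow> cmod (g z) \<le> D" by (rule Hinf_bound[OF g]) blast
  show ?thesis
    by (rule HinfI[OF holomorphic_polydisc_mult, of _ _ _ "C * D"])
      (use f g C D in \<open>auto simp: Hinf_def norm_mult intro: mult_mono\<close>)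
qed

lemma Hinf_sum:
  assumes "finite A" "\<And>a. a \<in> A \<Longrightarrow> (\<lambda>z\<in>polydisc n. f a z) \<in> Hinf n"
  shows "(\<lambda>z\<in>polydisc n. \<Sum>a\<in>A. f a z) \<in> Hinf n"
  using assms
proof (induction A rule: finite_induct)
  case empty
  then show ?case using Hinf_const[of 0 n] by (simp only: sum.empty)
next
  case (insert a A)
  have "(\<lambda>z\<in>polydisc n. (\<lambda>z\<in>polydisc n. f a z) z + (\<lambda>z\<in>polydisc n. \<Sum>a\<in>A. f a z) z) \<in> Hinf n"
    by (rule Hinf_add) (use insert in auto)
  moreover have "(\<lambda>z\<in>polydisc n. (\<lambda>z\<in>polydisc n. f a z) z + (\<lambda>z\<in>polydisc n. \<Sum>a\<in>A. f a z) z) =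
      (\<lambda>z\<in>polydisc n. \<Sum>a\<in>insert a A. f a z)"
    by (rule restrict_ext) (use insert.hyps in simp)
  ultimately show ?case by metis
qed

lemma Hinf_prod:
  assumes "finite A" "\<And>a. a \<in> A \<Longrightarrow> (\<lambda>z\<in>polydisc n. f a z) \<in> Hinf n"
  shows "(\<lambda>z\<in>polydisc n. \<Prod>a\<in>A. f a z) \<in> Hinf n"
  using assms
proof (induction A rule: finite_induct)
  case empty
  then show ?case using Hinf_const[of 1 n] by (simp only: prod.empty)
next
  case (insert a A)
  have "(\<lambda>z\<in>polydisc n. (\<lambda>z\<in>polydisc n. f a z) z * (\<lambda>z\<in>polydisc n. \<Prod>a\<in>A. f a z) z) \<in> Hinf n"
    by (rule Hinf_mult) (use insert in auto)
  moreover have "(\<lambda>z\<in>polydisc n. (\<lambda>z\<in>polydisc n. f a z) z * (\<lambda>z\<in>polydisc n. \<Prod>a\<in>A. f a z) z) =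
      (\<lambda>z\<in>polydisc n. \<Prod>a\<in>insert a A. f a z)"
    by (rule restrict_ext) (use insert.hyps in simp)
  ultimately show ?case by metis
qed

lemma Hinf_polynomial:
  assumes "finite A"
  shows "(\<lambda>z\<in>polydisc n. \<Sum>\<alpha>\<in>A. c \<alpha> * mon n \<alpha> z) \<in> Hinf n"
proof (rule Hinf_sum[OF assms])
  fix \<alpha> :: "nat \<Rightarrow> nat"
  have pow: "(\<lambda>z\<in>polydisc n. z i ^ k) \<in> Hinf n" if "i < n" for i k
  proof -
    have "(\<lambda>z\<in>polydisc n. \<Prod>_\<in>{..<k}. z i) \<in> Hinf n"
      by (rule Hinf_prod) (use that Hinf_coord in auto)
    then show ?thesis by simp
  qed
  have "(\<lambda>z\<in>polydisc n. mon n \<alpha> z) \<in> Hinf n" by (rule Hinf_prod) (use pow in auto)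
  from Hinf_mult[OF Hinf_const this, of "c \<alpha>"]
  show "(\<lambda>z\<in>polydisc n. c \<alpha> * mon n \<alpha> z) \<in> Hinf n" by (simp cong: restrict_cong)
qed

lemma H2_cmult: "f \<in> H2 n \<Longrightarrow> (\<lambda>z\<in>polydisc n. a * f z) \<in> H2 n"
  using H2_Hinf_mult[OF Hinf_const[of a n]] by (simp cong: restrict_cong)

lemma bdry_restrict_eqI:
  assumes "\<zeta> \<in> space (torus n)" "(\<lambda>j. h (dil n (of_real (radius j)) \<zeta>)) \<longlonglongrightarrow> l"
  shows "bdry n (\<lambda>z\<in>polydisc n. h z) \<zeta> = l"
  by (rule bdry_eqI) (use assms in \<open>simp add: radius_bounds\<close>)

lemma bdry_add:
  assumes f: "f \<in> H2 n" and g: "g \<in> H2 n"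
  shows "AE \<zeta> in torus n. bdry n (\<lambda>z\<in>polydisc n. f z + g z) \<zeta> = bdry n f \<zeta> + bdry n g \<zeta>"
  using AE_space AE_bdry_tendsto[OF f] AE_bdry_tendsto[OF g]
  by eventually_elim (intro bdry_restrict_eqI tendsto_intros)

lemma bdry_mult:
  assumes f: "f \<in> H2 n" and g: "g \<in> H2 n"
  shows "AE \<zeta> in torus n. bdry n (\<lambda>z\<in>polydisc n. f z * g z) \<zeta> = bdry n f \<zeta> * bdry n g \<zeta>"
  using AE_space AE_bdry_tendsto[OF f] AE_bdry_tendsto[OF g]
  by eventually_elim (intro bdry_restrict_eqI tendsto_intros)

lemma bdry_cmult:
  assumes f: "f \<in> H2 n"
  shows "AE \<zeta> in torus n. bdry n (\<lambda>z\<in>polydisc n. a * f z) \<zeta> = a * bdry n f \<zeta>"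
  using AE_space AE_bdry_tendsto[OF f]
  by eventually_elim (intro bdry_restrict_eqI tendsto_intros)

lemma bdry_polynomial:
  assumes "\<zeta> \<in> space (torus n)"
  shows "bdry n (\<lambda>z\<in>polydisc n. \<Sum>\<alpha>\<in>A. c \<alpha> * mon n \<alpha> z) \<zeta> = (\<Sum>\<alpha>\<in>A. c \<alpha> * mon n \<alpha> \<zeta>)"
proof (rule bdry_restrict_eqI[OF assms])
  have "(\<lambda>j. \<Sum>\<alpha>\<in>A. c \<alpha> * (of_real (radius j) ^ deg n \<alpha> * mon n \<alpha> \<zeta>)) \<longlonglongrightarrow> (\<Sum>\<alpha>\<in>A. c \<alpha> * (of_real 1 ^ deg n \<alpha> * mon n \<alpha> \<zeta>))"
    by (intro tendsto_intros radius_tendsto)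
  then show "(\<lambda>j. \<Sum>\<alpha>\<in>A. c \<alpha> * mon n \<alpha> (dil n (of_real (radius j)) \<zeta>)) \<longlonglongrightarrow> (\<Sum>\<alpha>\<in>A. c \<alpha> * mon n \<alpha> \<zeta>)"
    unfolding mon_dil by simp
qed

text \<open>By Parseval a function in \<open>H2\<close> whose boundary function vanishes has only zero coefficients.\<close>

lemma H2_eqI:
  assumes f: "f \<in> H2 n" and g: "g \<in> H2 n" and ae: "AE \<zeta> in torus n. bdry n f \<zeta> = bdry n g \<zeta>"
  shows "f = g"
proof -
  \<comment> \<open>The difference of \<open>f\<close> and \<open>g\<close>, in a form to which the closure properties apply.\<close>
  let ?d = "\<lambda>z\<in>polydisc n. f z + (\<lambda>z\<in>polydisc n. -1 * g z) z"
  have d: "?d \<in> H2 n" by (intro H2_add f H2_cmult g)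
  have "AE \<zeta> in torus n. (cmod (bdry n ?d \<zeta>))\<^sup>2 = 0"
    using bdry_add[OF f H2_cmult[OF g, of "-1"]] bdry_cmult[OF g, of "-1"] ae
    by eventually_elim simp
  then have "(LINT \<zeta>|torus n. (cmod (bdry n ?d \<zeta>))\<^sup>2) = 0"
    by (rule integral_eq_zero_AE)
  then have "H2_norm n ?d = 0" using H2_norm_bdry[OF d] by simp
  then have "(\<Sum>\<^sub>\<infinity>\<alpha>\<in>multiindices n. (cmod (power_coeff n ?d \<alpha>))\<^sup>2) = 0"
    by (simp add: H2_norm_def)
  then have coeff0: "(cmod (power_coeff n ?d \<alpha>))\<^sup>2 = 0" if "\<alpha> \<in> multiindices n" for \<alpha>
    using nonneg_infsum_le_0D[OF _ H2_summable[OF d] _ that] by simp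
  then have "?d z = 0" if "z \<in> polydisc n" for z
  proof -
    have "((\<lambda>\<alpha>. power_coeff n ?d \<alpha> * mon n \<alpha> z) has_sum 0) (multiindices n)"
      by (rule has_sum_0) (use coeff0 in auto)
    then show ?thesis using has_sum_unique[OF H2_sum[OF d that]] by blast
  qed
  then have "f z = g z" if "z \<in> polydisc n" for z using that by fastforce
  then show ?thesis
    using H2_holomorphic[OF f] H2_holomorphic[OF g]
    by (intro extensionalityI[of _ "polydisc n"]) (auto simp: holomorphic_polydisc_def)
qed

section \<open>Uniqueness of Fourier coefficients on the torus\<close>

text \<open>The products \<open>mon n \<alpha> * cnj (mon n \<beta>)\<close> run through all characters of the torus, so this says
  that all Fourier coefficients of \<open>G\<close> vanish; negative exponents are avoided.\<close>

definition null_coeffs :: "nat \<Rightarrow> ((nat \<Rightarrow> complex) \<Rightarrow> complex) \<Rightarrow> bool"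
  where "null_coeffs n G \<longleftrightarrow> integrable (torus n) G \<and>
    (\<forall>\<alpha> \<beta>. (LINT \<zeta>|torus n. G \<zeta> * (mon n \<alpha> \<zeta> * cnj (mon n \<beta> \<zeta>))) = 0)"

lemma integrable_mult_bounded:
  fixes G b :: "'a \<Rightarrow> complex"
  assumes "integrable M G" "b \<in> borel_measurable M" "\<And>x. x \<in> space M \<Longrightarrow> cmod (b x) \<le> B"
  shows "integrable M (\<lambda>x. G x * b x)"
proof (rule Bochner_Integration.integrable_bound)
  show "integrable M (\<lambda>x. of_real B * G x)" using assms(1) by simp
  show "(\<lambda>x. G x * b x) \<in> borel_measurable M" using assms by measurable
  show "AE x in M. norm (G x * b x) \<le> norm (of_real B * G x)"
    using AE_space
  proof eventually_elim
    case (elim x)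
    from mult_left_mono[OF order_trans[OF assms(3)[OF elim] abs_ge_self[of B]] norm_ge_zero[of "G x"]] show ?case
      by (simp add: norm_mult mult.commute)
  qed
qed

lemma borel_measurable_mon [measurable]: "mon n \<alpha> \<in> borel_measurable (torus n)"
  by (intro borel_measurable_torus_continuous continuous_intros)

lemma borel_measurable_character [measurable]:
  "(\<lambda>\<zeta>. mon n \<alpha> \<zeta> * cnj (mon n \<beta> \<zeta>)) \<in> borel_measurable (torus n)"
  by (intro borel_measurable_torus_continuous continuous_intros)

lemma norm_character: "\<zeta> \<in> space (torus n) \<Longrightarrow> cmod (mon n \<alpha> \<zeta> * cnj (mon n \<beta> \<zeta>)) = 1"
  by (simp only: norm_mult complex_mod_cnj norm_mon_torus)

lemma integrable_mult_monomials:
  assumes "integrable (torus n) G"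
  shows "integrable (torus n) (\<lambda>\<zeta>. G \<zeta> * (mon n \<alpha> \<zeta> * cnj (mon n \<beta> \<zeta>)))"
  by (rule integrable_mult_bounded[OF assms borel_measurable_character, where B=1])
    (simp only: norm_character)

lemma null_coeffs_add:
  assumes "null_coeffs n G" "null_coeffs n H"
  shows "null_coeffs n (\<lambda>\<zeta>. G \<zeta> + H \<zeta>)"
  using assms integrable_mult_monomials[of n G] integrable_mult_monomials[of n H]
  by (simp add: null_coeffs_def distrib_right del: cnj_prod)

lemma null_coeffs_cmult:
  assumes "null_coeffs n G"
  shows "null_coeffs n (\<lambda>\<zeta>. c * G \<zeta>)"
  using assms by (simp add: null_coeffs_def mult.assoc del: cnj_prod)

lemma null_coeffs_cong:
  assumes "null_coeffs n G" "\<And>\<zeta>. \<zeta> \<in> space (torus n) \<Longrightarrow> G \<zeta> = H \<zeta>"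
  shows "null_coeffs n H"
proof -
  have "integrable (torus n) G \<longleftrightarrow> integrable (torus n) H"
    by (rule Bochner_Integration.integrable_cong) (auto simp: assms(2))
  moreover have "(LINT \<zeta>|torus n. G \<zeta> * (mon n \<alpha> \<zeta> * cnj (mon n \<beta> \<zeta>))) = (LINT \<zeta>|torus n. H \<zeta> * (mon n \<alpha> \<zeta> * cnj (mon n \<beta> \<zeta>)))" for \<alpha> \<beta>
    by (rule Bochner_Integration.integral_cong) (auto simp: assms(2))
  ultimately show ?thesis using assms(1) by (simp add: null_coeffs_def del: cnj_prod)
qed

lemma mon_Suc: "i < n \<Longrightarrow> mon n (\<alpha>(i := Suc (\<alpha> i))) \<zeta> = \<zeta> i * mon n \<alpha> \<zeta>"
  by (simp add: prod.remove[of "{..<n}" i] mult_ac)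

lemma null_coeffs_coord:
  assumes G: "null_coeffs n G" and i: "i < n"
  shows "null_coeffs n (\<lambda>\<zeta>. G \<zeta> * \<zeta> i)" "null_coeffs n (\<lambda>\<zeta>. G \<zeta> * cnj (\<zeta> i))"
proof -
  have m [measurable]: "(\<lambda>\<zeta>. \<zeta> i) \<in> borel_measurable (torus n)"
    using i by (intro borel_measurable_torus_continuous) simp
  have int: "integrable (torus n) (\<lambda>\<zeta>. G \<zeta> * \<zeta> i)" "integrable (torus n) (\<lambda>\<zeta>. G \<zeta> * cnj (\<zeta> i))"
    using G norm_torus i by (auto simp: null_coeffs_def intro!: integrable_mult_bounded[where B=1])
  have "(LINT \<zeta>|torus n. G \<zeta> * \<zeta> i * (mon n \<alpha> \<zeta> * cnj (mon n \<beta> \<zeta>))) =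
     (LINT \<zeta>|torus n. G \<zeta> * (mon n (\<alpha>(i := Suc (\<alpha> i))) \<zeta> * cnj (mon n \<beta> \<zeta>)))" for \<alpha> \<beta>
    unfolding mon_Suc[OF i] by (simp only: mult_ac)
  moreover have "(LINT \<zeta>|torus n. G \<zeta> * cnj (\<zeta> i) * (mon n \<alpha> \<zeta> * cnj (mon n \<beta> \<zeta>))) =
     (LINT \<zeta>|torus n. G \<zeta> * (mon n \<alpha> \<zeta> * cnj (mon n (\<beta>(i := Suc (\<beta> i))) \<zeta>)))" for \<alpha> \<beta>
    unfolding mon_Suc[OF i] by (simp only: mult_ac complex_cnj_mult)
  ultimately show "null_coeffs n (\<lambda>\<zeta>. G \<zeta> * \<zeta> i)" "null_coeffs n (\<lambda>\<zeta>. G \<zeta> * cnj (\<zeta> i))"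
    using G int unfolding null_coeffs_def by simp_all
qed

text \<open>Multiplication by \<open>b\<close> preserves the vanishing of all Fourier coefficients. Unlike the vanishing of
  the integrals of \<open>G * b\<close> alone, this property is inherited by products, which makes it suitable for
  passing from coordinates to polynomials and from sets to their intersections.\<close>

definition null_multiplier :: "nat \<Rightarrow> ((nat \<Rightarrow> complex) \<Rightarrow> real) \<Rightarrow> bool"
  where "null_multiplier n b \<longleftrightarrow> b \<in> borel_measurable (torus n) \<and> (\<exists>B. \<forall>\<zeta>\<in>space (torus n). \<bar>b \<zeta>\<bar> \<le> B) \<and>
    (\<forall>G. null_coeffs n G \<longrightarrow> null_coeffs n (\<lambda>\<zeta>. G \<zeta> * of_real (b \<zeta>)))"

lemma null_multiplier_cong:
  assumes b: "null_multiplier n b" and eq: "\<And>\<zeta>. \<zeta> \<in> space (torus n) \<Longrightarrow> b \<zeta> = b' \<zeta>"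
  shows "null_multiplier n b'"
proof -
  have "b' \<in> borel_measurable (torus n)"
    using b eq measurable_cong[of "torus n" b b'] by (auto simp: null_multiplier_def)
  moreover have "null_coeffs n (\<lambda>\<zeta>. G \<zeta> * of_real (b' \<zeta>))" if "null_coeffs n G" for G
    by (rule null_coeffs_cong[of _ "\<lambda>\<zeta>. G \<zeta> * of_real (b \<zeta>)"]) (use b eq that in \<open>auto simp: null_multiplier_def\<close>)
  ultimately show ?thesis using b eq by (auto simp: null_multiplier_def)
qed

lemma null_multiplier_const: "null_multiplier n (\<lambda>_. c)"
  using null_coeffs_cmult[of n _ "of_real c"] by (auto simp: null_multiplier_def mult.commute)

lemma null_multiplier_add:
  assumes a: "null_multiplier n a" and b: "null_multiplier n b"
  shows "null_multiplier n (\<lambda>\<zeta>. a \<zeta> + b \<zeta>)"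
proof -
  obtain A B where "\<forall>\<zeta>\<in>space (torus n). \<bar>a \<zeta>\<bar> \<le> A" "\<forall>\<zeta>\<in>space (torus n). \<bar>b \<zeta>\<bar> \<le> B"
    using a b by (auto simp: null_multiplier_def)
  then have "\<forall>\<zeta>\<in>space (torus n). \<bar>a \<zeta> + b \<zeta>\<bar> \<le> A + B" by (force intro: abs_triangle_ineq order_trans)
  moreover have "null_coeffs n (\<lambda>\<zeta>. G \<zeta> * of_real (a \<zeta> + b \<zeta>))" if "null_coeffs n G" for G
    using null_coeffs_add[of n "\<lambda>\<zeta>. G \<zeta> * of_real (a \<zeta>)" "\<lambda>\<zeta>. G \<zeta> * of_real (b \<zeta>)"] a b that
    by (simp add: null_multiplier_def distrib_left)
  ultimately show ?thesis using a b by (auto simp: null_multiplier_def)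
qed

lemma null_multiplier_mult:
  assumes a: "null_multiplier n a" and b: "null_multiplier n b"
  shows "null_multiplier n (\<lambda>\<zeta>. a \<zeta> * b \<zeta>)"
proof -
  obtain A B where "\<forall>\<zeta>\<in>space (torus n). \<bar>a \<zeta>\<bar> \<le> A" "\<forall>\<zeta>\<in>space (torus n). \<bar>b \<zeta>\<bar> \<le> B"
    using a b by (auto simp: null_multiplier_def)
  then have "\<forall>\<zeta>\<in>space (torus n). \<bar>a \<zeta> * b \<zeta>\<bar> \<le> A * B"
    by (auto simp: abs_mult intro!: mult_mono intro: order_trans[OF abs_ge_zero])
  moreover have "null_coeffs n (\<lambda>\<zeta>. G \<zeta> * of_real (a \<zeta> * b \<zeta>))" if "null_coeffs n G" for G
  proof -
    have "null_coeffs n (\<lambda>\<zeta>. (G \<zeta> * of_real (a \<zeta>)) * of_real (b \<zeta>))"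
      using a b that by (simp add: null_multiplier_def)
    then show ?thesis by (simp add: mult.assoc)
  qed
  ultimately show ?thesis using a b by (auto simp: null_multiplier_def)
qed

lemma null_multiplier_prod:
  "finite I \<Longrightarrow> (\<And>i. i \<in> I \<Longrightarrow> null_multiplier n (b i)) \<Longrightarrow> null_multiplier n (\<lambda>\<zeta>. \<Prod>i\<in>I. b i \<zeta>)"
proof (induction I rule: finite_induct)
  case empty
  then show ?case by (simp add: null_multiplier_const)
next
  case (insert i I)
  then show ?case using null_multiplier_mult[of n "b i"] by simp
qed

lemma null_multiplier_limit:
  fixes b :: "nat \<Rightarrow> (nat \<Rightarrow> complex) \<Rightarrow> real"
  assumes b: "\<And>k. null_multiplier n (b k)"
    and bd: "\<And>k \<zeta>. \<zeta> \<in> space (torus n) \<Longrightarrow> \<bar>b k \<zeta>\<bar> \<le> B"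
    and lim: "\<And>\<zeta>. \<zeta> \<in> space (torus n) \<Longrightarrow> (\<lambda>k. b k \<zeta>) \<longlonglongrightarrow> c \<zeta>"
  shows "null_multiplier n c"
proof -
  have [measurable]: "b k \<in> borel_measurable (torus n)" for k using b by (simp add: null_multiplier_def)
  have [measurable]: "c \<in> borel_measurable (torus n)"
    by (rule borel_measurable_LIMSEQ_metric[where f=b]) (use lim in auto)
  have cB: "\<bar>c \<zeta>\<bar> \<le> B" if "\<zeta> \<in> space (torus n)" for \<zeta>
    using tendsto_rabs[OF lim[OF that]] bd[OF that] by (intro LIMSEQ_le_const2) auto
  have "null_coeffs n (\<lambda>\<zeta>. G \<zeta> * of_real (c \<zeta>))" if G: "null_coeffs n G" for G
  proof -
    have Gi [measurable]: "integrable (torus n) G" using G by (simp add: null_coeffs_def)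
    have int: "integrable (torus n) (\<lambda>\<zeta>. G \<zeta> * of_real (c \<zeta>))"
      by (rule integrable_mult_bounded[OF Gi, where B=B]) (use cB in auto)
    have "(LINT \<zeta>|torus n. G \<zeta> * of_real (c \<zeta>) * (mon n \<alpha> \<zeta> * cnj (mon n \<beta> \<zeta>))) = 0" for \<alpha> \<beta>
    proof -
      have "(\<lambda>k. LINT \<zeta>|torus n. G \<zeta> * of_real (b k \<zeta>) * (mon n \<alpha> \<zeta> * cnj (mon n \<beta> \<zeta>))) \<longlonglongrightarrow>
        (LINT \<zeta>|torus n. G \<zeta> * of_real (c \<zeta>) * (mon n \<alpha> \<zeta> * cnj (mon n \<beta> \<zeta>)))"
      proof (rule integral_dominated_convergence[where w="\<lambda>\<zeta>. B * cmod (G \<zeta>)"])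
        show "integrable (torus n) (\<lambda>\<zeta>. B * cmod (G \<zeta>))" using Gi by simp
        show "AE \<zeta> in torus n. (\<lambda>k. G \<zeta> * of_real (b k \<zeta>) * (mon n \<alpha> \<zeta> * cnj (mon n \<beta> \<zeta>))) \<longlonglongrightarrow>
          G \<zeta> * of_real (c \<zeta>) * (mon n \<alpha> \<zeta> * cnj (mon n \<beta> \<zeta>))"
          using AE_space by eventually_elim (intro tendsto_intros lim)
        show "AE \<zeta> in torus n. cmod (G \<zeta> * of_real (b k \<zeta>) * (mon n \<alpha> \<zeta> * cnj (mon n \<beta> \<zeta>))) \<le> B * cmod (G \<zeta>)" for k
          using AE_space
        proof eventually_elim
          case (elim \<zeta>)
          from mult_right_mono[OF bd[OF elim, of k], of "cmod (G \<zeta>)"] elim show ?case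
            by (simp add: norm_mult norm_mon_torus mult.commute del: cnj_prod)
        qed
      qed (use Gi in measurable)
      moreover have "(LINT \<zeta>|torus n. G \<zeta> * of_real (b k \<zeta>) * (mon n \<alpha> \<zeta> * cnj (mon n \<beta> \<zeta>))) = 0" for k
        using b[of k] G by (simp add: null_multiplier_def null_coeffs_def del: cnj_prod)
      ultimately show ?thesis by (simp add: LIMSEQ_const_iff)
    qed
    with int show ?thesis by (simp add: null_coeffs_def del: cnj_prod)
  qed
  then show ?thesis using cB by (auto simp: null_multiplier_def)
qed

text \<open>The real and imaginary parts of a coordinate are combinations of the coordinate and its conjugate,
  and these only shift the Fourier coefficients.\<close>

lemma null_multiplier_polynomial:
  fixes p :: "complex \<Rightarrow> real"
  assumes "real_polynomial_function p" and i: "i < n"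
  shows "null_multiplier n (\<lambda>\<zeta>. p (\<zeta> i))"
  using assms(1)
proof induction
  case (linear p)
  then interpret bounded_linear p .
  have p: "p w = Re w * p 1 + Im w * p \<i>" for w
  proof -
    have "w = Re w *\<^sub>R 1 + Im w *\<^sub>R \<i>" by (simp add: complex_eq_iff)
    then have "p w = p (Re w *\<^sub>R 1 + Im w *\<^sub>R \<i>)" by simp
    then show ?thesis by (simp only: add scaleR real_scaleR_def)
  qed
  have [measurable]: "(\<lambda>\<zeta>. \<zeta> i) \<in> borel_measurable (torus n)"
    by (intro borel_measurable_torus_continuous) simp
  have bd: "\<bar>Re (\<zeta> i)\<bar> \<le> 1" "\<bar>Im (\<zeta> i)\<bar> \<le> 1" if "\<zeta> \<in> space (torus n)" for \<zeta>
    using norm_torus[OF that i] abs_Re_le_cmod[of "\<zeta> i"] abs_Im_le_cmod[of "\<zeta> i"] by auto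
  have "null_coeffs n (\<lambda>\<zeta>. G \<zeta> * of_real (Re (\<zeta> i)))" if G: "null_coeffs n G" for G
  proof (rule null_coeffs_cong)
    show "null_coeffs n (\<lambda>\<zeta>. (1/2) * (G \<zeta> * \<zeta> i + G \<zeta> * cnj (\<zeta> i)))"
      by (intro null_coeffs_cmult null_coeffs_add null_coeffs_coord G i)
    show "(1/2) * (G \<zeta> * \<zeta> i + G \<zeta> * cnj (\<zeta> i)) = G \<zeta> * of_real (Re (\<zeta> i))" for \<zeta>
      by (simp add: complex_add_cnj flip: distrib_left)
  qed
  then have re: "null_multiplier n (\<lambda>\<zeta>. Re (\<zeta> i))"
    using bd unfolding null_multiplier_def by (intro conjI exI[of _ 1]) auto
  have "null_coeffs n (\<lambda>\<zeta>. G \<zeta> * of_real (Im (\<zeta> i)))" if G: "null_coeffs n G" for G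
  proof (rule null_coeffs_cong)
    show "null_coeffs n (\<lambda>\<zeta>. (1/(2*\<i>)) * (G \<zeta> * \<zeta> i + (-1) * (G \<zeta> * cnj (\<zeta> i))))"
      by (intro null_coeffs_cmult null_coeffs_add null_coeffs_coord G i)
    have e: "G \<zeta> * \<zeta> i + (-1) * (G \<zeta> * cnj (\<zeta> i)) = G \<zeta> * (\<zeta> i - cnj (\<zeta> i))" for \<zeta> by (simp add: algebra_simps)
    show "(1/(2*\<i>)) * (G \<zeta> * \<zeta> i + (-1) * (G \<zeta> * cnj (\<zeta> i))) = G \<zeta> * of_real (Im (\<zeta> i))" for \<zeta>
      unfolding e complex_diff_cnj by (simp add: field_simps)
  qed
  then have im: "null_multiplier n (\<lambda>\<zeta>. Im (\<zeta> i))"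
    using bd unfolding null_multiplier_def by (intro conjI exI[of _ 1]) auto
  have "null_multiplier n (\<lambda>\<zeta>. Re (\<zeta> i) * p 1 + Im (\<zeta> i) * p \<i>)"
    by (intro null_multiplier_add null_multiplier_mult re im null_multiplier_const)
  then show ?case by (rule null_multiplier_cong) (rule p[symmetric])
next
  case (const c)
  then show ?case by (rule null_multiplier_const)
next
  case (add f g)
  show ?case by (rule null_multiplier_add[OF add.IH])
next
  case (mult f g)
  show ?case by (rule null_multiplier_mult[OF mult.IH])
qed

text \<open>Weierstrass approximation on the circle.\<close>

lemma null_multiplier_continuous:
  fixes \<psi> :: "complex \<Rightarrow> real"
  assumes \<psi>: "continuous_on (sphere 0 1) \<psi>" and i: "i < n"
  shows "null_multiplier n (\<lambda>\<zeta>. \<psi> (\<zeta> i))"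
proof -
  have "\<exists>p. real_polynomial_function p \<and> (\<forall>w\<in>sphere 0 1. \<bar>\<psi> w - p w\<bar> < 1 / real (Suc k))" for k
  proof -
    have "0 < 1 / real (Suc k)" by simp
    with Stone_Weierstrass_real_polynomial_function[OF compact_sphere \<psi>]
    obtain p where "real_polynomial_function p" "\<And>w. w \<in> sphere 0 1 \<Longrightarrow> \<bar>\<psi> w - p w\<bar> < 1 / real (Suc k)"
      by metis
    then show ?thesis by (intro exI[of _ p]) simp
  qed
  then have "\<forall>k. \<exists>p. real_polynomial_function p \<and> (\<forall>w\<in>sphere 0 1. \<bar>\<psi> w - p w\<bar> < 1 / real (Suc k))" by blast
  from choice[OF this] obtain p where p: "\<And>k. real_polynomial_function (p k)" "\<And>k w. w \<in> sphere 0 1 \<Longrightarrow> \<bar>\<psi> w - p k w\<bar> < 1 / real (Suc k)"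
    by blast
  have "bounded (\<psi> ` sphere 0 1)" by (intro compact_imp_bounded compact_continuous_image \<psi> compact_sphere)
  then obtain B where "\<forall>w\<in>sphere 0 1. \<bar>\<psi> w\<bar> \<le> B" by (auto simp: bounded_iff)
  then have B: "\<bar>\<psi> w\<bar> \<le> B" if "w \<in> sphere 0 1" for w using that by blast
  show ?thesis
  proof (rule null_multiplier_limit)
    show "null_multiplier n (\<lambda>\<zeta>. p k (\<zeta> i))" for k by (rule null_multiplier_polynomial[OF p(1) i])
    fix \<zeta> assume "\<zeta> \<in> space (torus n)"
    then have \<zeta>: "\<zeta> i \<in> sphere 0 1" using norm_torus i by simp
    show "\<bar>p k (\<zeta> i)\<bar> \<le> B + 1" for k
    proof -
      have "1 / real (Suc k) \<le> 1" by simp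
      with p(2)[OF \<zeta>, of k] B[OF \<zeta>] show ?thesis by linarith
    qed
    show "(\<lambda>k. p k (\<zeta> i)) \<longlonglongrightarrow> \<psi> (\<zeta> i)"
    proof (rule LIMSEQ_I)
      fix e :: real assume "e > 0"
      then obtain N where N: "1 / real (Suc N) < e" using nat_approx_posE by blast
      have "norm (p k (\<zeta> i) - \<psi> (\<zeta> i)) < e" if "N \<le> k" for k
      proof -
        have "1 / real (Suc k) \<le> 1 / real (Suc N)" using that by (intro divide_left_mono) auto
        then show ?thesis using p(2)[OF \<zeta>, of k] N by (simp add: abs_minus_commute)
      qed
      then show "\<exists>N. \<forall>k\<ge>N. norm (p k (\<zeta> i) - \<psi> (\<zeta> i)) < e" by blast
    qed
  qed
qed

text \<open>The indicator of an open set is the limit of the continuous functions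
  \<open>min 1 (k * infdist w (- U))\<close>.\<close>

lemma null_multiplier_open:
  assumes U: "open U" and i: "i < n"
  shows "null_multiplier n (\<lambda>\<zeta>. indicator U (\<zeta> i))"
proof (cases "- U = {}")
  case True
  then have "U = UNIV" by blast
  then show ?thesis by (simp add: null_multiplier_const)
next
  case False
  let ?b = "\<lambda>k w. min 1 (real k * infdist w (- U))"
  show ?thesis
  proof (rule null_multiplier_limit[where B=1 and b="\<lambda>k \<zeta>. ?b k (\<zeta> i)"])
    show "null_multiplier n (\<lambda>\<zeta>. ?b k (\<zeta> i))" for k
      by (rule null_multiplier_continuous[OF _ i]) (intro continuous_intros)
    show "\<bar>?b k (\<zeta> i)\<bar> \<le> 1" for k \<zeta> by (simp add: infdist_nonneg)
    show "(\<lambda>k. ?b k (\<zeta> i)) \<longlonglongrightarrow> indicator U (\<zeta> i)" for \<zeta>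
    proof (cases "\<zeta> i \<in> U")
      case False
      then show ?thesis by simp
    next
      case True
      have "closed (- U)" using U by (simp add: closed_Compl)
      then have "infdist (\<zeta> i) (- U) > 0"
        using in_closed_iff_infdist_zero[of "- U" "\<zeta> i"] \<open>- U \<noteq> {}\<close> True infdist_nonneg[of "\<zeta> i" "- U"] by auto
      then obtain N where N: "1 < real N * infdist (\<zeta> i) (- U)" using reals_Archimedean3 by blast
      have "?b k (\<zeta> i) = 1" if "N \<le> k" for k
      proof -
        have "real N * infdist (\<zeta> i) (- U) \<le> real k * infdist (\<zeta> i) (- U)"
          using that by (intro mult_right_mono) (auto simp: infdist_nonneg)
        with N show ?thesis by simp
      qed
      then have "\<forall>\<^sub>F k in sequentially. ?b k (\<zeta> i) = 1" by (auto simp: eventually_sequentially)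
      then show ?thesis using True by (simp add: tendsto_eventually)
    qed
  qed
qed

text \<open>The sets with this property form a \<open>\<sigma>\<close>-algebra for which all coordinates are measurable,
  hence it contains the product \<open>\<sigma>\<close>-algebra.\<close>

lemma null_multiplier_indicator:
  assumes A: "A \<in> sets (torus n)"
  shows "null_multiplier n (indicator A)"
proof -
  \<comment> \<open>The closure under countable unions uses that \<open>1\<close> minus a product of complementary indicators
    is the indicator of a finite union.\<close>
  define \<A> where "\<A> = {A \<in> sets (torus n). null_multiplier n (indicator A)}"
  interpret \<A>: sigma_algebra "space (torus n)" \<A>
    unfolding sigma_algebra_iff2
  proof (intro conjI ballI allI impI)
    show "\<A> \<subseteq> Pow (space (torus n))" using sets.sets_into_space by (auto simp: \<A>_def)
    show "{} \<in> \<A>" using null_multiplier_cong[OF null_multiplier_const[of n 0], of "indicator {}"] by (simp add: \<A>_def)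
    fix S assume S: "S \<in> \<A>"
    have "null_multiplier n (\<lambda>\<zeta>. 1 + (-1) * indicator S \<zeta>)"
      using S by (intro null_multiplier_add null_multiplier_mult null_multiplier_const) (auto simp: \<A>_def)
    then have "null_multiplier n (indicator (space (torus n) - S))"
      by (rule null_multiplier_cong) (auto split: split_indicator)
    then show "space (torus n) - S \<in> \<A>" using S by (auto simp: \<A>_def)
  next
    fix S :: "nat \<Rightarrow> _" assume S: "range S \<subseteq> \<A>"
    have "null_multiplier n (indicator (\<Union>k. S k))"
    proof (rule null_multiplier_limit[where B=1 and b="\<lambda>N \<zeta>. 1 + (-1) * (\<Prod>k<N. 1 + (-1) * indicator (S k) \<zeta>)"])
      show "null_multiplier n (\<lambda>\<zeta>. 1 + (-1) * (\<Prod>k<N. 1 + (-1) * indicator (S k) \<zeta>))" for N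
        using S by (intro null_multiplier_add null_multiplier_mult null_multiplier_const null_multiplier_prod) (auto simp: \<A>_def)
      have e: "(\<Prod>k<N. 1 + (-1) * indicator (S k) \<zeta>) = (if \<exists>k<N. \<zeta> \<in> S k then 0 else 1 :: real)" for N \<zeta>
        by (induction N) (auto simp: less_Suc_eq)
      show "\<bar>1 + (-1) * (\<Prod>k<N. 1 + (-1) * indicator (S k) \<zeta>)\<bar> \<le> (1::real)" for N \<zeta> unfolding e by simp
      show "(\<lambda>N. 1 + (-1) * (\<Prod>k<N. 1 + (-1) * indicator (S k) \<zeta>)) \<longlonglongrightarrow> (indicator (\<Union>k. S k) \<zeta> :: real)" for \<zeta>
        unfolding e
      proof (rule tendsto_eventually, cases "\<exists>k. \<zeta> \<in> S k")
        case True
        then obtain k where "\<zeta> \<in> S k" by blast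
        then show "\<forall>\<^sub>F N in sequentially. 1 + (-1) * (if \<exists>k<N. \<zeta> \<in> S k then 0 else 1) = (indicator (\<Union>k. S k) \<zeta> :: real)"
          by (intro eventually_sequentiallyI[of "Suc k"]) (auto simp: Suc_le_eq indicator_def)
      qed auto
    qed
    then show "(\<Union>k. S k) \<in> \<A>" using S by (auto simp: \<A>_def)
  qed
  define N where "N = measure_of (space (torus n)) \<A> (\<lambda>_. 0)"
  have spN: "space N = space (torus n)" and setsN: "sets N = \<A>"
    by (simp_all add: N_def \<A>.space_measure_of_eq \<A>.sets_measure_of_eq)
  have "(\<lambda>\<zeta>. \<zeta> i) \<in> N \<rightarrow>\<^sub>M circle" if i: "i < n" for i
  proof (rule measurable_into_circle)
    show "(\<lambda>\<zeta>. \<zeta> i) \<in> borel_measurable N"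
    proof (rule borel_measurableI)
      fix U :: "complex set" assume U: "open U"
      have [measurable]: "(\<lambda>\<zeta>. \<zeta> i) \<in> borel_measurable (torus n)" "U \<in> sets borel"
        using i U by (auto intro: borel_measurable_torus_continuous)
      have "(\<lambda>\<zeta>. \<zeta> i) -` U \<inter> space (torus n) \<in> sets (torus n)" by measurable
      moreover have "null_multiplier n (indicator ((\<lambda>\<zeta>. \<zeta> i) -` U \<inter> space (torus n)))"
        by (rule null_multiplier_cong[OF null_multiplier_open[OF U i]]) (auto split: split_indicator)
      ultimately show "(\<lambda>\<zeta>. \<zeta> i) -` U \<inter> space N \<in> sets N" by (simp add: spN setsN \<A>_def)
    qed
  qed (use i in \<open>simp add: spN norm_torus\<close>)
  then have "(\<lambda>\<zeta>. \<zeta>) \<in> N \<rightarrow>\<^sub>M torus n"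
    unfolding torus_def by (intro measurable_PiM_single') (auto simp: spN space_torus)
  from measurable_sets[OF this A] have "A \<in> \<A>"
    using sets.sets_into_space[OF A] by (simp add: spN setsN Int_absorb2)
  then show ?thesis by (simp add: \<A>_def)
qed

text \<open>As indicators of measurable sets are multipliers, the integral of \<open>G\<close> over every measurable set
  vanishes.\<close>

theorem null_coeffs_imp_AE_0:
  assumes G: "null_coeffs n G"
  shows "AE \<zeta> in torus n. G \<zeta> = 0"
proof -
  have int: "integrable (torus n) G" using G by (simp add: null_coeffs_def)
  have set0: "(LINT \<zeta>|torus n. indicator A \<zeta> *\<^sub>R G \<zeta>) = 0" if A: "A \<in> sets (torus n)" for A
  proof -
    have "null_coeffs n (\<lambda>\<zeta>. G \<zeta> * of_real (indicator A \<zeta>))"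
      using null_multiplier_indicator[OF A] G by (simp add: null_multiplier_def)
    from conjunct2[OF this[unfolded null_coeffs_def], rule_format, of "\<lambda>_. 0" "\<lambda>_. 0"]
    show ?thesis by (simp add: scaleR_conv_of_real mult.commute)
  qed
  have intA: "integrable (torus n) (\<lambda>\<zeta>. indicator A \<zeta> *\<^sub>R G \<zeta>)" if "A \<in> sets (torus n)" for A
    by (rule integrable_mult_indicator[OF that int])
  have "AE \<zeta> in torus n. Re (G \<zeta>) = 0"
  proof (rule density_unique_real)
    fix A assume A: "A \<in> sets (torus n)"
    have "(LINT \<zeta>:A|torus n. Re (G \<zeta>)) = Re (LINT \<zeta>|torus n. indicator A \<zeta> *\<^sub>R G \<zeta>)"
      unfolding set_lebesgue_integral_def integral_Re[OF intA[OF A], symmetric] by simp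
    then show "(LINT \<zeta>:A|torus n. Re (G \<zeta>)) = (LINT \<zeta>:A|torus n. 0)"
      by (simp add: set0[OF A] set_lebesgue_integral_def)
  qed (use int in auto)
  moreover have "AE \<zeta> in torus n. Im (G \<zeta>) = 0"
  proof (rule density_unique_real)
    fix A assume A: "A \<in> sets (torus n)"
    have "(LINT \<zeta>:A|torus n. Im (G \<zeta>)) = Im (LINT \<zeta>|torus n. indicator A \<zeta> *\<^sub>R G \<zeta>)"
      unfolding set_lebesgue_integral_def integral_Im[OF intA[OF A], symmetric] by simp
    then show "(LINT \<zeta>:A|torus n. Im (G \<zeta>)) = (LINT \<zeta>:A|torus n. 0)"
      by (simp add: set0[OF A] set_lebesgue_integral_def)
  qed (use int in auto)
  ultimately show ?thesis by eventually_elim (simp add: complex_eq_iff)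
qed

section \<open>Invariant subspaces are invariant under all bounded multipliers\<close>

lemma invariant_subspaceD:
  assumes "invariant_subspace n M"
  shows "M \<subseteq> H2 n" "(\<lambda>z\<in>polydisc n. 0) \<in> M"
    "\<And>f g. f \<in> M \<Longrightarrow> g \<in> M \<Longrightarrow> (\<lambda>z\<in>polydisc n. f z + g z) \<in> M"
    "\<And>a f. f \<in> M \<Longrightarrow> (\<lambda>z\<in>polydisc n. a * f z) \<in> M"
    "\<And>X f. f \<in> H2 n \<Longrightarrow> (\<And>k. X k \<in> M) \<Longrightarrow> H2_tendsto n X f \<Longrightarrow> f \<in> M"
    "\<And>i f. i < n \<Longrightarrow> f \<in> M \<Longrightarrow> (\<lambda>z\<in>polydisc n. z i * f z) \<in> M"
  using assms unfolding invariant_subspace_def closed_subspace_def by blast+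

text \<open>Invariance under the coordinates, iterated.\<close>

lemma invariant_subspace_polynomial_mult:
  assumes M: "invariant_subspace n M" and F: "F \<in> M" and A: "finite A"
  shows "(\<lambda>z\<in>polydisc n. (\<Sum>\<alpha>\<in>A. c \<alpha> * mon n \<alpha> z) * F z) \<in> M"
proof -
  note D = invariant_subspaceD[OF M]
  have ext: "(\<lambda>z\<in>polydisc n. G z) = G" if "G \<in> M" for G
    using H2_holomorphic[of G n] D(1) that by (intro extensional_restrict) (auto simp: holomorphic_polydisc_def)
  have pow: "(\<lambda>z\<in>polydisc n. z i ^ k * G z) \<in> M" if i: "i < n" and G: "G \<in> M" for i k G
  proof (induction k)
    case 0
    then show ?case using ext[OF G] G by simp
  next
    case (Suc k)
    have "(\<lambda>z\<in>polydisc n. z i * (\<lambda>z\<in>polydisc n. z i ^ k * G z) z) = (\<lambda>z\<in>polydisc n. z i ^ Suc k * G z)"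
      by (rule restrict_ext) simp
    with D(6)[OF i Suc] show ?case by metis
  qed
  have mono: "(\<lambda>z\<in>polydisc n. (\<Prod>i<m. z i ^ \<alpha> i) * F z) \<in> M" if "m \<le> n" for m \<alpha>
    using that
  proof (induction m)
    case 0
    then show ?case using ext[OF F] F by simp
  next
    case (Suc m)
    have "(\<lambda>z\<in>polydisc n. z m ^ \<alpha> m * (\<lambda>z\<in>polydisc n. (\<Prod>i<m. z i ^ \<alpha> i) * F z) z) = (\<lambda>z\<in>polydisc n. (\<Prod>i<Suc m. z i ^ \<alpha> i) * F z)"
      by (rule restrict_ext) (simp add: mult_ac)
    moreover have "(\<lambda>z\<in>polydisc n. z m ^ \<alpha> m * (\<lambda>z\<in>polydisc n. (\<Prod>i<m. z i ^ \<alpha> i) * F z) z) \<in> M"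
      by (rule pow) (use Suc in auto)
    ultimately show ?case by metis
  qed
  show ?thesis
    using A
  proof (induction A rule: finite_induct)
    case empty
    have "(\<lambda>z\<in>polydisc n. (\<Sum>\<alpha>\<in>{}. c \<alpha> * mon n \<alpha> z) * F z) = (\<lambda>z\<in>polydisc n. 0)"
      by (rule restrict_ext) simp
    with D(2) show ?case by metis
  next
    case (insert \<alpha> A)
    have "(\<lambda>z\<in>polydisc n. (\<lambda>z\<in>polydisc n. c \<alpha> * (\<lambda>z\<in>polydisc n. mon n \<alpha> z * F z) z) z + (\<lambda>z\<in>polydisc n. (\<Sum>\<alpha>\<in>A. c \<alpha> * mon n \<alpha> z) * F z) z) =
        (\<lambda>z\<in>polydisc n. (\<Sum>\<alpha>\<in>insert \<alpha> A. c \<alpha> * mon n \<alpha> z) * F z)"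
      using insert.hyps by (intro restrict_ext) (simp add: algebra_simps)
    with D(3)[OF D(4)[OF mono[OF order_refl, of \<alpha>], of "c \<alpha>"] insert.IH] show ?case by metis
  qed
qed

text \<open>Polynomials \<open>q k\<close> are chosen uniformly close to the dilations of \<open>\<phi>\<close> by \<open>radius k\<close>. On the
  torus they are uniformly bounded and converge almost everywhere to the boundary function of \<open>\<phi>\<close>, so
  that \<open>q k * F\<close> tends to \<open>\<phi> * F\<close> in norm by dominated convergence.\<close>

theorem invariant_subspace_Hinf_mult:
  assumes M: "invariant_subspace n M" and \<phi>: "\<phi> \<in> Hinf n" and F: "F \<in> M"
  shows "(\<lambda>z\<in>polydisc n. \<phi> z * F z) \<in> M"
proof -
  note D = invariant_subspaceD[OF M]
  have F2: "F \<in> H2 n" using D(1) F by blast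
  have \<phi>2: "\<phi> \<in> H2 n" by (rule Hinf_subset_H2[OF \<phi>])
  note ps = H2_sum[OF \<phi>2]
  obtain C where C: "C \<ge> 0" "\<And>z. z \<in> polydisc n \<Longrightarrow> cmod (\<phi> z) \<le> C" by (rule Hinf_bound[OF \<phi>]) blast
  define c where "c = power_coeff n \<phi>"
  have "\<exists>A. finite A \<and> (\<forall>\<zeta>\<in>space (torus n). dist (\<Sum>\<alpha>\<in>A. c \<alpha> * mon n \<alpha> (dil n (of_real (radius k)) \<zeta>)) (\<phi> (dil n (of_real (radius k)) \<zeta>)) < 1 / real (Suc k))" for k
  proof -
    have "uniform_limit (space (torus n)) (\<lambda>A \<zeta>. \<Sum>\<alpha>\<in>A. c \<alpha> * mon n \<alpha> (dil n (of_real (radius k)) \<zeta>)) (\<lambda>\<zeta>. \<phi> (dil n (of_real (radius k)) \<zeta>)) (finite_subsets_at_top (multiindices n))"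
      unfolding c_def
    proof (rule power_series_uniform[OF ps radius_bounds(2,3)])
      fix \<zeta> assume "\<zeta> \<in> space (torus n)"
      then show "\<exists>\<zeta>' w. dil n (complex_of_real (radius k)) \<zeta> = dil n w \<zeta>' \<and> cmod w \<le> radius k \<and> \<zeta>' \<in> closed_polydisc n"
        using torus_subset_closed_polydisc radius_bounds(2)[of k] by (intro exI[of _ \<zeta>] exI[of _ "of_real (radius k)"]) auto
    qed
    then have "\<forall>\<^sub>F A in finite_subsets_at_top (multiindices n). \<forall>\<zeta>\<in>space (torus n). dist (\<Sum>\<alpha>\<in>A. c \<alpha> * mon n \<alpha> (dil n (of_real (radius k)) \<zeta>)) (\<phi> (dil n (of_real (radius k)) \<zeta>)) < 1 / real (Suc k)"
      unfolding uniform_limit_iff by simp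
    moreover have "\<forall>\<^sub>F A in finite_subsets_at_top (multiindices n). finite A"
      by (rule eventually_finite_subsets_at_top_weakI) auto
    ultimately have "\<forall>\<^sub>F A in finite_subsets_at_top (multiindices n). finite A \<and> (\<forall>\<zeta>\<in>space (torus n). dist (\<Sum>\<alpha>\<in>A. c \<alpha> * mon n \<alpha> (dil n (of_real (radius k)) \<zeta>)) (\<phi> (dil n (of_real (radius k)) \<zeta>)) < 1 / real (Suc k))"
      by eventually_elim auto
    then show ?thesis by (rule eventually_happens'[rotated]) simp
  qed
  then have "\<forall>k. \<exists>A. finite A \<and> (\<forall>\<zeta>\<in>space (torus n). dist (\<Sum>\<alpha>\<in>A. c \<alpha> * mon n \<alpha> (dil n (of_real (radius k)) \<zeta>)) (\<phi> (dil n (of_real (radius k)) \<zeta>)) < 1 / real (Suc k))"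
    by blast
  from choice[OF this] obtain A where A: "\<And>k. finite (A k)"
    "\<And>k \<zeta>. \<zeta> \<in> space (torus n) \<Longrightarrow> dist (\<Sum>\<alpha>\<in>A k. c \<alpha> * mon n \<alpha> (dil n (of_real (radius k)) \<zeta>)) (\<phi> (dil n (of_real (radius k)) \<zeta>)) < 1 / real (Suc k)"
    by blast
  define q where "q k z = (\<Sum>\<alpha>\<in>A k. (c \<alpha> * of_real (radius k) ^ deg n \<alpha>) * mon n \<alpha> z)" for k z
  have q: "dist (q k \<zeta>) (\<phi> (dil n (of_real (radius k)) \<zeta>)) < 1 / real (Suc k)" if "\<zeta> \<in> space (torus n)" for k \<zeta>
    using A(2)[OF that, of k] unfolding q_def mon_dil by (simp add: mult.assoc)
  define X where "X k = (\<lambda>z\<in>polydisc n. q k z * F z)" for k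
  have XM: "X k \<in> M" for k
    unfolding X_def q_def by (rule invariant_subspace_polynomial_mult[OF M F A(1)])
  define d where "d k = (\<lambda>z\<in>polydisc n. (\<lambda>z\<in>polydisc n. q k z) z + (\<lambda>z\<in>polydisc n. (\<lambda>z\<in>polydisc n. -1) z * \<phi> z) z)" for k
  have qH: "(\<lambda>z\<in>polydisc n. q k z) \<in> Hinf n" for k
    unfolding q_def by (rule Hinf_polynomial[OF A(1)])
  have mH: "(\<lambda>z\<in>polydisc n. (\<lambda>z\<in>polydisc n. -1) z * \<phi> z) \<in> Hinf n"
    by (rule Hinf_mult[OF Hinf_const \<phi>])
  have dH: "d k \<in> Hinf n" for k unfolding d_def by (rule Hinf_add[OF qH mH])
  have Xd: "(\<lambda>z\<in>polydisc n. X k z - (\<lambda>z\<in>polydisc n. \<phi> z * F z) z) = (\<lambda>z\<in>polydisc n. d k z * F z)" for k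
    by (rule restrict_ext) (simp add: X_def d_def algebra_simps)
  have bd: "AE \<zeta> in torus n. bdry n (\<lambda>z\<in>polydisc n. d k z * F z) \<zeta> = (q k \<zeta> - bdry n \<phi> \<zeta>) * bdry n F \<zeta>" for k
    using bdry_mult[OF Hinf_subset_H2[OF dH[of k]] F2] AE_space
      bdry_add[OF Hinf_subset_H2[OF qH[of k]] Hinf_subset_H2[OF mH]]
      bdry_mult[OF H2_const[of "-1" n] \<phi>2]
  proof eventually_elim
    case (elim \<zeta>)
    have "bdry n (\<lambda>z\<in>polydisc n. -1) \<zeta> = -1"
      by (rule bdry_restrict_eqI[OF elim(2)]) simp
    moreover have "bdry n (\<lambda>z\<in>polydisc n. q k z) \<zeta> = q k \<zeta>"
      unfolding q_def by (rule bdry_polynomial[OF elim(2)])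
    ultimately show ?case using elim by (simp add: d_def)
  qed
  have \<phi>F: "(\<lambda>z\<in>polydisc n. \<phi> z * F z) \<in> H2 n" by (rule H2_Hinf_mult[OF \<phi> F2])
  have conv: "AE \<zeta> in torus n. (\<lambda>k. q k \<zeta>) \<longlonglongrightarrow> bdry n \<phi> \<zeta>"
    using AE_space AE_bdry_tendsto[OF \<phi>2]
  proof eventually_elim
    case (elim \<zeta>)
    have "(\<lambda>k. dist (q k \<zeta>) (\<phi> (dil n (of_real (radius k)) \<zeta>))) \<longlonglongrightarrow> 0"
    proof (rule tendsto_sandwich)
      show "(\<lambda>k. 0) \<longlonglongrightarrow> (0::real)" by simp
      show "(\<lambda>k. 1 / real (Suc k)) \<longlonglongrightarrow> 0" by real_asymp
    qed (use q[OF elim(1)] in \<open>auto intro!: always_eventually less_imp_le\<close>)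
    then have "(\<lambda>k. q k \<zeta> - \<phi> (dil n (of_real (radius k)) \<zeta>)) \<longlonglongrightarrow> 0"
      by (simp add: dist_norm tendsto_norm_zero_iff)
    from tendsto_add[OF this elim(2)] show ?case by simp
  qed
  have qC: "cmod (q k \<zeta>) \<le> C + 1" if \<zeta>: "\<zeta> \<in> space (torus n)" for k \<zeta>
  proof -
    have "cmod (\<phi> (dil n (of_real (radius k)) \<zeta>)) \<le> C"
      by (intro C(2) dil_torus_polydisc \<zeta>) (simp add: radius_bounds)
    moreover have "1 / real (Suc k) \<le> 1" by simp
    ultimately show ?thesis
      using q[OF \<zeta>, of k] norm_triangle_sub[of "q k \<zeta>" "\<phi> (dil n (of_real (radius k)) \<zeta>)"]
      unfolding dist_norm by linarith
  qed
  have lim2: "(\<lambda>k. LINT \<zeta>|torus n. (cmod ((q k \<zeta> - bdry n \<phi> \<zeta>) * bdry n F \<zeta>))\<^sup>2) \<longlonglongrightarrow> (LINT \<zeta>|torus n. 0)"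
  proof (rule integral_dominated_convergence[where w="\<lambda>\<zeta>. (2 * C + 2)\<^sup>2 * (cmod (bdry n F \<zeta>))\<^sup>2"])
    have [measurable]: "bdry n F \<in> borel_measurable (torus n)" "bdry n \<phi> \<in> borel_measurable (torus n)"
      by (intro bdry_measurable H2_holomorphic F2 \<phi>2)+
    have [measurable]: "q k \<in> borel_measurable (torus n)" for k unfolding q_def by measurable
    show "(\<lambda>\<zeta>. (cmod ((q k \<zeta> - bdry n \<phi> \<zeta>) * bdry n F \<zeta>))\<^sup>2) \<in> borel_measurable (torus n)" for k by measurable
    show "integrable (torus n) (\<lambda>\<zeta>. (2 * C + 2)\<^sup>2 * (cmod (bdry n F \<zeta>))\<^sup>2)"
      using H2_square_integrable[OF F2] by simp
    show "AE \<zeta> in torus n. (\<lambda>k. (cmod ((q k \<zeta> - bdry n \<phi> \<zeta>) * bdry n F \<zeta>))\<^sup>2) \<longlonglongrightarrow> 0"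
      using conv
    proof eventually_elim
      case (elim \<zeta>)
      have "(\<lambda>k. (cmod ((q k \<zeta> - bdry n \<phi> \<zeta>) * bdry n F \<zeta>))\<^sup>2) \<longlonglongrightarrow> (cmod ((bdry n \<phi> \<zeta> - bdry n \<phi> \<zeta>) * bdry n F \<zeta>))\<^sup>2"
        by (intro tendsto_intros elim)
      then show ?case by simp
    qed
    show "AE \<zeta> in torus n. norm ((cmod ((q k \<zeta> - bdry n \<phi> \<zeta>) * bdry n F \<zeta>))\<^sup>2) \<le> (2 * C + 2)\<^sup>2 * (cmod (bdry n F \<zeta>))\<^sup>2" for k
      using AE_space conv
    proof eventually_elim
      case (elim \<zeta>)
      have "cmod (bdry n \<phi> \<zeta>) \<le> C + 1"
        using tendsto_norm[OF elim(2)] qC[OF elim(1)] by (intro LIMSEQ_le_const2) auto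
      then have "cmod (q k \<zeta> - bdry n \<phi> \<zeta>) \<le> 2 * C + 2"
        using qC[OF elim(1), of k] norm_triangle_ineq4[of "q k \<zeta>" "bdry n \<phi> \<zeta>"] by linarith
      then have "(cmod (q k \<zeta> - bdry n \<phi> \<zeta>))\<^sup>2 \<le> (2 * C + 2)\<^sup>2" by (rule power_mono) simp
      then show ?case by (simp add: norm_mult power_mult_distrib mult_right_mono)
    qed
  qed auto
  have "(\<lambda>k. (H2_norm n (\<lambda>z\<in>polydisc n. d k z * F z))\<^sup>2) \<longlonglongrightarrow> 0"
  proof -
    have "(H2_norm n (\<lambda>z\<in>polydisc n. d k z * F z))\<^sup>2 = (LINT \<zeta>|torus n. (cmod ((q k \<zeta> - bdry n \<phi> \<zeta>) * bdry n F \<zeta>))\<^sup>2)" for k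
    proof -
      have dF: "(\<lambda>z\<in>polydisc n. d k z * F z) \<in> H2 n" by (rule H2_Hinf_mult[OF dH F2])
      have [measurable]: "bdry n F \<in> borel_measurable (torus n)" "bdry n \<phi> \<in> borel_measurable (torus n)"
        by (intro bdry_measurable H2_holomorphic F2 \<phi>2)+
      have [measurable]: "q k \<in> borel_measurable (torus n)" unfolding q_def by measurable
      show ?thesis
        unfolding H2_norm_bdry[OF dF]
      proof (rule integral_cong_AE)
        show "(\<lambda>\<zeta>. (cmod (bdry n (\<lambda>z\<in>polydisc n. d k z * F z) \<zeta>))\<^sup>2) \<in> borel_measurable (torus n)"
          by (intro borel_measurable_power measurable_compose[OF bdry_measurable[OF H2_holomorphic[OF dF]] borel_measurable_norm])
        show "(\<lambda>\<zeta>. (cmod ((q k \<zeta> - bdry n \<phi> \<zeta>) * bdry n F \<zeta>))\<^sup>2) \<in> borel_measurable (torus n)"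
          by measurable
        show "AE \<zeta> in torus n. (cmod (bdry n (\<lambda>z\<in>polydisc n. d k z * F z) \<zeta>))\<^sup>2 =
            (cmod ((q k \<zeta> - bdry n \<phi> \<zeta>) * bdry n F \<zeta>))\<^sup>2"
          using bd[of k] by eventually_elim simp
      qed
    qed
    with lim2 show ?thesis by simp
  qed
  then have "(\<lambda>k. sqrt ((H2_norm n (\<lambda>z\<in>polydisc n. d k z * F z))\<^sup>2)) \<longlonglongrightarrow> sqrt 0"
    by (intro tendsto_real_sqrt)
  then have "(\<lambda>k. H2_norm n (\<lambda>z\<in>polydisc n. d k z * F z)) \<longlonglongrightarrow> 0"
    by (simp add: H2_norm_def infsum_nonneg)
  then have "H2_tendsto n X (\<lambda>z\<in>polydisc n. \<phi> z * F z)"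
    unfolding H2_tendsto_def Xd .
  from D(5)[OF \<phi>F XM this] show ?thesis .
qed

section \<open>Functions of the first variables\<close>

lemma integral_torus_Suc:
  fixes f :: "(nat \<Rightarrow> complex) \<Rightarrow> complex"
  assumes "integrable (torus (Suc m)) f"
  shows "(LINT \<zeta>|torus (Suc m). f \<zeta>) = (LINT \<zeta>|torus m. LINT w|circle. f (\<zeta>(m := w)))"
proof -
  interpret product_sigma_finite "\<lambda>_::nat. circle" by (rule product_sigma_finite_circle)
  show ?thesis
    using assms unfolding torus_def lessThan_Suc by (intro product_integral_insert) auto
qed

lemma measurable_restrict_torus: "(\<lambda>\<zeta>. restrict \<zeta> {..<m}) \<in> torus (Suc m) \<rightarrow>\<^sub>M torus m"
  unfolding torus_def by (rule measurable_restrict_subset) auto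

lemma AE_restrict_torus:
  assumes "AE \<zeta> in torus m. P \<zeta>"
  shows "AE \<zeta> in torus (Suc m). P (restrict \<zeta> {..<m})"
proof -
  interpret product_prob_space "\<lambda>_::nat. circle" "{..<Suc m}"
  proof -
    interpret prob_space circle by (rule prob_space_circle)
    show "product_prob_space (\<lambda>_::nat. circle)" by unfold_locales
  qed
  have "distr (torus (Suc m)) (torus m) (\<lambda>\<zeta>. restrict \<zeta> {..<m}) = torus m"
    unfolding torus_def by (rule distr_restrict[symmetric]) auto
  then have "AE \<zeta> in distr (torus (Suc m)) (torus m) (\<lambda>\<zeta>. restrict \<zeta> {..<m}). P \<zeta>"
    using assms by (simp only:)
  then show ?thesis by (rule AE_distrD[OF measurable_restrict_torus])
qed

lemma upd_torus_Suc: "\<zeta> \<in> space (torus (Suc m)) \<Longrightarrow> cmod w = 1 \<Longrightarrow> \<zeta>(m := w) \<in> space (torus (Suc m))"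
  by (auto simp: space_torus PiE_iff extensional_def)

lemma restrict_upd: "\<zeta> \<in> space (torus m) \<Longrightarrow> restrict (\<zeta>(m := w)) {..<m} = \<zeta>"
  by (auto simp: space_torus PiE_iff extensional_def fun_eq_iff)

lemma mon_upd: "mon (Suc m) \<alpha> (\<zeta>(m := w)) = mon m \<alpha> \<zeta> * w ^ \<alpha> m"
  by simp

text \<open>A function of the first \<open>m\<close> variables as a function of \<open>m + 1\<close> variables.\<close>

definition lift :: "nat \<Rightarrow> ((nat \<Rightarrow> complex) \<Rightarrow> complex) \<Rightarrow> (nat \<Rightarrow> complex) \<Rightarrow> complex"
  where "lift m f = (\<lambda>z\<in>polydisc (Suc m). f (restrict z {..<m}))"

lemma restrict_polydisc: "z \<in> polydisc (Suc m) \<Longrightarrow> restrict z {..<m} \<in> polydisc m"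
  by (simp add: in_polydisc)

lemma lift_Hinf:
  assumes f: "f \<in> Hinf m"
  shows "lift m f \<in> Hinf (Suc m)"
proof -
  have hf: "holomorphic_polydisc m f" using f by (simp add: Hinf_def)
  obtain C where C: "C \<ge> 0" "\<And>z. z \<in> polydisc m \<Longrightarrow> cmod (f z) \<le> C" by (rule Hinf_bound[OF f]) blast
  show ?thesis
  proof (rule HinfI)
    show "cmod (lift m f z) \<le> C" if "z \<in> polydisc (Suc m)" for z
      using C(2)[OF restrict_polydisc[OF that]] that by (simp add: lift_def)
    show "holomorphic_polydisc (Suc m) (lift m f)"
      unfolding holomorphic_polydisc_def
    proof (intro conjI ballI allI impI)
      show "lift m f \<in> extensional (polydisc (Suc m))" by (simp add: lift_def)
      have r: "continuous_on X (\<lambda>z. restrict z {..<m})" for X :: "(nat \<Rightarrow> complex) set"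
      proof (rule continuous_on_coordinatewise_then_product)
        fix i show "continuous_on X (\<lambda>z. restrict z {..<m} i)" by (cases "i < m") auto
      qed
      have "continuous_on (polydisc (Suc m)) (\<lambda>z. f (restrict z {..<m}))"
        by (rule continuous_on_compose2[OF _ r]) (use hf restrict_polydisc in \<open>auto simp: holomorphic_polydisc_def\<close>)
      then show "continuous_on (polydisc (Suc m)) (lift m f)"
        by (subst continuous_on_cong[OF refl, of _ _ "\<lambda>z. f (restrict z {..<m})"]) (auto simp: lift_def)
      fix z i assume z: "z \<in> polydisc (Suc m)" and i: "i < Suc m"
      have zw: "z(i := w) \<in> polydisc (Suc m)" if "w \<in> ball 0 1" for w
        using z i that by (auto simp: in_polydisc extensional_def)
      have "(\<lambda>w. f (restrict (z(i := w)) {..<m})) holomorphic_on ball 0 1"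
      proof (cases "i = m")
        case True
        then have "restrict (z(i := w)) {..<m} = restrict z {..<m}" for w by (auto simp: fun_eq_iff)
        then show ?thesis by simp
      next
        case False
        then have "restrict (z(i := w)) {..<m} = (restrict z {..<m})(i := w)" for w
          using i by (auto simp: fun_eq_iff)
        then show ?thesis using hf False i restrict_polydisc[OF z] by (simp add: holomorphic_polydisc_def del: fun_upd_apply)
      qed
      then show "(\<lambda>w. lift m f (z(i := w))) holomorphic_on ball 0 1"
        by (subst holomorphic_cong[OF refl, of _ _ "\<lambda>w. f (restrict (z(i := w)) {..<m})"]) (use zw in \<open>auto simp: lift_def simp del: fun_upd_apply\<close>)
    qed
  qed
qed

lemma bdry_lift:
  assumes "\<zeta> \<in> space (torus (Suc m))"
  shows "bdry (Suc m) (lift m f) \<zeta> = bdry m f (restrict \<zeta> {..<m})"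
proof -
  have "restrict (dil (Suc m) c \<zeta>) {..<m} = dil m c (restrict \<zeta> {..<m})" for c
    by (auto simp: dil_def fun_eq_iff)
  then have "lift m f (dil (Suc m) (of_real (radius j)) \<zeta>) = f (dil m (of_real (radius j)) (restrict \<zeta> {..<m}))" for j
    using assms by (simp add: lift_def radius_bounds)
  then show ?thesis by (simp add: bdry_def)
qed

text \<open>The inverse boundary function is bounded almost everywhere; it is truncated so as to be bounded
  everywhere.\<close>

lemma bounded_inverse_lift:
  assumes f: "f \<in> Hinf m" and inv: "inverse_in_Linf m f"
  obtains b C where "b \<in> borel_measurable (torus m)" "\<And>\<zeta>. cmod (b \<zeta>) \<le> C"
    "AE \<zeta> in torus (Suc m). bdry (Suc m) (lift m f) \<zeta> * b (restrict \<zeta> {..<m}) = 1"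
proof -
  obtain C where C: "AE \<zeta> in torus m. cmod (1 / boundary_fun m f \<zeta>) \<le> C"
    and nz: "AE \<zeta> in torus m. boundary_fun m f \<zeta> \<noteq> 0"
    using inv by (auto simp: inverse_in_Linf_def Linf_def)
  define b where "b \<zeta> = (if cmod (1 / bdry m f \<zeta>) \<le> C then 1 / bdry m f \<zeta> else 0)" for \<zeta>
  have f2: "f \<in> H2 m" by (rule Hinf_subset_H2[OF f])
  have [measurable]: "bdry m f \<in> borel_measurable (torus m)" by (rule bdry_measurable[OF H2_holomorphic[OF f2]])
  have "AE \<zeta> in torus m. bdry m f \<zeta> * b \<zeta> = 1"
    using C nz AE_boundary_fun[OF f2] by eventually_elim (simp add: b_def)
  from AE_restrict_torus[OF this] AE_space
  have "AE \<zeta> in torus (Suc m). bdry (Suc m) (lift m f) \<zeta> * b (restrict \<zeta> {..<m}) = 1"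
    by eventually_elim (simp add: bdry_lift)
  moreover have "b \<in> borel_measurable (torus m)" unfolding b_def by measurable
  moreover have "cmod (b \<zeta>) \<le> max 0 C" for \<zeta> unfolding b_def by (auto simp: le_max_iff_disj)
  ultimately show ?thesis using that by blast
qed

section \<open>Functions analytic and antianalytic in the last variable\<close>

text \<open>In the last variable the integrand is a function holomorphic on the disc times a positive power of
  that variable, up to a factor that does not depend on it. By the mean value property the inner
  integral vanishes.\<close>

lemma analytic_coeff_zero:
  assumes \<phi>: "holomorphic_polydisc (Suc m) \<phi>" and r: "0 \<le> r" "r < 1"
    and b [measurable]: "b \<in> borel_measurable (torus m)" and C: "\<And>\<zeta>. cmod (b \<zeta>) \<le> C"
    and ab: "\<beta> m < \<alpha> m"
  shows "(LINT \<zeta>|torus (Suc m). \<phi> (dil (Suc m) (of_real r) \<zeta>) * b (restrict \<zeta> {..<m}) * (mon (Suc m) \<alpha> \<zeta> * cnj (mon (Suc m) \<beta> \<zeta>))) = 0"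
proof -
  let ?n = "Suc m"
  have cont: "continuous_on (space (torus ?n)) (\<lambda>\<zeta>. \<phi> (dil ?n (of_real r) \<zeta>))"
    using \<phi> r by (intro continuous_on_subset[OF continuous_on_dil_torus torus_subset_closed_polydisc]) (auto simp: holomorphic_polydisc_def)
  have bm: "(\<lambda>\<zeta>. b (restrict \<zeta> {..<m})) \<in> borel_measurable (torus ?n)"
    by (rule measurable_compose[OF measurable_restrict_torus b])
  have int: "integrable (torus ?n) (\<lambda>\<zeta>. \<phi> (dil ?n (of_real r) \<zeta>) * b (restrict \<zeta> {..<m}) * (mon ?n \<alpha> \<zeta> * cnj (mon ?n \<beta> \<zeta>)))"
    by (intro integrable_mult_monomials integrable_mult_bounded[OF integrable_torus_continuous[OF cont] bm C])
  have inner: "(LINT w|circle. \<phi> (dil ?n (of_real r) (\<zeta>(m := w))) * b (restrict (\<zeta>(m := w)) {..<m}) * (mon ?n \<alpha> (\<zeta>(m := w)) * cnj (mon ?n \<beta> (\<zeta>(m := w))))) = 0"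
    if \<zeta>: "\<zeta> \<in> space (torus m)" for \<zeta>
  proof -
    define K where "K = b \<zeta> * (mon m \<alpha> \<zeta> * cnj (mon m \<beta> \<zeta>))"
    define g where "g w = \<phi> (dil ?n (of_real r) (\<zeta>(m := w))) * w ^ (\<alpha> m - \<beta> m)" for w
    have "\<zeta>(m := 0) \<in> closed_polydisc ?n"
      using \<zeta> by (auto simp: space_torus PiE_iff in_closed_polydisc extensional_def less_Suc_eq)
    from dil_slice[OF \<phi> this _ r, of m]
    have g: "continuous_on (cball 0 1) g" "g holomorphic_on ball 0 1"
      unfolding g_def by (auto intro!: continuous_intros holomorphic_intros simp del: fun_upd_apply)
    have "(LINT w|circle. \<phi> (dil ?n (of_real r) (\<zeta>(m := w))) * b (restrict (\<zeta>(m := w)) {..<m}) * (mon ?n \<alpha> (\<zeta>(m := w)) * cnj (mon ?n \<beta> (\<zeta>(m := w))))) =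
      (LINT w|circle. K * g w)"
    proof (rule Bochner_Integration.integral_cong)
      fix w assume "w \<in> space circle"
      then have "(w * cnj w) ^ \<beta> m = 1" by (simp add: complex_norm_square[symmetric])
      moreover have "w ^ \<alpha> m * cnj (w ^ \<beta> m) = (w * cnj w) ^ \<beta> m * w ^ (\<alpha> m - \<beta> m)"
        using power_add[of w "\<beta> m" "\<alpha> m - \<beta> m"] ab by (simp add: power_mult_distrib mult_ac)
      ultimately have e: "w ^ \<alpha> m * cnj (w ^ \<beta> m) = w ^ (\<alpha> m - \<beta> m)" by simp
      have "mon ?n \<alpha> (\<zeta>(m := w)) * cnj (mon ?n \<beta> (\<zeta>(m := w))) = (mon m \<alpha> \<zeta> * cnj (mon m \<beta> \<zeta>)) * (w ^ \<alpha> m * cnj (w ^ \<beta> m))"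
        unfolding mon_upd complex_cnj_mult by (simp only: mult_ac)
      then show "\<phi> (dil ?n (of_real r) (\<zeta>(m := w))) * b (restrict (\<zeta>(m := w)) {..<m}) * (mon ?n \<alpha> (\<zeta>(m := w)) * cnj (mon ?n \<beta> (\<zeta>(m := w)))) = K * g w"
        unfolding e restrict_upd[OF \<zeta>] K_def g_def by (simp only: mult_ac)
    qed simp
    also have "\<dots> = K * g 0" by (simp add: circle_mean_value[OF g])
    also have "\<dots> = 0" using ab by (simp add: g_def)
    finally show ?thesis .
  qed
  show ?thesis
    unfolding integral_torus_Suc[OF int]
    by (subst Bochner_Integration.integral_cong[OF refl inner]) auto
qed

text \<open>The function \<open>h\<close> inherits from \<open>\<phi>\<close> that it has no negative frequencies in the last variable, since
  the other factor does not depend on that variable. The dilations of \<open>\<phi>\<close> reduce this to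
  \<open>analytic_coeff_zero\<close>.\<close>

lemma quotient_coeff_zero:
  assumes h [measurable]: "h \<in> borel_measurable (torus (Suc m))"
    and \<phi>: "\<phi> \<in> H2 (Suc m)"
    and b [measurable]: "b \<in> borel_measurable (torus m)" and C: "\<And>\<zeta>. cmod (b \<zeta>) \<le> C"
    and ae: "AE \<zeta> in torus (Suc m). h \<zeta> = bdry (Suc m) \<phi> \<zeta> * b (restrict \<zeta> {..<m})"
    and ab: "\<beta> m < \<alpha> m"
  shows "(LINT \<zeta>|torus (Suc m). h \<zeta> * (mon (Suc m) \<alpha> \<zeta> * cnj (mon (Suc m) \<beta> \<zeta>))) = 0"
proof -
  let ?n = "Suc m"
  let ?c = "\<lambda>\<zeta>. mon ?n \<alpha> \<zeta> * cnj (mon ?n \<beta> \<zeta>)"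
  interpret prob_space "torus ?n" by (rule prob_space_torus)
  note h\<phi> = H2_holomorphic[OF \<phi>]
  have C0: "C \<ge> 0" using order_trans[OF norm_ge_zero C] .
  have bm [measurable]: "(\<lambda>\<zeta>. b (restrict \<zeta> {..<m})) \<in> borel_measurable (torus ?n)"
    by (rule measurable_compose[OF measurable_restrict_torus b])
  have [measurable]: "bdry ?n \<phi> \<in> borel_measurable (torus ?n)" by (rule bdry_measurable[OF h\<phi>])
  have [measurable]: "(\<lambda>\<zeta>. \<phi> (dil ?n (of_real (radius j)) \<zeta>)) \<in> borel_measurable (torus ?n)" for j
    by (rule holomorphic_dil_measurable[OF h\<phi> radius_bounds(2,3)])
  have cm [measurable]: "?c \<in> borel_measurable (torus ?n)" by (rule borel_measurable_character)
  obtain w where w: "integrable (torus ?n) w" "\<And>\<zeta>. w \<zeta> \<ge> 0"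
    "AE \<zeta> in torus ?n. \<forall>j. (cmod (\<phi> (dil ?n (of_real (radius j)) \<zeta>)))\<^sup>2 \<le> w \<zeta>"
    by (rule H2_dominated[OF \<phi>]) blast
  have "(LINT \<zeta>|torus ?n. h \<zeta> * ?c \<zeta>) = (LINT \<zeta>|torus ?n. bdry ?n \<phi> \<zeta> * b (restrict \<zeta> {..<m}) * ?c \<zeta>)"
  proof (rule integral_cong_AE)
    show "(\<lambda>\<zeta>. h \<zeta> * ?c \<zeta>) \<in> borel_measurable (torus ?n)"
      by (rule borel_measurable_times[OF h cm])
    show "(\<lambda>\<zeta>. bdry ?n \<phi> \<zeta> * b (restrict \<zeta> {..<m}) * ?c \<zeta>) \<in> borel_measurable (torus ?n)"
      by (intro borel_measurable_times bdry_measurable h\<phi> bm cm)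
    show "AE \<zeta> in torus ?n. h \<zeta> * ?c \<zeta> = bdry ?n \<phi> \<zeta> * b (restrict \<zeta> {..<m}) * ?c \<zeta>"
      using ae by eventually_elim (simp only:)
  qed
  also have "\<dots> = 0"
  proof (rule LIMSEQ_unique)
    show "(\<lambda>j. LINT \<zeta>|torus ?n. \<phi> (dil ?n (of_real (radius j)) \<zeta>) * b (restrict \<zeta> {..<m}) * ?c \<zeta>) \<longlonglongrightarrow>
      (LINT \<zeta>|torus ?n. bdry ?n \<phi> \<zeta> * b (restrict \<zeta> {..<m}) * ?c \<zeta>)"
    proof (rule integral_dominated_convergence[where w="\<lambda>\<zeta>. (1 + w \<zeta>) * C"])
      show "(\<lambda>\<zeta>. bdry ?n \<phi> \<zeta> * b (restrict \<zeta> {..<m}) * ?c \<zeta>) \<in> borel_measurable (torus ?n)"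
        by (intro borel_measurable_times bdry_measurable h\<phi> bm cm)
      show "(\<lambda>\<zeta>. \<phi> (dil ?n (of_real (radius j)) \<zeta>) * b (restrict \<zeta> {..<m}) * ?c \<zeta>) \<in> borel_measurable (torus ?n)" for j
        by (intro borel_measurable_times holomorphic_dil_measurable[OF h\<phi> radius_bounds(2,3)] bm cm)
      show "integrable (torus ?n) (\<lambda>\<zeta>. (1 + w \<zeta>) * C)" using w(1) by simp
      show "AE \<zeta> in torus ?n. (\<lambda>j. \<phi> (dil ?n (of_real (radius j)) \<zeta>) * b (restrict \<zeta> {..<m}) * ?c \<zeta>) \<longlonglongrightarrow>
        bdry ?n \<phi> \<zeta> * b (restrict \<zeta> {..<m}) * ?c \<zeta>"
        using AE_bdry_tendsto[OF \<phi>] by eventually_elim (intro tendsto_mult tendsto_const)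
      show "AE \<zeta> in torus ?n. cmod (\<phi> (dil ?n (of_real (radius j)) \<zeta>) * b (restrict \<zeta> {..<m}) * ?c \<zeta>) \<le> (1 + w \<zeta>) * C" for j
        using w(3) AE_space
      proof eventually_elim
        case (elim \<zeta>)
        let ?x = "cmod (\<phi> (dil ?n (of_real (radius j)) \<zeta>))"
        have "?x \<le> 1 + ?x\<^sup>2" using mult_le_sum_squares[of ?x 1] by simp
        also have "\<dots> \<le> 1 + w \<zeta>" using elim(1) by simp
        finally have "?x * cmod (b (restrict \<zeta> {..<m})) \<le> (1 + w \<zeta>) * C"
          using C by (intro mult_mono) (auto simp: w(2))
        then show ?case
          unfolding norm_mult[of "_ * _" "?c \<zeta>"] norm_character[OF elim(2)] by (simp add: norm_mult)
      qed
    qed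
    show "(\<lambda>j. LINT \<zeta>|torus ?n. \<phi> (dil ?n (of_real (radius j)) \<zeta>) * b (restrict \<zeta> {..<m}) * ?c \<zeta>) \<longlonglongrightarrow> 0"
      by (simp only: analytic_coeff_zero[where \<alpha>=\<alpha> and \<beta>=\<beta>, OF h\<phi> radius_bounds(2,3) b C ab] tendsto_const)
  qed
  finally show ?thesis .
qed

text \<open>The candidate \<open>H\<close> is the average of \<open>h\<close> over the last variable. It has the same Fourier
  coefficients as \<open>h\<close>: those of frequency \<open>0\<close> in the last variable agree by Fubini, and all others
  vanish for both functions.\<close>

lemma last_variable_independent:
  assumes h [measurable]: "h \<in> borel_measurable (torus (Suc m))"
    and h1: "\<And>\<zeta>. cmod (h \<zeta>) \<le> 1"
    and z: "\<And>\<alpha> \<beta>. \<alpha> m \<noteq> \<beta> m \<Longrightarrow> (LINT \<zeta>|torus (Suc m). h \<zeta> * (mon (Suc m) \<alpha> \<zeta> * cnj (mon (Suc m) \<beta> \<zeta>))) = 0"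
  obtains H where "H \<in> borel_measurable (torus (Suc m))" "depends_only_on (Suc m) {..<m} H"
    "AE \<zeta> in torus (Suc m). h \<zeta> = H \<zeta>"
proof
  let ?n = "Suc m"
  interpret C: prob_space circle by (rule prob_space_circle)
  interpret T: prob_space "torus ?n" by (rule prob_space_torus)
  define H where "H \<zeta> = (LINT w|circle. h (\<zeta>(m := w)))" for \<zeta>
  have "(\<lambda>p. (fst p)(m := snd p)) \<in> torus ?n \<Otimes>\<^sub>M circle \<rightarrow>\<^sub>M torus ?n"
    unfolding torus_def
  proof (rule measurable_PiM_single')
    fix i assume i: "i \<in> {..<?n}"
    have c: "(\<lambda>p. fst p i) \<in> PiM {..<?n} (\<lambda>_. circle) \<Otimes>\<^sub>M circle \<rightarrow>\<^sub>M circle"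
      by (rule measurable_compose[OF measurable_fst measurable_component_singleton[OF i]])
    show "(\<lambda>p. ((fst p)(m := snd p)) i) \<in> PiM {..<?n} (\<lambda>_. circle) \<Otimes>\<^sub>M circle \<rightarrow>\<^sub>M circle"
      using c by (cases "i = m") simp_all
  next
    show "(\<lambda>p. (fst p)(m := snd p)) \<in> space (PiM {..<?n} (\<lambda>_. circle) \<Otimes>\<^sub>M circle) \<rightarrow> ({..<?n} \<rightarrow>\<^sub>E space circle)"
    proof (rule Pi_I)
      fix p assume "p \<in> space (PiM {..<?n} (\<lambda>_. circle) \<Otimes>\<^sub>M circle)"
      then have "fst p \<in> space (torus ?n)" "cmod (snd p) = 1"
        by (auto simp: space_pair_measure torus_def)
      from upd_torus_Suc[OF this] show "(fst p)(m := snd p) \<in> {..<?n} \<rightarrow>\<^sub>E space circle"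
        by (simp only: space_torus space_circle)
    qed
  qed
  from measurable_compose[OF this h]
  have hm: "(\<lambda>(\<zeta>, w). h (\<zeta>(m := w))) \<in> borel_measurable (torus ?n \<Otimes>\<^sub>M circle)"
    by (simp add: case_prod_unfold del: fun_upd_apply)
  show Hm: "H \<in> borel_measurable (torus ?n)"
    unfolding H_def by (rule C.borel_measurable_lebesgue_integral[OF hm])
  show "depends_only_on ?n {..<m} H"
    unfolding depends_only_on_def
  proof (intro ballI impI)
    fix \<zeta> \<xi> assume e: "\<zeta> \<in> space (torus ?n)" "\<xi> \<in> space (torus ?n)" "\<forall>i\<in>{..<m}. \<zeta> i = \<xi> i"
    have "\<zeta> i = \<xi> i" if "i \<noteq> m" for i
    proof (cases "i < m")
      case False
      with that have "i \<notin> {..<?n}" by simp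
      then show ?thesis using e(1,2) unfolding space_torus by (metis PiE_arb)
    qed (use e in simp)
    then have "\<zeta>(m := w) = \<xi>(m := w)" for w by (simp add: fun_eq_iff)
    then show "H \<zeta> = H \<xi>" by (simp add: H_def del: fun_upd_apply)
  qed
  have H1: "cmod (H \<zeta>) \<le> 1" for \<zeta>
  proof -
    have "cmod (H \<zeta>) \<le> (LINT w|circle. cmod (h (\<zeta>(m := w))))" unfolding H_def by (rule integral_norm_bound)
    also have "\<dots> \<le> (LINT w|circle. 1)"
    proof (cases "integrable circle (\<lambda>w. cmod (h (\<zeta>(m := w))))")
      case True
      then show ?thesis by (intro integral_mono) (auto simp: h1)
    qed (simp add: not_integrable_integral_eq)
    finally show ?thesis using C.prob_space by simp
  qed
  have hi: "integrable (torus ?n) h" and Hi: "integrable (torus ?n) H"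
    using h1 H1 Hm by (auto intro!: T.integrable_const_bound[where B=1])
  have Hupd: "H (\<zeta>(m := w)) = H \<zeta>" for \<zeta> w by (simp add: H_def)
  have "(LINT \<zeta>|torus ?n. (h \<zeta> + (-1) * H \<zeta>) * (mon ?n \<alpha> \<zeta> * cnj (mon ?n \<beta> \<zeta>))) = 0" for \<alpha> \<beta>
  proof -
    let ?c = "\<lambda>\<zeta>. mon ?n \<alpha> \<zeta> * cnj (mon ?n \<beta> \<zeta>)"
    let ?d = "\<lambda>\<zeta>. mon m \<alpha> \<zeta> * cnj (mon m \<beta> \<zeta>)"
    have c: "?c (\<zeta>(m := w)) = ?d \<zeta> * (w ^ \<alpha> m * cnj w ^ \<beta> m)" for \<zeta> w
      unfolding mon_upd complex_cnj_mult complex_cnj_power by (simp only: mult_ac)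
    have i1: "integrable (torus ?n) (\<lambda>\<zeta>. h \<zeta> * ?c \<zeta>)" and i2: "integrable (torus ?n) (\<lambda>\<zeta>. H \<zeta> * ?c \<zeta>)"
      by (intro integrable_mult_monomials hi Hi)+
    have "(LINT \<zeta>|torus ?n. H \<zeta> * ?c \<zeta>) = (LINT \<zeta>|torus m. LINT w|circle. (H \<zeta> * ?d \<zeta>) * (w ^ \<alpha> m * cnj w ^ \<beta> m))"
      unfolding integral_torus_Suc[OF i2] Hupd c by (simp only: mult.assoc)
    also have "\<dots> = (LINT \<zeta>|torus m. (H \<zeta> * ?d \<zeta>) * (if \<alpha> m = \<beta> m then 1 else 0))"
      by (simp only: integral_mult_right_zero integral_circle_monomials)
    finally have eH: "(LINT \<zeta>|torus ?n. H \<zeta> * ?c \<zeta>) = \<dots>" .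
    have "(LINT \<zeta>|torus ?n. h \<zeta> * ?c \<zeta>) = (LINT \<zeta>|torus ?n. H \<zeta> * ?c \<zeta>)"
    proof (cases "\<alpha> m = \<beta> m")
      case False
      then show ?thesis using z[of \<alpha> \<beta>, OF False] unfolding eH by (simp del: cnj_prod)
    next
      case True
      have "(LINT \<zeta>|torus ?n. h \<zeta> * ?c \<zeta>) = (LINT \<zeta>|torus m. LINT w|circle. h (\<zeta>(m := w)) * ?d \<zeta>)"
        unfolding integral_torus_Suc[OF i1]
      proof (intro Bochner_Integration.integral_cong refl)
        fix \<zeta> w assume "w \<in> space circle"
        then have "(w * cnj w) ^ \<beta> m = 1" by (simp add: complex_norm_square[symmetric])
        then have "w ^ \<alpha> m * cnj w ^ \<beta> m = 1" using True by (simp add: power_mult_distrib)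
        then show "h (\<zeta>(m := w)) * ?c (\<zeta>(m := w)) = h (\<zeta>(m := w)) * ?d \<zeta>" unfolding c by (simp only: mult_1_right)
      qed
      also have "\<dots> = (LINT \<zeta>|torus m. H \<zeta> * ?d \<zeta>)"
        unfolding H_def by (simp only: integral_mult_left_zero)
      finally show ?thesis unfolding eH using True by (simp only: simp_thms if_True mult_1_right)
    qed
    moreover have "(LINT \<zeta>|torus ?n. (h \<zeta> + (-1) * H \<zeta>) * ?c \<zeta>) = (LINT \<zeta>|torus ?n. h \<zeta> * ?c \<zeta>) - (LINT \<zeta>|torus ?n. H \<zeta> * ?c \<zeta>)"
      using Bochner_Integration.integral_diff[OF i1 i2] by (simp add: algebra_simps del: cnj_prod)
    ultimately show ?thesis by simp
  qed
  then have "null_coeffs ?n (\<lambda>\<zeta>. h \<zeta> + (-1) * H \<zeta>)"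
    unfolding null_coeffs_def using hi Hi by (intro conjI allI) auto
  from null_coeffs_imp_AE_0[OF this] show "AE \<zeta> in torus ?n. h \<zeta> = H \<zeta>"
    by eventually_elim simp
qed

section \<open>Unitary equivalence of sequence-based invariant subspaces\<close>

lemma H2_norm_zero: "H2_norm n (\<lambda>z\<in>polydisc n. 0) = 0"
proof -
  have "(LINT \<zeta>|torus n. (cmod (bdry n (\<lambda>z\<in>polydisc n. 0) \<zeta>))\<^sup>2) = (LINT \<zeta>|torus n. 0)"
  proof (rule Bochner_Integration.integral_cong)
    fix \<zeta> assume "\<zeta> \<in> space (torus n)"
    then have "bdry n (\<lambda>z\<in>polydisc n. 0) \<zeta> = 0" by (rule bdry_restrict_eqI) simp
    then show "(cmod (bdry n (\<lambda>z\<in>polydisc n. 0) \<zeta>))\<^sup>2 = 0" by simp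
  qed simp
  then show ?thesis using H2_norm_bdry[OF H2_const[of 0 n]] by simp
qed

text \<open>The function \<open>f 0\<close> is the element of the layer of degree \<open>0\<close> that belongs to \<open>u = 1\<close>.\<close>

lemma lift_mem_sequence_based:
  assumes "sequence_based (Suc m) M f"
  shows "lift m (f 0) \<in> M"
proof -
  let ?n = "Suc m"
  have M: "M = direct_sum ?n (\<lambda>l. layer ?n (f l) l)" and f: "f 0 \<in> Hinf m"
    using assms by (auto simp: sequence_based_def is_direct_sum_def)
  define x where "x l = (if l = 0 then lift m (f 0) else (\<lambda>z\<in>polydisc ?n. 0))" for l :: nat
  have "x l \<in> layer ?n (f l) l" for l
  proof (cases "l = 0")
    case True
    have "lift m (f 0) = (\<lambda>z\<in>polydisc ?n. f 0 (restrict z {..<?n - 1}) * (\<lambda>z\<in>polydisc m. 1) (restrict z {..<?n - 1}) * z (?n - 1) ^ 0)"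
      unfolding lift_def by (rule restrict_ext) (simp add: restrict_polydisc)
    then have "lift m (f 0) \<in> layer ?n (f 0) 0"
      unfolding layer_def by (intro CollectI exI[of _ "\<lambda>z\<in>polydisc m. 1"] conjI) (simp_all only: diff_Suc_1 H2_const)
    then show ?thesis using True by (simp only: x_def simp_thms if_True)
  next
    case False
    have "(\<lambda>z\<in>polydisc ?n. 0) = (\<lambda>z\<in>polydisc ?n. f l (restrict z {..<?n - 1}) * (\<lambda>z\<in>polydisc m. 0) (restrict z {..<?n - 1}) * z (?n - 1) ^ l)"
      by (rule restrict_ext) (simp add: restrict_polydisc)
    then have "(\<lambda>z\<in>polydisc ?n. 0) \<in> layer ?n (f l) l"
      unfolding layer_def by (intro CollectI exI[of _ "\<lambda>z\<in>polydisc m. 0"] conjI) (simp_all only: diff_Suc_1 H2_const)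
    then show ?thesis using False by (simp only: x_def simp_thms if_False)
  qed
  moreover have "H2_tendsto ?n (\<lambda>N. \<lambda>z\<in>polydisc ?n. \<Sum>l<N. x l z) (lift m (f 0))"
    unfolding H2_tendsto_def
  proof (rule tendsto_eventually)
    show "\<forall>\<^sub>F N in sequentially. H2_norm ?n (\<lambda>z\<in>polydisc ?n. (\<lambda>z\<in>polydisc ?n. \<Sum>l<N. x l z) z - lift m (f 0) z) = 0"
    proof (rule eventually_sequentiallyI[of 1])
      fix N :: nat assume N: "1 \<le> N"
      have "(\<Sum>l<N. x l z) = lift m (f 0) z" if "z \<in> polydisc ?n" for z
      proof -
        have "(\<Sum>l<N. x l z) = (\<Sum>l<N. if l = 0 then lift m (f 0) z else 0)"
          using that by (intro sum.cong) (auto simp: x_def)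
        then show ?thesis using N by simp
      qed
      then have "(\<lambda>z\<in>polydisc ?n. (\<lambda>z\<in>polydisc ?n. \<Sum>l<N. x l z) z - lift m (f 0) z) = (\<lambda>z\<in>polydisc ?n. 0)"
        by (intro restrict_ext) simp
      then show "H2_norm ?n (\<lambda>z\<in>polydisc ?n. (\<lambda>z\<in>polydisc ?n. \<Sum>l<N. x l z) z - lift m (f 0) z) = 0"
        by (simp only: H2_norm_zero)
    qed
  qed
  ultimately show ?thesis
    unfolding M direct_sum_def using Hinf_subset_H2[OF lift_Hinf[OF f]] by blast
qed

lemma Hinf_monomial: "(\<lambda>z\<in>polydisc n. mon n \<alpha> z) \<in> Hinf n"
proof -
  have "(\<lambda>z\<in>polydisc n. \<Sum>\<beta>\<in>{\<alpha>}. 1 * mon n \<beta> z) \<in> Hinf n" by (rule Hinf_polynomial) simp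
  moreover have "(\<lambda>z\<in>polydisc n. \<Sum>\<beta>\<in>{\<alpha>}. 1 * mon n \<beta> z) = (\<lambda>z\<in>polydisc n. mon n \<alpha> z)"
    by (rule restrict_ext) simp
  ultimately show ?thesis by metis
qed

lemma bdry_monomial_mult:
  assumes f: "f \<in> H2 n"
  shows "AE \<zeta> in torus n. bdry n (\<lambda>z\<in>polydisc n. (\<lambda>z\<in>polydisc n. mon n \<alpha> z) z * f z) \<zeta> = mon n \<alpha> \<zeta> * bdry n f \<zeta>"
  using bdry_mult[OF Hinf_subset_H2[OF Hinf_monomial[of \<alpha> n]] f] AE_space
proof eventually_elim
  case (elim \<zeta>)
  have "bdry n (\<lambda>z\<in>polydisc n. \<Sum>\<beta>\<in>{\<alpha>}. 1 * mon n \<beta> z) \<zeta> = (\<Sum>\<beta>\<in>{\<alpha>}. 1 * mon n \<beta> \<zeta>)"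
    by (rule bdry_polynomial[OF elim(2)])
  moreover have "(\<lambda>z\<in>polydisc n. \<Sum>\<beta>\<in>{\<alpha>}. 1 * mon n \<beta> z) = (\<lambda>z\<in>polydisc n. mon n \<alpha> z)"
    by (rule restrict_ext) simp
  ultimately show ?case using elim(1) by simp
qed

text \<open>The Fourier coefficients of \<open>f\<^sup>* * cnj g\<^sup>*\<close> are inner products of monomial multiples of \<open>f\<close> and \<open>g\<close>.\<close>

lemma H2_inner_monomial_mult:
  assumes f: "f \<in> H2 n" and g: "g \<in> H2 n"
  shows "H2_inner n (\<lambda>z\<in>polydisc n. (\<lambda>z\<in>polydisc n. mon n \<alpha> z) z * f z) (\<lambda>z\<in>polydisc n. (\<lambda>z\<in>polydisc n. mon n \<beta> z) z * g z) =
    (LINT \<zeta>|torus n. bdry n f \<zeta> * cnj (bdry n g \<zeta>) * (mon n \<alpha> \<zeta> * cnj (mon n \<beta> \<zeta>)))"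
proof -
  let ?f = "\<lambda>z\<in>polydisc n. (\<lambda>z\<in>polydisc n. mon n \<alpha> z) z * f z"
  let ?g = "\<lambda>z\<in>polydisc n. (\<lambda>z\<in>polydisc n. mon n \<beta> z) z * g z"
  have fg: "?f \<in> H2 n" "?g \<in> H2 n" by (intro H2_Hinf_mult Hinf_monomial f g)+
  have "(LINT \<zeta>|torus n. bdry n ?f \<zeta> * cnj (bdry n ?g \<zeta>)) =
    (LINT \<zeta>|torus n. bdry n f \<zeta> * cnj (bdry n g \<zeta>) * (mon n \<alpha> \<zeta> * cnj (mon n \<beta> \<zeta>)))"
  proof (rule integral_cong_AE)
    show "(\<lambda>\<zeta>. bdry n ?f \<zeta> * cnj (bdry n ?g \<zeta>)) \<in> borel_measurable (torus n)"
      using H2_product_limit(1)[OF fg] by (rule borel_measurable_integrable)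
    show "(\<lambda>\<zeta>. bdry n f \<zeta> * cnj (bdry n g \<zeta>) * (mon n \<alpha> \<zeta> * cnj (mon n \<beta> \<zeta>))) \<in> borel_measurable (torus n)"
      by (rule borel_measurable_integrable, rule integrable_mult_monomials, rule H2_product_limit(1)[OF f g])
    show "AE \<zeta> in torus n. bdry n ?f \<zeta> * cnj (bdry n ?g \<zeta>) = bdry n f \<zeta> * cnj (bdry n g \<zeta>) * (mon n \<alpha> \<zeta> * cnj (mon n \<beta> \<zeta>))"
      using bdry_monomial_mult[OF f, of \<alpha>] bdry_monomial_mult[OF g, of \<beta>]
    proof eventually_elim
      case (elim \<zeta>)
      show ?case unfolding elim complex_cnj_mult by (simp only: mult_ac)
    qed
  qed
  then show ?thesis by (simp only: H2_inner_bdry[OF fg])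
qed

text \<open>A unitary operator that commutes with multiplication by monomials preserves the inner products of
  all monomial multiples of \<open>f\<close> and \<open>g\<close>, which are the Fourier coefficients of the two sides.\<close>

lemma unitary_boundary_relation:
  assumes M1: "invariant_subspace n M1" and M2: "invariant_subspace n M2"
    and U: "unitary_operator n M1 M2 U"
    and comm: "\<And>\<phi> f. \<phi> \<in> Hinf n \<Longrightarrow> f \<in> M1 \<Longrightarrow> U (\<lambda>z\<in>polydisc n. \<phi> z * f z) = (\<lambda>z\<in>polydisc n. \<phi> z * U f z)"
    and f: "f \<in> M1" and g: "g \<in> M1"
  shows "AE \<zeta> in torus n. bdry n (U f) \<zeta> * cnj (bdry n (U g) \<zeta>) = bdry n f \<zeta> * cnj (bdry n g \<zeta>)"
proof -
  have bij: "bij_betw U M1 M2" and inner: "\<And>f g. f \<in> M1 \<Longrightarrow> g \<in> M1 \<Longrightarrow> H2_inner n (U f) (U g) = H2_inner n f g"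
    using U by (auto simp: unitary_operator_def)
  have H: "f \<in> H2 n" "g \<in> H2 n" using invariant_subspaceD(1)[OF M1] f g by auto
  have UH: "U f \<in> H2 n" "U g \<in> H2 n"
    using invariant_subspaceD(1)[OF M2] bij_betwE[OF bij] f g by auto
  let ?A = "\<lambda>\<zeta>. bdry n (U f) \<zeta> * cnj (bdry n (U g) \<zeta>)" and ?B = "\<lambda>\<zeta>. bdry n f \<zeta> * cnj (bdry n g \<zeta>)"
  have int: "integrable (torus n) ?A" "integrable (torus n) ?B"
    by (intro H2_product_limit(1) H UH)+
  have eq: "(LINT \<zeta>|torus n. ?A \<zeta> * (mon n \<alpha> \<zeta> * cnj (mon n \<beta> \<zeta>))) = (LINT \<zeta>|torus n. ?B \<zeta> * (mon n \<alpha> \<zeta> * cnj (mon n \<beta> \<zeta>)))" for \<alpha> \<beta>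
  proof -
    let ?m = "\<lambda>\<alpha>. \<lambda>z\<in>polydisc n. mon n \<alpha> z"
    have mf: "(\<lambda>z\<in>polydisc n. ?m \<alpha> z * f z) \<in> M1" and mg: "(\<lambda>z\<in>polydisc n. ?m \<beta> z * g z) \<in> M1"
      by (intro invariant_subspace_Hinf_mult[OF M1] Hinf_monomial f g)+
    have "H2_inner n (\<lambda>z\<in>polydisc n. ?m \<alpha> z * U f z) (\<lambda>z\<in>polydisc n. ?m \<beta> z * U g z) =
      H2_inner n (\<lambda>z\<in>polydisc n. ?m \<alpha> z * f z) (\<lambda>z\<in>polydisc n. ?m \<beta> z * g z)"
      using inner[OF mf mg] by (simp only: comm[OF Hinf_monomial f] comm[OF Hinf_monomial g])
    then show ?thesis by (simp only: H2_inner_monomial_mult[OF UH] H2_inner_monomial_mult[OF H])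
  qed
  have "null_coeffs n (\<lambda>\<zeta>. ?A \<zeta> + (-1) * ?B \<zeta>)"
    unfolding null_coeffs_def
  proof (intro conjI allI)
    show "integrable (torus n) (\<lambda>\<zeta>. ?A \<zeta> + (-1) * ?B \<zeta>)"
      by (intro Bochner_Integration.integrable_add integrable_mult_right int)
    fix \<alpha> \<beta>
    have "(LINT \<zeta>|torus n. (?A \<zeta> + (-1) * ?B \<zeta>) * (mon n \<alpha> \<zeta> * cnj (mon n \<beta> \<zeta>))) =
      (LINT \<zeta>|torus n. ?A \<zeta> * (mon n \<alpha> \<zeta> * cnj (mon n \<beta> \<zeta>)) - ?B \<zeta> * (mon n \<alpha> \<zeta> * cnj (mon n \<beta> \<zeta>)))"
      by (intro Bochner_Integration.integral_cong refl) (simp add: algebra_simps del: cnj_prod)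
    also have "\<dots> = 0"
      by (subst Bochner_Integration.integral_diff[OF integrable_mult_monomials[OF int(1)] integrable_mult_monomials[OF int(2)]]) (simp only: eq diff_self)
    finally show "(LINT \<zeta>|torus n. (?A \<zeta> + (-1) * ?B \<zeta>) * (mon n \<alpha> \<zeta> * cnj (mon n \<beta> \<zeta>))) = 0" .
  qed
  from null_coeffs_imp_AE_0[OF this] show ?thesis by eventually_elim simp
qed

text \<open>With \<open>F = f 0\<close> and \<open>\<phi> = U F\<close>, the quotient \<open>h\<close> of the boundary functions of \<open>\<phi>\<close> and \<open>F\<close> is
  unimodular and represents \<open>U\<close>, by \<open>unitary_boundary_relation\<close> for the pairs \<open>(F, F)\<close> and
  \<open>(x, F)\<close>. As \<open>F\<close> depends on the first variables only, \<open>h\<close> has no negative frequencies in the last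
  variable. If \<open>\<psi>\<close> denotes the preimage of \<open>G = g 0\<close>, then \<open>cnj h\<close> is the quotient of the boundary
  functions of \<open>\<psi>\<close> and \<open>G\<close>, so \<open>h\<close> has no positive ones either.\<close>

lemma unimodular_from_unitary:
  assumes s1: "sequence_based (Suc m) M1 f" and s2: "sequence_based (Suc m) M2 g"
    and ue: "unitarily_equivalent (Suc m) M1 M2"
  shows "\<exists>h. unimodular (Suc m) h \<and> depends_only_on (Suc m) {..<m} h \<and> boundary_multiple (Suc m) M2 h M1"
proof -
  let ?n = "Suc m"
  have M1: "invariant_subspace ?n M1" and M2: "invariant_subspace ?n M2"
    and f0: "f 0 \<in> Hinf m" "inverse_in_Linf m (f 0)" and g0: "g 0 \<in> Hinf m" "inverse_in_Linf m (g 0)"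
    using s1 s2 by (auto simp: sequence_based_def)
  obtain U where U: "unitary_operator ?n M1 M2 U"
    and comm: "\<And>\<phi> f. \<phi> \<in> Hinf ?n \<Longrightarrow> f \<in> M1 \<Longrightarrow> U (\<lambda>z\<in>polydisc ?n. \<phi> z * f z) = (\<lambda>z\<in>polydisc ?n. \<phi> z * U f z)"
    using ue unfolding unitarily_equivalent_def by blast
  have bij: "bij_betw U M1 M2" using U by (simp add: unitary_operator_def)
  have rel: "AE \<zeta> in torus ?n. bdry ?n (U x) \<zeta> * cnj (bdry ?n (U y) \<zeta>) = bdry ?n x \<zeta> * cnj (bdry ?n y \<zeta>)"
    if "x \<in> M1" "y \<in> M1" for x y
    by (rule unitary_boundary_relation[OF M1 M2 U comm that])
  define F where "F = lift m (f 0)"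
  define G where "G = lift m (g 0)"
  have F: "F \<in> M1" and G: "G \<in> M2"
    using lift_mem_sequence_based[OF s1] lift_mem_sequence_based[OF s2] by (simp_all add: F_def G_def)
  define \<phi> where "\<phi> = U F"
  define \<psi> where "\<psi> = inv_into M1 U G"
  have \<phi>: "\<phi> \<in> M2" using bij_betwE[OF bij] F by (simp add: \<phi>_def)
  have \<psi>: "\<psi> \<in> M1" "U \<psi> = G"
    using G bij bij_betw_inv_into_right[OF bij G] bij_betwE[OF bij_betw_inv_into[OF bij]] by (auto simp: \<psi>_def)
  have H2s: "x \<in> H2 ?n" if "x \<in> M1 \<union> M2" for x
    using that invariant_subspaceD(1)[OF M1] invariant_subspaceD(1)[OF M2] by blast
  obtain b C where b: "b \<in> borel_measurable (torus m)" "\<And>\<zeta>. cmod (b \<zeta>) \<le> C"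
    "AE \<zeta> in torus ?n. bdry ?n F \<zeta> * b (restrict \<zeta> {..<m}) = 1"
    unfolding F_def by (rule bounded_inverse_lift[OF f0]) blast
  obtain b' C' where b': "b' \<in> borel_measurable (torus m)" "\<And>\<zeta>. cmod (b' \<zeta>) \<le> C'"
    "AE \<zeta> in torus ?n. bdry ?n G \<zeta> * b' (restrict \<zeta> {..<m}) = 1"
    unfolding G_def by (rule bounded_inverse_lift[OF g0]) blast
  define h1 where "h1 \<zeta> = bdry ?n \<phi> \<zeta> * b (restrict \<zeta> {..<m})" for \<zeta>
  \<comment> \<open>Since \<open>h1\<close> is unimodular only almost everywhere, it is truncated to be bounded everywhere.\<close>
  define h where "h \<zeta> = (if cmod (h1 \<zeta>) \<le> 1 then h1 \<zeta> else 0)" for \<zeta>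
  have h1m [measurable]: "h1 \<in> borel_measurable (torus ?n)"
    unfolding h1_def using \<phi>
    by (intro borel_measurable_times bdry_measurable H2_holomorphic H2s measurable_compose[OF measurable_restrict_torus b(1)]) auto
  have hm [measurable]: "h \<in> borel_measurable (torus ?n)" unfolding h_def by measurable
  have hle: "cmod (h \<zeta>) \<le> 1" for \<zeta> by (simp add: h_def)
  have h1_norm: "AE \<zeta> in torus ?n. cmod (h1 \<zeta>) = 1"
    using rel[OF F F] b(3)
  proof eventually_elim
    case (elim \<zeta>)
    have "(cmod (bdry ?n \<phi> \<zeta>))\<^sup>2 = (cmod (bdry ?n F \<zeta>))\<^sup>2"
      using elim(1) unfolding \<phi>_def[symmetric] complex_norm_square[symmetric] of_real_eq_iff .
    then have "cmod (bdry ?n \<phi> \<zeta>) = cmod (bdry ?n F \<zeta>)" by simp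
    then have "cmod (h1 \<zeta>) = cmod (bdry ?n F \<zeta> * b (restrict \<zeta> {..<m}))" by (simp add: h1_def norm_mult)
    with elim(2) show ?case by simp
  qed
  have h_eq: "AE \<zeta> in torus ?n. h \<zeta> = bdry ?n \<phi> \<zeta> * b (restrict \<zeta> {..<m})"
    using h1_norm by eventually_elim (simp add: h_def h1_def)
  have h_norm: "AE \<zeta> in torus ?n. cmod (h \<zeta>) = 1"
    using h1_norm by eventually_elim (simp add: h_def)
  have mult: "AE \<zeta> in torus ?n. bdry ?n (U x) \<zeta> = h \<zeta> * bdry ?n x \<zeta>" if x: "x \<in> M1" for x
    using rel[OF x F] h_eq h_norm b(3)
  proof eventually_elim
    case (elim \<zeta>)
    let ?b = "b (restrict \<zeta> {..<m})"
    have "bdry ?n (U x) \<zeta> * cnj (h \<zeta>) = (bdry ?n (U x) \<zeta> * cnj (bdry ?n \<phi> \<zeta>)) * cnj ?b"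
      using elim(2) by simp
    also have "\<dots> = bdry ?n x \<zeta> * cnj (bdry ?n F \<zeta> * ?b)"
      using elim(1) by (simp add: \<phi>_def)
    finally have 1: "bdry ?n (U x) \<zeta> * cnj (h \<zeta>) = bdry ?n x \<zeta>" using elim(4) by simp
    have 2: "h \<zeta> * cnj (h \<zeta>) = 1" using elim(3) by (simp add: complex_norm_square[symmetric])
    have "bdry ?n (U x) \<zeta> = bdry ?n (U x) \<zeta> * (h \<zeta> * cnj (h \<zeta>))" unfolding 2 by simp
    also have "\<dots> = h \<zeta> * (bdry ?n (U x) \<zeta> * cnj (h \<zeta>))" by (simp only: mult_ac)
    finally show ?case unfolding 1 .
  qed
  have cnj_h: "AE \<zeta> in torus ?n. cnj (h \<zeta>) = bdry ?n \<psi> \<zeta> * b' (restrict \<zeta> {..<m})"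
    using mult[OF \<psi>(1)] h_norm b'(3)
  proof eventually_elim
    case (elim \<zeta>)
    let ?b = "b' (restrict \<zeta> {..<m})"
    have 2: "h \<zeta> * cnj (h \<zeta>) = 1" using elim(2) by (simp add: complex_norm_square[symmetric])
    have "cnj (h \<zeta>) = cnj (h \<zeta>) * (h \<zeta> * bdry ?n \<psi> \<zeta> * ?b)"
      using elim(1,3) by (simp add: \<psi>(2))
    also have "\<dots> = (h \<zeta> * cnj (h \<zeta>)) * (bdry ?n \<psi> \<zeta> * ?b)" by (simp only: mult_ac)
    finally show ?case unfolding 2 by simp
  qed
  have z: "(LINT \<zeta>|torus ?n. h \<zeta> * (mon ?n \<alpha> \<zeta> * cnj (mon ?n \<beta> \<zeta>))) = 0" if "\<alpha> m \<noteq> \<beta> m" for \<alpha> \<beta>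
  proof (cases "\<beta> m < \<alpha> m")
    case True
    show ?thesis
      by (rule quotient_coeff_zero[where \<alpha>=\<alpha> and \<beta>=\<beta>, OF hm H2s[of \<phi>] b(1,2) h_eq True]) (use \<phi> in simp)
  next
    case False
    then have lt: "\<alpha> m < \<beta> m" using that by simp
    have cm: "(\<lambda>\<zeta>. cnj (h \<zeta>)) \<in> borel_measurable (torus ?n)" by measurable
    have "(LINT \<zeta>|torus ?n. cnj (h \<zeta>) * (mon ?n \<beta> \<zeta> * cnj (mon ?n \<alpha> \<zeta>))) = 0"
      by (rule quotient_coeff_zero[where \<alpha>=\<beta> and \<beta>=\<alpha>, OF cm H2s[of \<psi>] b'(1,2) cnj_h lt]) (use \<psi> in simp)
    moreover have "(LINT \<zeta>|torus ?n. cnj (h \<zeta>) * (mon ?n \<beta> \<zeta> * cnj (mon ?n \<alpha> \<zeta>))) =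
      (LINT \<zeta>|torus ?n. cnj (h \<zeta> * (mon ?n \<alpha> \<zeta> * cnj (mon ?n \<beta> \<zeta>))))"
      by (intro Bochner_Integration.integral_cong refl) (simp only: complex_cnj_mult complex_cnj_cnj mult_ac)
    ultimately show ?thesis
      by (simp only: Bochner_Integration.integral_cnj complex_cnj_zero_iff)
  qed
  obtain H where H: "H \<in> borel_measurable (torus ?n)" "depends_only_on ?n {..<m} H" "AE \<zeta> in torus ?n. h \<zeta> = H \<zeta>"
    using last_variable_independent[OF hm hle z] by blast
  have "unimodular ?n H"
    unfolding unimodular_def
  proof
    show "AE \<zeta> in torus ?n. cmod (H \<zeta>) = 1" using H(3) h_norm by eventually_elim simp
  qed (rule H)
  moreover have bm: "AE \<zeta> in torus ?n. boundary_fun ?n (U x) \<zeta> = H \<zeta> * boundary_fun ?n x \<zeta>" if x: "x \<in> M1" for x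
  proof -
    have Ux: "U x \<in> M2" using bij_betwE[OF bij] x by blast
    have "AE \<zeta> in torus ?n. boundary_fun ?n (U x) \<zeta> = bdry ?n (U x) \<zeta>" "AE \<zeta> in torus ?n. boundary_fun ?n x \<zeta> = bdry ?n x \<zeta>"
      by (rule AE_boundary_fun, rule H2s, use x Ux in blast)+
    then show ?thesis using mult[OF x] H(3) by eventually_elim simp
  qed
  have "boundary_multiple ?n M2 H M1"
    unfolding boundary_multiple_def
  proof (intro conjI ballI)
    fix x assume "x \<in> M1"
    then show "\<exists>y\<in>M2. AE \<zeta> in torus ?n. boundary_fun ?n y \<zeta> = H \<zeta> * boundary_fun ?n x \<zeta>"
      using bm bij_betwE[OF bij] by blast
  next
    fix y assume "y \<in> M2"
    then obtain x where "x \<in> M1" "U x = y" using bij by (auto simp: bij_betw_def)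
    then show "\<exists>x\<in>M1. AE \<zeta> in torus ?n. boundary_fun ?n y \<zeta> = H \<zeta> * boundary_fun ?n x \<zeta>"
      using bm by blast
  qed
  ultimately show ?thesis using H(2) by blast
qed

text \<open>The operator sends \<open>x\<close> to the element of \<open>M2\<close> with boundary function \<open>h * x\<^sup>*\<close>. All its properties
  can be read off on the torus, where boundary functions determine elements of \<open>H2\<close>.\<close>

lemma unitary_from_unimodular:
  assumes M1: "invariant_subspace n M1" and M2: "invariant_subspace n M2"
    and h: "unimodular n h" and bm: "boundary_multiple n M2 h M1"
  shows "unitarily_equivalent n M1 M2"
proof -
  have H2s: "x \<in> H2 n" if "x \<in> M1 \<union> M2" for x
    using that invariant_subspaceD(1)[OF M1] invariant_subspaceD(1)[OF M2] by blast
  have h1: "AE \<zeta> in torus n. cmod (h \<zeta>) = 1" using h by (simp add: unimodular_def)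
  define R where "R x y \<longleftrightarrow> (AE \<zeta> in torus n. bdry n y \<zeta> = h \<zeta> * bdry n x \<zeta>)" for x y
  have R: "(AE \<zeta> in torus n. boundary_fun n y \<zeta> = h \<zeta> * boundary_fun n x \<zeta>) \<longleftrightarrow> R x y" if "x \<in> M1" "y \<in> M2" for x y
  proof -
    have x: "AE \<zeta> in torus n. boundary_fun n x \<zeta> = bdry n x \<zeta>" and y: "AE \<zeta> in torus n. boundary_fun n y \<zeta> = bdry n y \<zeta>"
      by (rule AE_boundary_fun, rule H2s, use that in blast)+
    show ?thesis
    proof
      assume "AE \<zeta> in torus n. boundary_fun n y \<zeta> = h \<zeta> * boundary_fun n x \<zeta>"
      then show "R x y" unfolding R_def using x y by eventually_elim simp
    next
      assume "R x y"
      then show "AE \<zeta> in torus n. boundary_fun n y \<zeta> = h \<zeta> * boundary_fun n x \<zeta>"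
        unfolding R_def using x y by eventually_elim simp
    qed
  qed
  have ex1: "\<exists>y\<in>M2. R x y" if "x \<in> M1" for x
    using bm R that unfolding boundary_multiple_def by blast
  have ex2: "\<exists>x\<in>M1. R x y" if "y \<in> M2" for y
    using bm R that unfolding boundary_multiple_def by blast
  have uniq: "y = y'" if "R x y" "R x y'" "y \<in> M2" "y' \<in> M2" for x y y'
  proof (rule H2_eqI)
    show "AE \<zeta> in torus n. bdry n y \<zeta> = bdry n y' \<zeta>"
      using that(1,2) unfolding R_def by eventually_elim simp
  qed (use H2s that in auto)
  have uniq': "x = x'" if "R x y" "R x' y" "x \<in> M1" "x' \<in> M1" for x x' y
  proof (rule H2_eqI)
    show "AE \<zeta> in torus n. bdry n x \<zeta> = bdry n x' \<zeta>"
      using that(1,2) h1 unfolding R_def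
    proof eventually_elim
      case (elim \<zeta>)
      then have "h \<zeta> \<noteq> 0" by auto
      then show ?case using elim by simp
    qed
  qed (use H2s that in auto)
  define U where "U x = (SOME y. y \<in> M2 \<and> R x y)" for x
  have U: "U x \<in> M2" "R x (U x)" if "x \<in> M1" for x
    using someI_ex[of "\<lambda>y. y \<in> M2 \<and> R x y"] ex1[OF that] unfolding U_def by auto
  have Ueq: "U x = y" if "x \<in> M1" "y \<in> M2" "R x y" for x y
    by (rule uniq[OF U(2)[OF that(1)] that(3) U(1)[OF that(1)] that(2)])
  note D1 = invariant_subspaceD[OF M1] and D2 = invariant_subspaceD[OF M2]
  have bij: "bij_betw U M1 M2"
    unfolding bij_betw_def
  proof
    show "inj_on U M1"
    proof (rule inj_onI)
      fix x x' assume x: "x \<in> M1" "x' \<in> M1" "U x = U x'"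
      show "x = x'" by (rule uniq'[OF U(2)[OF x(1)] _ x(1,2)]) (use U(2)[OF x(2)] x(3) in simp)
    qed
    show "U ` M1 = M2"
    proof
      show "U ` M1 \<subseteq> M2" using U(1) by blast
      show "M2 \<subseteq> U ` M1"
      proof
        fix y assume y: "y \<in> M2"
        then obtain x where "x \<in> M1" "R x y" using ex2 by blast
        then show "y \<in> U ` M1" using Ueq y by blast
      qed
    qed
  qed
  have add: "U (\<lambda>z\<in>polydisc n. x z + y z) = (\<lambda>z\<in>polydisc n. U x z + U y z)" if x: "x \<in> M1" and y: "y \<in> M1" for x y
  proof (rule Ueq[OF D1(3)[OF x y] D2(3)[OF U(1)[OF x] U(1)[OF y]]])
    have H: "x \<in> H2 n" "y \<in> H2 n" "U x \<in> H2 n" "U y \<in> H2 n" using H2s x y U(1) by auto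
    show "R (\<lambda>z\<in>polydisc n. x z + y z) (\<lambda>z\<in>polydisc n. U x z + U y z)"
      using U(2)[OF x] U(2)[OF y] bdry_add[OF H(1,2)] bdry_add[OF H(3,4)] unfolding R_def
      by eventually_elim (simp add: distrib_left)
  qed
  have scal: "U (\<lambda>z\<in>polydisc n. a * x z) = (\<lambda>z\<in>polydisc n. a * U x z)" if x: "x \<in> M1" for a x
  proof (rule Ueq[OF D1(4)[OF x] D2(4)[OF U(1)[OF x]]])
    have H: "x \<in> H2 n" "U x \<in> H2 n" using H2s x U(1) by auto
    show "R (\<lambda>z\<in>polydisc n. a * x z) (\<lambda>z\<in>polydisc n. a * U x z)"
      using U(2)[OF x] bdry_cmult[OF H(1), of a] bdry_cmult[OF H(2), of a] unfolding R_def
      by eventually_elim simp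
  qed
  have comm: "U (\<lambda>z\<in>polydisc n. \<phi> z * x z) = (\<lambda>z\<in>polydisc n. \<phi> z * U x z)" if \<phi>: "\<phi> \<in> Hinf n" and x: "x \<in> M1" for \<phi> x
  proof (rule Ueq[OF invariant_subspace_Hinf_mult[OF M1 \<phi> x] invariant_subspace_Hinf_mult[OF M2 \<phi> U(1)[OF x]]])
    have H: "x \<in> H2 n" "U x \<in> H2 n" using H2s x U(1) by auto
    show "R (\<lambda>z\<in>polydisc n. \<phi> z * x z) (\<lambda>z\<in>polydisc n. \<phi> z * U x z)"
      using U(2)[OF x] bdry_mult[OF Hinf_subset_H2[OF \<phi>] H(1)] bdry_mult[OF Hinf_subset_H2[OF \<phi>] H(2)] unfolding R_def
      by eventually_elim simp
  qed
  have inner: "H2_inner n (U x) (U y) = H2_inner n x y" if x: "x \<in> M1" and y: "y \<in> M1" for x y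
  proof -
    have H: "x \<in> H2 n" "y \<in> H2 n" "U x \<in> H2 n" "U y \<in> H2 n" using H2s x y U(1) by auto
    show ?thesis
      unfolding H2_inner_bdry[OF H(1,2)] H2_inner_bdry[OF H(3,4)]
    proof (rule integral_cong_AE)
      show "(\<lambda>\<zeta>. bdry n (U x) \<zeta> * cnj (bdry n (U y) \<zeta>)) \<in> borel_measurable (torus n)"
        "(\<lambda>\<zeta>. bdry n x \<zeta> * cnj (bdry n y \<zeta>)) \<in> borel_measurable (torus n)"
        using H2_product_limit(1) H by (blast intro: borel_measurable_integrable)+
      show "AE \<zeta> in torus n. bdry n (U x) \<zeta> * cnj (bdry n (U y) \<zeta>) = bdry n x \<zeta> * cnj (bdry n y \<zeta>)"
        using U(2)[OF x] U(2)[OF y] h1 unfolding R_def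
      proof eventually_elim
        case (elim \<zeta>)
        have 2: "h \<zeta> * cnj (h \<zeta>) = 1" using elim(3) by (simp add: complex_norm_square[symmetric])
        have "bdry n (U x) \<zeta> * cnj (bdry n (U y) \<zeta>) = (h \<zeta> * cnj (h \<zeta>)) * (bdry n x \<zeta> * cnj (bdry n y \<zeta>))"
          unfolding elim(1,2) complex_cnj_mult by (simp only: mult_ac)
        then show ?case unfolding 2 by simp
      qed
    qed
  qed
  show ?thesis
    unfolding unitarily_equivalent_def unitary_operator_def
    using bij add scal comm inner by (intro exI[of _ U]) blast
qed

theorem theorem4p1:
  fixes n :: nat
    and M1 M2 :: "((nat \<Rightarrow> complex) \<Rightarrow> complex) set"
    and f g :: "nat \<Rightarrow> (nat \<Rightarrow> complex) \<Rightarrow> complex"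
  assumes "n \<ge> 2"
    and "sequence_based n M1 f"
    and "sequence_based n M2 g"
  shows "unitarily_equivalent n M1 M2 \<longleftrightarrow>
    (\<exists>h. unimodular n h \<and> depends_only_on n {..<n - 1} h \<and> boundary_multiple n M2 h M1)"
proof -
  obtain m where n: "n = Suc m" using \<open>n \<ge> 2\<close> by (cases n) auto
  show ?thesis
  proof
    assume "unitarily_equivalent n M1 M2"
    then show "\<exists>h. unimodular n h \<and> depends_only_on n {..<n - 1} h \<and> boundary_multiple n M2 h M1"
      using unimodular_from_unitary[of m M1 f M2 g] assms by (simp add: n)
  next
    assume "\<exists>h. unimodular n h \<and> depends_only_on n {..<n - 1} h \<and> boundary_multiple n M2 h M1"
    moreover have "invariant_subspace n M1" "invariant_subspace n M2"
      using assms by (auto simp: sequence_based_def)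
    ultimately show "unitarily_equivalent n M1 M2" using unitary_from_unimodular by blast
  qed
qed

end
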